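(* The graded commutative algebra $(H^*(\mathcal{A}),\cdot)$ and the Harrison cohomology class $[\mu_3]$ are invariants of the DGCA homotopy class of a simply connected Poincaré DGCA $\mathcal{A}^*$ admitting a Hodge homotopy. That is, if $\mathcal{A}^*$ and $\mathcal{A}'^*$ are simply connected Poincaré DGCAs over $\mathbb{K}$ admitting Hodge homotopies, with associated classes $[\mu_3]\in\mathrm{HHarr}^{3,-1}(H^*(\mathcal{A}),H^*(\mathcal{A}))$ and $[\mu_3']\in\mathrm{HHarr}^{3,-1}(H^*(\mathcal{A}'),H^*(\mathcal{A}'))$, and if $\mathcal{A}^*$ and $\mathcal{A}'^*$ are in the same homotopy class, then there exists an isomorphism of graded commutative algebras $\phi:(H^*(\mathcal{A}),\cdot)\to(H^*(\mathcal{A}'),\cdot)$ mapping $[\mu_3]$ to $[\mu_3']$ via the induced isomorphism of Harrison cohomologies.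
   Context: $\mathbb{K}$ is a field of characteristic zero. A DGCA is a unital differential graded commutative algebra with differential $d$ of degree $+1$. A Poincaré DGCA of degree $n$ is a DGCA $(\mathcal{A}^*=\bigoplus_{k=0}^n\mathcal{A}^k,d)$ with finite-dimensional cohomology $H^*(\mathcal{A})$ and a linear functional (fundamental class) $\int: H^n(\mathcal{A})\to\mathbb{K}$ such that the pairing on $H^*(\mathcal{A})$ given on homogeneous elements by $\langle a,b\rangle=\int a\cdot b$ if $\deg a+\deg b=n$ and $0$ otherwise is non-degenerate. It induces a pairing on $\mathcal{A}^*$: $\langle\alpha,\beta\rangle=\int[\alpha\cdot\beta]$ if $\deg\alpha+\deg\beta=n$, and $0$ otherwise. Simply connected means $H^0(\mathcal{A})=\mathbb{K}$ and $H^1(\mathcal{A})=0$. Two DGCAs are in the same homotopy class if they are connected by a zig-zag of quasi-isomorphisms of DGCAs. A Hodge homotopy is a linear operator $d^-:\mathcal{A}^*\to\mathcal{A}^{*-1}$ with $d^-d^-=0$, $d^-dd^-=d^-$, $dd^-d=d$, $\langle \mathrm{Im}(d^-),\mathrm{Im}(d^-)\rangle=0$ and $\langle\mathrm{Im}(\pi_{\mathcal{H}}),\mathrm{Im}(d^-)\rangle=0$, where $\pi_{\mathcal{H}}:=\mathrm{id}_{\mathcal{A}^*}-(dd^-+d^-d)$ (a projection). The harmonic subspace is $\mathcal{H}^*:=\mathrm{Im}(\pi_{\mathcal{H}})$; it consists of closed elements and $\mathcal{H}^*\to H^*(\mathcal{A})$, $\alpha\mapsto[\alpha]$, is an isomorphism,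 with inverse denoted $\iota:H^*(\mathcal{A})\to\mathcal{H}^*\subseteq\mathcal{A}^*$. Harrison cohomology: for a graded commutative algebra $B$, $\mathrm{CHoch}^{p,q}(B,B)$ is the space of linear maps $f:B^{\otimes p}\to B$ of degree $q$, with differential $\mathrm{CHoch}^{p,q}\to\mathrm{CHoch}^{p+1,q}$ $$(d_{\mathrm{Hoch}}f)(a_1,\dots,a_{p+1})=(-1)^{q\deg a_1}a_1f(a_2,\dots,a_{p+1})+\sum_{i=1}^p(-1)^if(a_1,\dots,a_ia_{i+1},\dots,a_{p+1})+(-1)^{p+1}f(a_1,\dots,a_p)a_{p+1}.$$ $\mathrm{CHarr}^{p,q}(B,B)$ is the subcomplex of cochains vanishing on signed shuffles (for $0<i<p$, the sum over $(i,p-i)$-shuffles of $f$ applied to the shuffled arguments, with sign the product of the sign of the permutation and the Koszul sign, is zero); $\mathrm{HHarr}^{p,q}(B,B)$ is its cohomology. The class $[\mu_3]$: choosing a Hodge homotopy $d^-$ on $\mathcal{A}^*$, put $$\mu_3(a,b,c)=\big[\pi_{\mathcal{H}}\big(d^-(\iota(a)\cdot\iota(b))\cdot\iota(c)-(-1)^{\deg a}\iota(a)\cdot d^-(\iota(b)\cdot\iota(c))\big)\big].$$ This is the ternary operation of the minimal unital $C_\infty$-structure on $H^*(\mathcal{A})$ (with binary operation the cohomology product) obtained by homotopy transfer; it is a Harrison cocycle of bidegree $(3,-1)$ whose class does not depend on the choice of Hodge homotopy. The class $[\mu_3']$ is defined in the same way from $\mathcal{A}'^*$. *)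

theory Defs
  imports "HOL-Algebra.Module" "HOL-Algebra.QuotRing" "HOL-Combinatorics.Permutations"
begin

section \<open>Graded and differential graded commutative algebras\<close>

text \<open>Gradings are indexed by the integers.  \<open>parity_sign k\<close> is $(-1)^k$ for an integer $k$; signs
  act on module elements through integer multiples \<open>[s] \<cdot> x\<close>.\<close>

record ('k, 'a) graded_algebra = "('k, 'a) module" +
  grade :: "int \<Rightarrow> 'a set"

record ('k, 'a) dg_algebra = "('k, 'a) graded_algebra" +
  differential :: "'a \<Rightarrow> 'a"

definition parity_sign :: "int \<Rightarrow> int" where
  "parity_sign k = (if even k then 1 else - 1)"

definition char_zero :: "('k, 'm) ring_scheme \<Rightarrow> bool" where
  "char_zero K \<longleftrightarrow> (\<forall>n::nat. n > 0 \<longrightarrow> [n] \<cdot>\<^bsub>K\<^esub> \<one>\<^bsub>K\<^esub> \<noteq> \<zero>\<^bsub>K\<^esub>)"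

definition linear_map ::
  "('k, 'm) ring_scheme \<Rightarrow> ('k, 'a, 'x) module_scheme \<Rightarrow> ('k, 'b, 'y) module_scheme \<Rightarrow> ('a \<Rightarrow> 'b) \<Rightarrow> bool"
  where "linear_map K M N f \<longleftrightarrow>
    f \<in> carrier M \<rightarrow> carrier N \<and>
    (\<forall>x\<in>carrier M. \<forall>y\<in>carrier M. f (x \<oplus>\<^bsub>M\<^esub> y) = f x \<oplus>\<^bsub>N\<^esub> f y) \<and>
    (\<forall>c\<in>carrier K. \<forall>x\<in>carrier M. f (c \<odot>\<^bsub>M\<^esub> x) = c \<odot>\<^bsub>N\<^esub> f x)"

definition finite_dimensional :: "('k, 'm) ring_scheme \<Rightarrow> ('k, 'a, 'x) module_scheme \<Rightarrow> bool" where
  "finite_dimensional K M \<longleftrightarrow> (\<exists>S. finite S \<and> S \<subseteq> carrier M \<and>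
     (\<forall>x\<in>carrier M. \<exists>c\<in>S \<rightarrow> carrier K. x = (\<Oplus>\<^bsub>M\<^esub>s\<in>S. c s \<odot>\<^bsub>M\<^esub> s)))"

text \<open>\<open>is_decomposition B x c\<close>: \<open>x\<close> is the sum of the finitely supported family \<open>c\<close> of homogeneous
  elements.  Unique existence of such a family for each \<open>x\<close> says that \<open>B\<close> is the direct sum of its
  homogeneous parts.\<close>

definition is_decomposition :: "('k, 'a, 'x) graded_algebra_scheme \<Rightarrow> 'a \<Rightarrow> (int \<Rightarrow> 'a) \<Rightarrow> bool" where
  "is_decomposition B x c \<longleftrightarrow>
     (\<forall>k. c k \<in> grade B k) \<and> finite {k. c k \<noteq> \<zero>\<^bsub>B\<^esub>} \<and> x = finsum B c {k. c k \<noteq> \<zero>\<^bsub>B\<^esub>}"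

definition component :: "('k, 'a, 'x) graded_algebra_scheme \<Rightarrow> 'a \<Rightarrow> int \<Rightarrow> 'a" where
  "component B x = (THE c. is_decomposition B x c)"

text \<open>\<open>sign_twist B q\<close> is the linear extension of $a \mapsto (-1)^{q \deg a} a$.\<close>

definition sign_twist :: "('k, 'a, 'x) graded_algebra_scheme \<Rightarrow> int \<Rightarrow> 'a \<Rightarrow> 'a" where
  "sign_twist B q x =
     finsum B (\<lambda>k. [parity_sign (q * k)] \<cdot>\<^bsub>B\<^esub> component B x k) {k. component B x k \<noteq> \<zero>\<^bsub>B\<^esub>}"

locale gca = module K B + ring B
  for K (structure) and B :: "('k, 'a, 'x) graded_algebra_scheme" (structure) +
  assumes smult_mult_left:
      "\<lbrakk>c \<in> carrier K; x \<in> carrier B; y \<in> carrier B\<rbrakk> \<Longrightarrow> (c \<odot>\<^bsub>B\<^esub> x) \<otimes>\<^bsub>B\<^esub> y = c \<odot>\<^bsub>B\<^esub> (x \<otimes>\<^bsub>B\<^esub> y)"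
    and smult_mult_right:
      "\<lbrakk>c \<in> carrier K; x \<in> carrier B; y \<in> carrier B\<rbrakk> \<Longrightarrow> x \<otimes>\<^bsub>B\<^esub> (c \<odot>\<^bsub>B\<^esub> y) = c \<odot>\<^bsub>B\<^esub> (x \<otimes>\<^bsub>B\<^esub> y)"
    and grade_submodule: "submodule (grade B k) K B"
    and grade_direct_sum: "x \<in> carrier B \<Longrightarrow> \<exists>!c. is_decomposition B x c"
    and one_grade: "\<one>\<^bsub>B\<^esub> \<in> grade B 0"
    and mult_grade: "\<lbrakk>x \<in> grade B i; y \<in> grade B j\<rbrakk> \<Longrightarrow> x \<otimes>\<^bsub>B\<^esub> y \<in> grade B (i + j)"
    and graded_commutative:
      "\<lbrakk>x \<in> grade B i; y \<in> grade B j\<rbrakk> \<Longrightarrow> x \<otimes>\<^bsub>B\<^esub> y = [parity_sign (i * j)] \<cdot>\<^bsub>B\<^esub> (y \<otimes>\<^bsub>B\<^esub> x)"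

locale dgca = gca K A for K (structure) and A :: "('k, 'a, 'x) dg_algebra_scheme" (structure) +
  assumes differential_linear: "linear_map K A A (differential A)"
    and differential_grade: "x \<in> grade A k \<Longrightarrow> differential A x \<in> grade A (k + 1)"
    and differential_square: "x \<in> carrier A \<Longrightarrow> differential A (differential A x) = \<zero>\<^bsub>A\<^esub>"
    and leibniz: "\<lbrakk>x \<in> grade A i; y \<in> carrier A\<rbrakk> \<Longrightarrow>
      differential A (x \<otimes>\<^bsub>A\<^esub> y) =
        differential A x \<otimes>\<^bsub>A\<^esub> y \<oplus>\<^bsub>A\<^esub> [parity_sign i] \<cdot>\<^bsub>A\<^esub> (x \<otimes>\<^bsub>A\<^esub> differential A y)"

definition gca_hom ::
  "('k, 'm) ring_scheme \<Rightarrow> ('k, 'a, 'x) graded_algebra_scheme \<Rightarrow> ('k, 'b, 'y) graded_algebra_scheme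
    \<Rightarrow> ('a \<Rightarrow> 'b) \<Rightarrow> bool"
  where "gca_hom K B C f \<longleftrightarrow>
    linear_map K B C f \<and> f \<in> ring_hom B C \<and> (\<forall>k. f ` grade B k \<subseteq> grade C k)"

definition gca_iso ::
  "('k, 'm) ring_scheme \<Rightarrow> ('k, 'a, 'x) graded_algebra_scheme \<Rightarrow> ('k, 'b, 'y) graded_algebra_scheme
    \<Rightarrow> ('a \<Rightarrow> 'b) \<Rightarrow> bool"
  where "gca_iso K B C f \<longleftrightarrow> gca_hom K B C f \<and> bij_betw f (carrier B) (carrier C)"

section \<open>Cohomology, quasi-isomorphisms, homotopy classes\<close>

definition cocycles :: "('k, 'a, 'x) dg_algebra_scheme \<Rightarrow> 'a set" where
  "cocycles A = {x \<in> carrier A. differential A x = \<zero>\<^bsub>A\<^esub>}"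

definition coboundaries :: "('k, 'a, 'x) dg_algebra_scheme \<Rightarrow> 'a set" where
  "coboundaries A = differential A ` carrier A"

definition cohomology_class :: "('k, 'a, 'x) dg_algebra_scheme \<Rightarrow> 'a \<Rightarrow> 'a set" where
  "cohomology_class A x = coboundaries A +>\<^bsub>A\<^esub> x"

text \<open>The cohomology algebra: the quotient ring of the ring of cocycles by the ideal of coboundaries,
  with the induced scalar multiplication and grading.\<close>

definition cohomology :: "('k, 'a, 'x) dg_algebra_scheme \<Rightarrow> ('k, 'a set) graded_algebra" where
  "cohomology A = (let Q = (A\<lparr>carrier := cocycles A\<rparr>) Quot coboundaries A in
     \<lparr>carrier = carrier Q, monoid.mult = monoid.mult Q, one = one Q, zero = zero Q, add = add Q,
      smult = (\<lambda>c X. \<Union>x\<in>X. cohomology_class A (c \<odot>\<^bsub>A\<^esub> x)),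
      grade = (\<lambda>k. cohomology_class A ` (cocycles A \<inter> grade A k))\<rparr>)"

definition cohomology_map ::
  "('k, 'b, 'y) dg_algebra_scheme \<Rightarrow> ('a \<Rightarrow> 'b) \<Rightarrow> 'a set \<Rightarrow> 'b set"
  where "cohomology_map B f X = (\<Union>x\<in>X. cohomology_class B (f x))"

definition dgca_hom ::
  "('k, 'm) ring_scheme \<Rightarrow> ('k, 'a, 'x) dg_algebra_scheme \<Rightarrow> ('k, 'b, 'y) dg_algebra_scheme
    \<Rightarrow> ('a \<Rightarrow> 'b) \<Rightarrow> bool"
  where "dgca_hom K A B f \<longleftrightarrow> gca_hom K A B f \<and>
    (\<forall>x\<in>carrier A. f (differential A x) = differential B (f x))"

definition quasi_iso ::
  "('k, 'm) ring_scheme \<Rightarrow> ('k, 'a, 'x) dg_algebra_scheme \<Rightarrow> ('k, 'b, 'y) dg_algebra_scheme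
    \<Rightarrow> ('a \<Rightarrow> 'b) \<Rightarrow> bool"
  where "quasi_iso K A B f \<longleftrightarrow> dgca K A \<and> dgca K B \<and> dgca_hom K A B f \<and>
    bij_betw (cohomology_map B f) (carrier (cohomology A)) (carrier (cohomology B))"

definition quasi_iso_linked ::
  "('k, 'm) ring_scheme \<Rightarrow> ('k, 'a) dg_algebra \<Rightarrow> ('k, 'b) dg_algebra \<Rightarrow> bool"
  where "quasi_iso_linked K A B \<longleftrightarrow> (\<exists>f. quasi_iso K A B f) \<or> (\<exists>g. quasi_iso K B A g)"

text \<open>A zig-zag of quasi-isomorphisms from \<open>A\<close> to \<open>B\<close> whose intermediate DGCAs have carriers in the
  type \<open>'u\<close>.  HOL cannot quantify existentially over the carrier types of the intermediate algebras,
  so \<open>'u\<close> is a parameter.  Leaving it arbitrary in the hypothesis of a theorem covers all zig-zags: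
  the finitely many algebras of a zig-zag can be copied into one common type, e.g. the sum of their
  carrier types.  Prescribing at least one intermediate algebra is no restriction, because identities are
  quasi-isomorphisms.\<close>

definition same_homotopy_class ::
  "'u itself \<Rightarrow> ('k, 'm) ring_scheme \<Rightarrow> ('k, 'a) dg_algebra \<Rightarrow> ('k, 'b) dg_algebra \<Rightarrow> bool"
  where "same_homotopy_class TYPE('u) K A B \<longleftrightarrow>
    (\<exists>U V :: ('k, 'u) dg_algebra.
       quasi_iso_linked K A U \<and> (quasi_iso_linked K)\<^sup>*\<^sup>* U V \<and> quasi_iso_linked K V B)"

section \<open>Poincare DGCAs and Hodge homotopies\<close>

text \<open>The two pairings are the bilinear extensions of the ones given on homogeneous elements: only the
  degree \<open>n\<close> component of the product contributes.\<close>

definition cohomology_pairing ::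
  "('k, 'a, 'x) dg_algebra_scheme \<Rightarrow> nat \<Rightarrow> ('a set \<Rightarrow> 'k) \<Rightarrow> 'a set \<Rightarrow> 'a set \<Rightarrow> 'k"
  where "cohomology_pairing A n fund a b =
    fund (component (cohomology A) (a \<otimes>\<^bsub>cohomology A\<^esub> b) (int n))"

definition pairing ::
  "('k, 'a, 'x) dg_algebra_scheme \<Rightarrow> nat \<Rightarrow> ('a set \<Rightarrow> 'k) \<Rightarrow> 'a \<Rightarrow> 'a \<Rightarrow> 'k"
  where "pairing A n fund \<alpha> \<beta> = fund (cohomology_class A (component A (\<alpha> \<otimes>\<^bsub>A\<^esub> \<beta>) (int n)))"

definition poincare_dgca ::
  "('k, 'm) ring_scheme \<Rightarrow> ('k, 'a, 'x) dg_algebra_scheme \<Rightarrow> nat \<Rightarrow> ('a set \<Rightarrow> 'k) \<Rightarrow> bool"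
  where "poincare_dgca K A n fund \<longleftrightarrow>
    dgca K A \<and>
    (\<forall>k. k < 0 \<or> int n < k \<longrightarrow> grade A k = {\<zero>\<^bsub>A\<^esub>}) \<and>
    finite_dimensional K (cohomology A) \<and>
    fund \<in> grade (cohomology A) (int n) \<rightarrow> carrier K \<and>
    (\<forall>a\<in>grade (cohomology A) (int n). \<forall>b\<in>grade (cohomology A) (int n).
       fund (a \<oplus>\<^bsub>cohomology A\<^esub> b) = fund a \<oplus>\<^bsub>K\<^esub> fund b) \<and>
    (\<forall>c\<in>carrier K. \<forall>a\<in>grade (cohomology A) (int n).
       fund (c \<odot>\<^bsub>cohomology A\<^esub> a) = c \<otimes>\<^bsub>K\<^esub> fund a) \<and>
    (\<forall>a\<in>carrier (cohomology A).
       (\<forall>b\<in>carrier (cohomology A). cohomology_pairing A n fund a b = \<zero>\<^bsub>K\<^esub>)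
         \<longrightarrow> a = \<zero>\<^bsub>cohomology A\<^esub>) \<and>
    (\<forall>b\<in>carrier (cohomology A).
       (\<forall>a\<in>carrier (cohomology A). cohomology_pairing A n fund a b = \<zero>\<^bsub>K\<^esub>)
         \<longrightarrow> b = \<zero>\<^bsub>cohomology A\<^esub>)"

text \<open>The condition $H^0 = K$ means that the unit map $K \to H^0$ is bijective.\<close>

definition simply_connected :: "('k, 'm) ring_scheme \<Rightarrow> ('k, 'a, 'x) dg_algebra_scheme \<Rightarrow> bool" where
  "simply_connected K A \<longleftrightarrow>
     bij_betw (\<lambda>c. c \<odot>\<^bsub>cohomology A\<^esub> \<one>\<^bsub>cohomology A\<^esub>) (carrier K) (grade (cohomology A) 0) \<and>
     grade (cohomology A) 1 = {\<zero>\<^bsub>cohomology A\<^esub>}"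

definition harmonic_proj :: "('k, 'a, 'x) dg_algebra_scheme \<Rightarrow> ('a \<Rightarrow> 'a) \<Rightarrow> 'a \<Rightarrow> 'a" where
  "harmonic_proj A h x = x \<ominus>\<^bsub>A\<^esub> (differential A (h x) \<oplus>\<^bsub>A\<^esub> h (differential A x))"

definition harmonics :: "('k, 'a, 'x) dg_algebra_scheme \<Rightarrow> ('a \<Rightarrow> 'a) \<Rightarrow> 'a set" where
  "harmonics A h = harmonic_proj A h ` carrier A"

definition hodge_homotopy ::
  "('k, 'm) ring_scheme \<Rightarrow> ('k, 'a, 'x) dg_algebra_scheme \<Rightarrow> nat \<Rightarrow> ('a set \<Rightarrow> 'k) \<Rightarrow> ('a \<Rightarrow> 'a) \<Rightarrow> bool"
  where "hodge_homotopy K A n fund h \<longleftrightarrow>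
    linear_map K A A h \<and>
    (\<forall>k. h ` grade A k \<subseteq> grade A (k - 1)) \<and>
    (\<forall>x\<in>carrier A. h (h x) = \<zero>\<^bsub>A\<^esub>) \<and>
    (\<forall>x\<in>carrier A. h (differential A (h x)) = h x) \<and>
    (\<forall>x\<in>carrier A. differential A (h (differential A x)) = differential A x) \<and>
    (\<forall>x\<in>h ` carrier A. \<forall>y\<in>h ` carrier A. pairing A n fund x y = \<zero>\<^bsub>K\<^esub>) \<and>
    (\<forall>x\<in>harmonics A h. \<forall>y\<in>h ` carrier A. pairing A n fund x y = \<zero>\<^bsub>K\<^esub>)"

text \<open>The inverse $\iota$ of the isomorphism from the harmonic subspace to the cohomology.\<close>

definition harmonic_rep :: "('k, 'a, 'x) dg_algebra_scheme \<Rightarrow> ('a \<Rightarrow> 'a) \<Rightarrow> 'a set \<Rightarrow> 'a" where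
  "harmonic_rep A h = inv_into (harmonics A h) (cohomology_class A)"

section \<open>Harrison cohomology\<close>

text \<open>Linear maps on the \<open>p\<close>-th tensor power are rendered as \<open>p\<close>-multilinear maps on lists of length \<open>p\<close>,
  extensional outside \<open>tuples B p\<close>.\<close>

definition tuples :: "('k, 'b, 'x) graded_algebra_scheme \<Rightarrow> nat \<Rightarrow> 'b list set" where
  "tuples B p = {xs. length xs = p \<and> set xs \<subseteq> carrier B}"

definition homogeneous_of :: "('k, 'b, 'x) graded_algebra_scheme \<Rightarrow> 'b list \<Rightarrow> int list \<Rightarrow> bool" where
  "homogeneous_of B xs ks \<longleftrightarrow> list_all2 (\<lambda>x k. x \<in> grade B k) xs ks"

definition CHoch ::
  "('k, 'm) ring_scheme \<Rightarrow> ('k, 'b, 'x) graded_algebra_scheme \<Rightarrow> nat \<Rightarrow> int \<Rightarrow> ('b list \<Rightarrow> 'b) set"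
  where "CHoch K B p q = {f \<in> tuples B p \<rightarrow>\<^sub>E carrier B.
    (\<forall>xs\<in>tuples B p. \<forall>i<p. linear_map K B B (\<lambda>x. f (xs[i := x]))) \<and>
    (\<forall>xs\<in>tuples B p. \<forall>ks. homogeneous_of B xs ks \<longrightarrow> f xs \<in> grade B (sum_list ks + q))}"

text \<open>In the middle sum, $a_i$ and $a_{i+1}$ are \<open>xs ! (i - 1)\<close> and \<open>xs ! i\<close>.\<close>

definition hoch_diff ::
  "('k, 'b, 'x) graded_algebra_scheme \<Rightarrow> nat \<Rightarrow> int \<Rightarrow> ('b list \<Rightarrow> 'b) \<Rightarrow> 'b list \<Rightarrow> 'b"
  where "hoch_diff B p q f = (\<lambda>xs\<in>tuples B (Suc p).
    sign_twist B q (hd xs) \<otimes>\<^bsub>B\<^esub> f (tl xs)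
    \<oplus>\<^bsub>B\<^esub> (\<Oplus>\<^bsub>B\<^esub>i\<in>{1..p}. [parity_sign (int i)] \<cdot>\<^bsub>B\<^esub>
            f (take (i - 1) xs @ (xs ! (i - 1) \<otimes>\<^bsub>B\<^esub> xs ! i) # drop (i + 1) xs))
    \<oplus>\<^bsub>B\<^esub> [parity_sign (int p + 1)] \<cdot>\<^bsub>B\<^esub> (f (butlast xs) \<otimes>\<^bsub>B\<^esub> last xs))"

definition shuffle_perms :: "nat \<Rightarrow> nat \<Rightarrow> (nat \<Rightarrow> nat) set" where
  "shuffle_perms i p =
     {\<sigma>. \<sigma> permutes {..<p} \<and> strict_mono_on {..<i} \<sigma> \<and> strict_mono_on {i..<p} \<sigma>}"

text \<open>The exponent of the Koszul sign of moving, for each \<open>j\<close>, the argument \<open>j\<close> of degree \<open>ks ! j\<close> to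
  position \<open>\<sigma> j\<close>.\<close>

definition koszul_exponent :: "(nat \<Rightarrow> nat) \<Rightarrow> int list \<Rightarrow> int" where
  "koszul_exponent \<sigma> ks =
     (\<Sum>(j, l) \<in> {(j, l). j < l \<and> l < length ks \<and> \<sigma> l < \<sigma> j}. ks ! j * ks ! l)"

definition CHarr ::
  "('k, 'm) ring_scheme \<Rightarrow> ('k, 'b, 'x) graded_algebra_scheme \<Rightarrow> nat \<Rightarrow> int \<Rightarrow> ('b list \<Rightarrow> 'b) set"
  where "CHarr K B p q = {f \<in> CHoch K B p q.
    \<forall>i. 0 < i \<and> i < p \<longrightarrow>
      (\<forall>xs\<in>tuples B p. \<forall>ks. homogeneous_of B xs ks \<longrightarrow>
        (\<Oplus>\<^bsub>B\<^esub>\<sigma>\<in>shuffle_perms i p.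
           [(sign \<sigma> * parity_sign (koszul_exponent \<sigma> ks))] \<cdot>\<^bsub>B\<^esub>
             f (permute_list (inv_into UNIV \<sigma>) xs)) = \<zero>\<^bsub>B\<^esub>)}"

definition harr_cocycles ::
  "('k, 'm) ring_scheme \<Rightarrow> ('k, 'b, 'x) graded_algebra_scheme \<Rightarrow> nat \<Rightarrow> int \<Rightarrow> ('b list \<Rightarrow> 'b) set"
  where "harr_cocycles K B p q =
    {f \<in> CHarr K B p q. hoch_diff B p q f = (\<lambda>xs\<in>tuples B (Suc p). \<zero>\<^bsub>B\<^esub>)}"

definition harr_coboundaries ::
  "('k, 'm) ring_scheme \<Rightarrow> ('k, 'b, 'x) graded_algebra_scheme \<Rightarrow> nat \<Rightarrow> int \<Rightarrow> ('b list \<Rightarrow> 'b) set"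
  where "harr_coboundaries K B p q =
    (if p = 0 then {\<lambda>xs\<in>tuples B 0. \<zero>\<^bsub>B\<^esub>} else hoch_diff B (p - 1) q ` CHarr K B (p - 1) q)"

definition harr_class ::
  "('k, 'm) ring_scheme \<Rightarrow> ('k, 'b, 'x) graded_algebra_scheme \<Rightarrow> nat \<Rightarrow> int \<Rightarrow> ('b list \<Rightarrow> 'b)
    \<Rightarrow> ('b list \<Rightarrow> 'b) set"
  where "harr_class K B p q f =
    (\<lambda>g. \<lambda>xs\<in>tuples B p. f xs \<oplus>\<^bsub>B\<^esub> g xs) ` harr_coboundaries K B p q"

definition HHarr ::
  "('k, 'm) ring_scheme \<Rightarrow> ('k, 'b, 'x) graded_algebra_scheme \<Rightarrow> nat \<Rightarrow> int
    \<Rightarrow> ('b list \<Rightarrow> 'b) set set"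
  where "HHarr K B p q = harr_class K B p q ` harr_cocycles K B p q"

text \<open>An isomorphism $\phi : B \to C$ acts on cochains by
  $f \mapsto \phi \circ f \circ (\phi^{-1})^{\otimes p}$ and on cohomology classes, which are sets of
  cochains, elementwise.\<close>

definition cochain_transport ::
  "('k, 'b, 'x) graded_algebra_scheme \<Rightarrow> ('k, 'c, 'y) graded_algebra_scheme \<Rightarrow> ('b \<Rightarrow> 'c) \<Rightarrow> nat
    \<Rightarrow> ('b list \<Rightarrow> 'b) \<Rightarrow> 'c list \<Rightarrow> 'c"
  where "cochain_transport B C \<phi> p f =
    (\<lambda>ys\<in>tuples C p. \<phi> (f (map (inv_into (carrier B) \<phi>) ys)))"

definition HHarr_map ::
  "('k, 'b, 'x) graded_algebra_scheme \<Rightarrow> ('k, 'c, 'y) graded_algebra_scheme \<Rightarrow> ('b \<Rightarrow> 'c) \<Rightarrow> nat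
    \<Rightarrow> ('b list \<Rightarrow> 'b) set \<Rightarrow> ('c list \<Rightarrow> 'c) set"
  where "HHarr_map B C \<phi> p X = cochain_transport B C \<phi> p ` X"

section \<open>The ternary operation\<close>

text \<open>The sign $(-1)^{\deg a}$ is put on the argument $a$ by \<open>sign_twist\<close>, so that the formula also makes
  sense, linearly extended, for inhomogeneous $a$.\<close>

definition mu3 :: "('k, 'a, 'x) dg_algebra_scheme \<Rightarrow> ('a \<Rightarrow> 'a) \<Rightarrow> 'a set list \<Rightarrow> 'a set" where
  "mu3 A h = (\<lambda>xs\<in>tuples (cohomology A) 3.
     let a = xs ! 0; b = xs ! 1; c = xs ! 2; \<iota> = harmonic_rep A h
     in cohomology_class A (harmonic_proj A h
          (h (\<iota> a \<otimes>\<^bsub>A\<^esub> \<iota> b) \<otimes>\<^bsub>A\<^esub> \<iota> c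
           \<ominus>\<^bsub>A\<^esub> \<iota> (sign_twist (cohomology A) 1 a) \<otimes>\<^bsub>A\<^esub> h (\<iota> b \<otimes>\<^bsub>A\<^esub> \<iota> c))))"

definition mu3_class ::
  "('k, 'm) ring_scheme \<Rightarrow> ('k, 'a, 'x) dg_algebra_scheme \<Rightarrow> ('a \<Rightarrow> 'a) \<Rightarrow> ('a set list \<Rightarrow> 'a set) set"
  where "mu3_class K A h = harr_class K (cohomology A) 3 (- 1) (mu3 A h)"

end

theory Submission
  imports Defs "HOL-Algebra.Subrings"
begin

text \<open>The pairing plays no role: all that matters is a linear choice $\iota$ of representatives
  of the cohomology together with a graded symmetric $m$ of degree $-1$ satisfying
  $d\,m(a,b) = \iota a\,\iota b - \iota(ab)$.  Writing $\tau$ for the sign involution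
  $a \mapsto (-1)^{\deg a} a$, the element
  $z(a,b,c) = m(a,b)\,\iota c - \tau(\iota a)\,m(b,c) + m(ab,c) - m(a,bc)$ is closed, and its class is a
  Harrison cocycle; for $m(a,b) = d^-(\iota a\,\iota b)$ it is $\mu_3$, since $\pi_{\mathcal H}$ kills the
  image of $d^-$ and does not change the class of a closed element.  Two such choices over the same
  identification of cohomology differ by a Harrison coboundary.  Choices can be pushed forward along
  quasi-isomorphisms without changing the cocycle, and every DGCA admits one because a graded subspace has a
  graded complement, so the class is carried along each step of a zig-zag.\<close>

section \<open>Signs, linear maps and gradings\<close>

text \<open>The algebras inside a zig-zag need not carry a Hodge homotopy, and a quasi-isomorphism
  need not have an inverse that is an algebra map. So the objects compared are weaker than Hodge
  homotopies, and the indexing algebra \<open>H\<close> stays fixed while \<open>A\<close> varies: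
  all cochains met along a zig-zag then live on one space. Backward arrows are also handled by
  pushing models forward, from the new algebra to the old one; this works because every model over a
  given identification yields the same class. Only arities up to three of a homotopy transfer
  matter, so the identities are written out directly in \<open>A\<close> and then passed to classes.
  The twist \<open>\<tau>\<close> carries the signs that come from moving an operator past an
  argument. With it the Leibniz rule and the Hochschild formulas hold for inhomogeneous arguments
  and turn into plain ring identities. Parity cases survive only where graded commutativity enters,
  that is, in the symmetry and shuffle relations.\<close>

lemma parity_sign_uminus [simp]: "parity_sign (- k) = parity_sign k"
  by (simp add: parity_sign_def)

lemma (in abelian_group) int_one_pow: "x \<in> carrier G \<Longrightarrow> [(1::int)] \<cdot> x = x"
  by (simp add: add_pow_def int_pow_def2)

lemma (in abelian_group) int_minus_one_pow: "x \<in> carrier G \<Longrightarrow> [(-1::int)] \<cdot> x = \<ominus> x"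
  by (simp add: add_pow_def int_pow_def2 a_inv_def)

lemma (in abelian_group) parity_pow:
  "x \<in> carrier G \<Longrightarrow> [parity_sign k] \<cdot> x = (if even k then x else \<ominus> x)"
  by (simp add: parity_sign_def int_one_pow int_minus_one_pow)

lemma (in abelian_group) diff_add_add:
  "\<lbrakk>p \<in> carrier G; q \<in> carrier G; p' \<in> carrier G; q' \<in> carrier G\<rbrakk> \<Longrightarrow>
    (p \<oplus> q) \<ominus> (p' \<oplus> q') = (p \<ominus> p') \<oplus> (q \<ominus> q')"
  by (simp add: a_minus_def minus_add a_ac)

lemma finsum_additive:
  assumes "abelian_monoid M" "abelian_monoid N"
    and f: "f \<in> carrier M \<rightarrow> carrier N" "f \<zero>\<^bsub>M\<^esub> = \<zero>\<^bsub>N\<^esub>"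
    and add: "\<And>x y. x \<in> carrier M \<Longrightarrow> y \<in> carrier M \<Longrightarrow> f (x \<oplus>\<^bsub>M\<^esub> y) = f x \<oplus>\<^bsub>N\<^esub> f y"
    and c: "c \<in> F \<rightarrow> carrier M"
  shows "f (finsum M c F) = finsum N (\<lambda>k. f (c k)) F"
proof -
  interpret M: abelian_monoid M by fact
  interpret N: abelian_monoid N by fact
  show ?thesis
  proof (cases "finite F")
    case True
    then show ?thesis using c
    proof (induction F)
      case empty
      then show ?case by (simp add: f)
    next
      case (insert k F)
      then have "finsum M c F \<in> carrier M" "(\<lambda>k. f (c k)) \<in> F \<rightarrow> carrier N" "f (c k) \<in> carrier N"
        using f by (auto intro!: M.finsum_closed)
      then show ?case using insert by (simp add: add)
    qed
  next
    case False
    then show ?thesis by (simp add: f M.finsum_infinite N.finsum_infinite)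
  qed
qed

context
  fixes K :: "('k, 'm) ring_scheme" and M :: "('k, 'a, 'x) module_scheme"
    and N :: "('k, 'b, 'y) module_scheme" and f
  assumes f: "linear_map K M N f"
begin

lemma linear_map_closed [simp, intro]: "x \<in> carrier M \<Longrightarrow> f x \<in> carrier N"
  and linear_map_add: "x \<in> carrier M \<Longrightarrow> y \<in> carrier M \<Longrightarrow> f (x \<oplus>\<^bsub>M\<^esub> y) = f x \<oplus>\<^bsub>N\<^esub> f y"
  and linear_map_smult: "a \<in> carrier K \<Longrightarrow> x \<in> carrier M \<Longrightarrow> f (a \<odot>\<^bsub>M\<^esub> x) = a \<odot>\<^bsub>N\<^esub> f x"
  using f unfolding linear_map_def by auto

lemma linear_map_zero:
  assumes "abelian_group M" "abelian_group N"
  shows "f \<zero>\<^bsub>M\<^esub> = \<zero>\<^bsub>N\<^esub>"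
proof -
  interpret M: abelian_group M by fact
  interpret N: abelian_group N by fact
  have "f \<zero>\<^bsub>M\<^esub> \<oplus>\<^bsub>N\<^esub> f \<zero>\<^bsub>M\<^esub> = f \<zero>\<^bsub>M\<^esub>"
    by (subst linear_map_add [symmetric]) auto
  then show ?thesis
    using N.add.r_cancel_one' by force
qed

lemma linear_map_neg:
  assumes "abelian_group M" "abelian_group N" "x \<in> carrier M"
  shows "f (\<ominus>\<^bsub>M\<^esub> x) = \<ominus>\<^bsub>N\<^esub> f x"
proof -
  interpret M: abelian_group M by fact
  interpret N: abelian_group N by fact
  have "f (\<ominus>\<^bsub>M\<^esub> x) \<oplus>\<^bsub>N\<^esub> f x = \<zero>\<^bsub>N\<^esub>"
    using assms by (subst linear_map_add [symmetric]) (auto simp: M.l_neg linear_map_zero)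
  then show ?thesis
    using assms(3) by (simp add: N.minus_equality)
qed

lemma linear_map_diff:
  assumes "abelian_group M" "abelian_group N" "x \<in> carrier M" "y \<in> carrier M"
  shows "f (x \<ominus>\<^bsub>M\<^esub> y) = f x \<ominus>\<^bsub>N\<^esub> f y"
proof -
  interpret M: abelian_group M by fact
  show ?thesis using assms by (simp add: a_minus_def linear_map_add linear_map_neg)
qed

end

lemma linear_mapI:
  assumes "\<And>x. x \<in> carrier M \<Longrightarrow> f x \<in> carrier N"
    and "\<And>x y. x \<in> carrier M \<Longrightarrow> y \<in> carrier M \<Longrightarrow> f (x \<oplus>\<^bsub>M\<^esub> y) = f x \<oplus>\<^bsub>N\<^esub> f y"
    and "\<And>a x. a \<in> carrier K \<Longrightarrow> x \<in> carrier M \<Longrightarrow> f (a \<odot>\<^bsub>M\<^esub> x) = a \<odot>\<^bsub>N\<^esub> f x"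
  shows "linear_map K M N f"
  using assms unfolding linear_map_def by auto

section \<open>Homogeneous components and the sign involution\<close>

context gca
begin

lemma smult_neg: "\<lbrakk>a \<in> carrier K; x \<in> carrier B\<rbrakk> \<Longrightarrow> a \<odot>\<^bsub>B\<^esub> (\<ominus>\<^bsub>B\<^esub> x) = \<ominus>\<^bsub>B\<^esub> (a \<odot>\<^bsub>B\<^esub> x)"
  by (rule smult_r_minus)

lemma smult_diff:
  "\<lbrakk>a \<in> carrier K; x \<in> carrier B; y \<in> carrier B\<rbrakk> \<Longrightarrow> a \<odot>\<^bsub>B\<^esub> (x \<ominus>\<^bsub>B\<^esub> y) = a \<odot>\<^bsub>B\<^esub> x \<ominus>\<^bsub>B\<^esub> a \<odot>\<^bsub>B\<^esub> y"
  by (simp add: a_minus_def smult_r_distr smult_neg)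

lemma grade_carrier: "x \<in> grade B k \<Longrightarrow> x \<in> carrier B"
  using submoduleE(1)[OF grade_submodule] by blast

lemma grade_zero [simp, intro]: "\<zero>\<^bsub>B\<^esub> \<in> grade B k"
  using submodule.axioms(1)[OF grade_submodule, of k] subgroup.one_closed by force

lemma grade_add: "\<lbrakk>x \<in> grade B k; y \<in> grade B k\<rbrakk> \<Longrightarrow> x \<oplus>\<^bsub>B\<^esub> y \<in> grade B k"
  using submoduleE(5)[OF grade_submodule] .

lemma grade_neg: "x \<in> grade B k \<Longrightarrow> \<ominus>\<^bsub>B\<^esub> x \<in> grade B k"
  using submoduleE(3)[OF grade_submodule] .

lemma grade_diff: "\<lbrakk>x \<in> grade B k; y \<in> grade B k\<rbrakk> \<Longrightarrow> x \<ominus>\<^bsub>B\<^esub> y \<in> grade B k"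
  by (simp add: a_minus_def grade_add grade_neg)

lemma grade_smult: "\<lbrakk>a \<in> carrier K; x \<in> grade B k\<rbrakk> \<Longrightarrow> a \<odot>\<^bsub>B\<^esub> x \<in> grade B k"
  using submoduleE(4)[OF grade_submodule] .

lemma component_decomposition:
  "x \<in> carrier B \<Longrightarrow> is_decomposition B x (component B x)"
  unfolding component_def using theI'[OF grade_direct_sum] .

lemma component_grade: "x \<in> carrier B \<Longrightarrow> component B x k \<in> grade B k"
  using component_decomposition unfolding is_decomposition_def by blast

lemma component_closed [simp]: "x \<in> carrier B \<Longrightarrow> component B x k \<in> carrier B"
  using component_grade grade_carrier by blast

lemma component_finite: "x \<in> carrier B \<Longrightarrow> finite {k. component B x k \<noteq> \<zero>\<^bsub>B\<^esub>}"
  using component_decomposition unfolding is_decomposition_def by blast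

lemma component_sum:
  assumes "x \<in> carrier B" "finite F" "{k. component B x k \<noteq> \<zero>\<^bsub>B\<^esub>} \<subseteq> F"
  shows "x = finsum B (component B x) F"
proof -
  have "x = finsum B (component B x) {k. component B x k \<noteq> \<zero>\<^bsub>B\<^esub>}"
    using component_decomposition[OF assms(1)] unfolding is_decomposition_def by blast
  also have "\<dots> = finsum B (component B x) F"
    using assms by (intro M.add.finprod_mono_neutral_cong_left) auto
  finally show ?thesis .
qed

text \<open>The index set may be larger than the support, so that several elements can be decomposed
  over one common finite set.\<close>

lemma component_eqI:
  assumes c: "\<And>k. c k \<in> grade B k" and F: "finite F" "\<And>k. k \<notin> F \<Longrightarrow> c k = \<zero>\<^bsub>B\<^esub>"
    and x: "x = finsum B c F"
  shows "component B x = c"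
proof -
  have cc: "c k \<in> carrier B" for k using c grade_carrier by blast
  have sub: "{k. c k \<noteq> \<zero>\<^bsub>B\<^esub>} \<subseteq> F" using F by auto
  have "finsum B c {k. c k \<noteq> \<zero>\<^bsub>B\<^esub>} = finsum B c F"
    using cc F sub by (intro M.add.finprod_mono_neutral_cong_left) auto
  then have "is_decomposition B x c"
    using c x finite_subset[OF sub F(1)] unfolding is_decomposition_def by simp
  moreover have "x \<in> carrier B" using x cc by auto
  ultimately show ?thesis
    using grade_direct_sum[of x] component_decomposition[of x] by blast
qed

lemma component_homogeneous:
  assumes "x \<in> grade B i"
  shows "component B x = (\<lambda>k. if k = i then x else \<zero>\<^bsub>B\<^esub>)"
proof (rule component_eqI)
  show "x = (\<Oplus>\<^bsub>B\<^esub>k\<in>{i}. if k = i then x else \<zero>\<^bsub>B\<^esub>)"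
    using assms grade_carrier by simp
qed (use assms in auto)

lemma component_add:
  assumes "x \<in> carrier B" "y \<in> carrier B"
  shows "component B (x \<oplus>\<^bsub>B\<^esub> y) = (\<lambda>k. component B x k \<oplus>\<^bsub>B\<^esub> component B y k)"
proof (rule component_eqI)
  let ?F = "{k. component B x k \<noteq> \<zero>\<^bsub>B\<^esub>} \<union> {k. component B y k \<noteq> \<zero>\<^bsub>B\<^esub>}"
  show F: "finite ?F" using assms component_finite by blast
  show "x \<oplus>\<^bsub>B\<^esub> y = (\<Oplus>\<^bsub>B\<^esub>k\<in>?F. component B x k \<oplus>\<^bsub>B\<^esub> component B y k)"
    using component_sum[OF assms(1) F] component_sum[OF assms(2) F] assms
    by (subst M.finsum_addf) auto
qed (use assms component_grade grade_add in auto)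

lemma component_smult:
  assumes "a \<in> carrier K" "x \<in> carrier B"
  shows "component B (a \<odot>\<^bsub>B\<^esub> x) = (\<lambda>k. a \<odot>\<^bsub>B\<^esub> component B x k)"
proof (rule component_eqI)
  let ?F = "{k. component B x k \<noteq> \<zero>\<^bsub>B\<^esub>}"
  show F: "finite ?F" using assms component_finite by blast
  show "a \<odot>\<^bsub>B\<^esub> x = (\<Oplus>\<^bsub>B\<^esub>k\<in>?F. a \<odot>\<^bsub>B\<^esub> component B x k)"
    using component_sum[OF assms(2) F] finsum_smult_ldistr[OF F assms(1), of "component B x"] assms
    by auto
qed (use assms component_grade grade_smult in auto)

lemma component_linear: "linear_map K B B (\<lambda>x. component B x k)"
  by (rule linear_mapI) (simp_all add: component_add component_smult)

lemma abgrp: "abelian_group B" ..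

text \<open>Reduces additive statements to homogeneous elements, on which \<open>\<tau>\<close> is a
  plain sign.\<close>

lemma homogeneous_induct [consumes 1, case_names zero homogeneous add]:
  assumes "x \<in> carrier B" and "P \<zero>\<^bsub>B\<^esub>" and "\<And>x k. x \<in> grade B k \<Longrightarrow> P x"
    and "\<And>x y. \<lbrakk>x \<in> carrier B; y \<in> carrier B; P x; P y\<rbrakk> \<Longrightarrow> P (x \<oplus>\<^bsub>B\<^esub> y)"
  shows "P x"
proof -
  have *: "P (finsum B (component B x) F)" if "finite F" for F
    using that
    by (induction F)
      (use assms(1,2) in \<open>auto intro!: assms(4) M.finsum_closed intro: assms(3)[OF component_grade]\<close>)
  show ?thesis
    using *[OF component_finite[OF assms(1)]] component_sum[OF assms(1) component_finite[OF assms(1)]]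
    by simp
qed

abbreviation \<tau> :: "'a \<Rightarrow> 'a" where "\<tau> \<equiv> sign_twist B 1"

text \<open>The cochains of interest have degree -1, and the Hochschild differential twists by this
  degree; only its parity matters.\<close>

lemma sign_twist_minus_one: "sign_twist B (-1) = \<tau>"
  unfolding sign_twist_def by simp

lemma twist_sum:
  assumes "x \<in> carrier B" "finite F" "{k. component B x k \<noteq> \<zero>\<^bsub>B\<^esub>} \<subseteq> F"
  shows "\<tau> x = (\<Oplus>\<^bsub>B\<^esub>k\<in>F. [parity_sign k] \<cdot>\<^bsub>B\<^esub> component B x k)"
  unfolding sign_twist_def using assms
  by (simp, intro M.add.finprod_mono_neutral_cong_left) (auto simp: M.parity_pow)

lemma twist_closed [simp, intro]: "x \<in> carrier B \<Longrightarrow> \<tau> x \<in> carrier B"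
  by (subst twist_sum[OF _ component_finite order_refl]) (auto simp: M.parity_pow intro!: M.finsum_closed)

lemma twist_homogeneous:
  assumes "x \<in> grade B k" shows "\<tau> x = [parity_sign k] \<cdot>\<^bsub>B\<^esub> x"
  using assms grade_carrier[OF assms] component_homogeneous[OF assms]
  by (subst twist_sum[of _ "{k}"]) (auto simp: M.parity_pow split: if_splits)

lemma twist_linear: "linear_map K B B \<tau>"
proof (rule linear_mapI)
  fix x y assume xy: "x \<in> carrier B" "y \<in> carrier B"
  \<comment> \<open>One finite set containing both supports lets the three sums be compared term by
    term.\<close>
  let ?F = "{k. component B x k \<noteq> \<zero>\<^bsub>B\<^esub>} \<union> {k. component B y k \<noteq> \<zero>\<^bsub>B\<^esub>}"
  have F: "finite ?F" using xy component_finite by blast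
  have "{k. component B (x \<oplus>\<^bsub>B\<^esub> y) k \<noteq> \<zero>\<^bsub>B\<^esub>} \<subseteq> ?F"
    using xy by (auto simp: component_add)
  then have "\<tau> (x \<oplus>\<^bsub>B\<^esub> y)
      = (\<Oplus>\<^bsub>B\<^esub>k\<in>?F. [parity_sign k] \<cdot>\<^bsub>B\<^esub> component B x k \<oplus>\<^bsub>B\<^esub> [parity_sign k] \<cdot>\<^bsub>B\<^esub> component B y k)"
    using xy F
    by (subst twist_sum[of _ ?F], simp_all only: M.add.m_closed, intro M.finsum_cong')
      (auto simp: component_add M.parity_pow M.minus_add)
  also have "\<dots> = \<tau> x \<oplus>\<^bsub>B\<^esub> \<tau> y"
    using xy F by (subst M.finsum_addf) (auto simp: M.parity_pow twist_sum[of x ?F] twist_sum[of y ?F])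
  finally show "\<tau> (x \<oplus>\<^bsub>B\<^esub> y) = \<tau> x \<oplus>\<^bsub>B\<^esub> \<tau> y" .
next
  fix a x assume ax: "a \<in> carrier K" "x \<in> carrier B"
  let ?F = "{k. component B x k \<noteq> \<zero>\<^bsub>B\<^esub>}"
  have F: "finite ?F" using ax component_finite by blast
  have "{k. component B (a \<odot>\<^bsub>B\<^esub> x) k \<noteq> \<zero>\<^bsub>B\<^esub>} \<subseteq> ?F"
    using ax by (auto simp: component_smult)
  then have "\<tau> (a \<odot>\<^bsub>B\<^esub> x) = (\<Oplus>\<^bsub>B\<^esub>k\<in>?F. a \<odot>\<^bsub>B\<^esub> ([parity_sign k] \<cdot>\<^bsub>B\<^esub> component B x k))"
    using ax F
    by (subst twist_sum[of _ ?F], simp_all only: smult_closed, intro M.finsum_cong')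
      (auto simp: component_smult M.parity_pow smult_neg)
  also have "\<dots> = a \<odot>\<^bsub>B\<^esub> \<tau> x"
    using ax F twist_sum[of x ?F] finsum_smult_ldistr[OF F ax(1), symmetric]
    by (auto simp: M.parity_pow)
  finally show "\<tau> (a \<odot>\<^bsub>B\<^esub> x) = a \<odot>\<^bsub>B\<^esub> \<tau> x" .
qed simp

lemmas twist_add = linear_map_add[OF twist_linear]
lemmas twist_smult = linear_map_smult[OF twist_linear]
lemmas twist_zero = linear_map_zero[OF twist_linear abgrp abgrp]
lemmas twist_neg = linear_map_neg[OF twist_linear abgrp abgrp]
lemmas twist_diff = linear_map_diff[OF twist_linear abgrp abgrp]

lemma twist_grade: "x \<in> grade B k \<Longrightarrow> \<tau> x \<in> grade B k"
  by (simp add: twist_homogeneous M.parity_pow grade_carrier grade_neg)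

lemma twist_twist: "x \<in> carrier B \<Longrightarrow> \<tau> (\<tau> x) = x"
proof (induction rule: homogeneous_induct)
  case (homogeneous x k)
  then show ?case by (simp add: twist_homogeneous M.parity_pow grade_carrier grade_neg twist_neg)
qed (auto simp: twist_zero twist_add)

text \<open>Degrees add under multiplication, hence signs multiply: \<open>\<tau>\<close> is an
  algebra automorphism.\<close>

lemma twist_mult:
  assumes "x \<in> carrier B" "y \<in> carrier B"
  shows "\<tau> (x \<otimes>\<^bsub>B\<^esub> y) = \<tau> x \<otimes>\<^bsub>B\<^esub> \<tau> y"
  using assms
proof (induction rule: homogeneous_induct)
  case zero
  then show ?case by (simp add: twist_zero)
next
  case (add x x')
  then show ?case by (simp add: twist_add l_distr)
next
  case (homogeneous x i)
  have x: "x \<in> carrier B" using homogeneous grade_carrier by blast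
  from homogeneous(2) show ?case
  proof (induction rule: homogeneous_induct)
    case zero
    then show ?case using x by (simp add: twist_zero)
  next
    case (add x x')
    then show ?case using x by (simp add: twist_add r_distr)
  next
    case (homogeneous y j)
    have y: "y \<in> carrier B" using homogeneous grade_carrier by blast
    show ?case
      using x y \<open>x \<in> grade B i\<close> homogeneous mult_grade[OF \<open>x \<in> grade B i\<close> homogeneous]
      by (simp add: twist_homogeneous M.parity_pow l_minus r_minus)
  qed
qed

end

text \<open>Used with q = 1 for the differential and with q = 0 for sections and algebra
  maps.\<close>

lemma gca_degree_map_component:
  assumes "gca K B" "gca K C" and f: "linear_map K B C f"
    and deg: "\<And>x k. x \<in> grade B k \<Longrightarrow> f x \<in> grade C (k + q)" and x: "x \<in> carrier B"
  shows "component C (f x) (k + q) = f (component B x k)"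
proof -
  interpret B: gca K B by fact
  interpret C: gca K C by fact
  show ?thesis
    using x
  proof (induction rule: B.homogeneous_induct)
    case zero
    show ?case
      using linear_map_zero[OF f B.abgrp C.abgrp] linear_map_zero[OF C.component_linear C.abgrp C.abgrp]
        linear_map_zero[OF B.component_linear B.abgrp B.abgrp] by simp
  next
    case (homogeneous x i)
    then show ?case
      using deg[of x i] linear_map_zero[OF f B.abgrp C.abgrp]
      by (simp add: B.component_homogeneous[of x i] C.component_homogeneous[of "f x" "i + q"])
  next
    case (add x y)
    then show ?case
      by (simp add: B.component_add C.component_add linear_map_add[OF f] linear_map_closed[OF f])
  qed
qed

text \<open>With q = 1 this says that the differential anticommutes with \<open>\<tau>\<close>; with
  q = 0, that degree-preserving maps commute with it.\<close>

lemma gca_degree_map_twist: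
  assumes "gca K B" "gca K C" and f: "linear_map K B C f"
    and deg: "\<And>x k. x \<in> grade B k \<Longrightarrow> f x \<in> grade C (k + q)" and x: "x \<in> carrier B"
  shows "sign_twist C 1 (f x) = [parity_sign q] \<cdot>\<^bsub>C\<^esub> f (sign_twist B 1 x)"
proof -
  interpret B: gca K B by fact
  interpret C: gca K C by fact
  note [simp] = linear_map_closed[OF f]
  show ?thesis
    using x
  proof (induction rule: B.homogeneous_induct)
    case zero
    show ?case
      using linear_map_zero[OF f B.abgrp C.abgrp]
      by (simp add: B.twist_zero C.twist_zero C.M.parity_pow)
  next
    case (homogeneous x i)
    then show ?case
      using B.grade_carrier[OF homogeneous]
      by (simp add: B.twist_homogeneous C.twist_homogeneous[OF deg] C.M.parity_pow B.M.parity_pow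
          linear_map_neg[OF f B.abgrp C.abgrp])
  next
    case (add x y)
    then show ?case
      by (simp add: B.twist_add C.twist_add linear_map_add[OF f] C.M.parity_pow C.M.minus_add split: if_splits)
  qed
qed

section \<open>Cohomology of a DGCA\<close>

context dgca
begin

abbreviation d :: "'a \<Rightarrow> 'a" where "d \<equiv> differential A"
abbreviation cls :: "'a \<Rightarrow> 'a set" where "cls \<equiv> cohomology_class A"

lemmas d_closed [simp, intro] = linear_map_closed[OF differential_linear]
lemmas d_add = linear_map_add[OF differential_linear]
lemmas d_smult = linear_map_smult[OF differential_linear]
lemmas d_zero = linear_map_zero[OF differential_linear abgrp abgrp]
lemmas d_neg = linear_map_neg[OF differential_linear abgrp abgrp]
lemmas d_diff = linear_map_diff[OF differential_linear abgrp abgrp]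

lemma d_component: "x \<in> carrier A \<Longrightarrow> component A (d x) (k + 1) = d (component A x k)"
  by (rule gca_degree_map_component[OF gca_axioms gca_axioms differential_linear differential_grade])

lemma d_twist: "x \<in> carrier A \<Longrightarrow> d (\<tau> x) = \<ominus>\<^bsub>A\<^esub> \<tau> (d x)"
  by (subst gca_degree_map_twist[OF gca_axioms gca_axioms differential_linear differential_grade])
    (simp_all add: M.parity_pow)

text \<open>Writing the sign as a twist of the left factor removes the homogeneity condition, so
  that this form can be used as a rewrite rule.\<close>

lemma leibniz_twist:
  assumes "x \<in> carrier A" "y \<in> carrier A"
  shows "d (x \<otimes>\<^bsub>A\<^esub> y) = d x \<otimes>\<^bsub>A\<^esub> y \<oplus>\<^bsub>A\<^esub> \<tau> x \<otimes>\<^bsub>A\<^esub> d y"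
  using assms
proof (induction rule: homogeneous_induct)
  case zero
  then show ?case by (simp add: d_zero twist_zero)
next
  case (homogeneous x k)
  then show ?case
    using grade_carrier[OF homogeneous(1)]
    by (simp add: leibniz twist_homogeneous M.parity_pow l_minus)
next
  case (add x x')
  then show ?case
    by (simp add: l_distr d_add twist_add M.a_ac)
qed

lemma cocycle_closed: "x \<in> cocycles A \<Longrightarrow> x \<in> carrier A"
  and cocycle_d: "x \<in> cocycles A \<Longrightarrow> d x = \<zero>\<^bsub>A\<^esub>"
  by (simp_all add: cocycles_def)

lemma cocycleI: "x \<in> carrier A \<Longrightarrow> d x = \<zero>\<^bsub>A\<^esub> \<Longrightarrow> x \<in> cocycles A"
  by (simp add: cocycles_def)

lemma cocycle_zero: "\<zero>\<^bsub>A\<^esub> \<in> cocycles A"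
  by (simp add: cocycles_def d_zero)

lemma cocycle_add: "x \<in> cocycles A \<Longrightarrow> y \<in> cocycles A \<Longrightarrow> x \<oplus>\<^bsub>A\<^esub> y \<in> cocycles A"
  by (simp add: cocycles_def d_add)

lemma cocycle_neg: "x \<in> cocycles A \<Longrightarrow> \<ominus>\<^bsub>A\<^esub> x \<in> cocycles A"
  by (simp add: cocycles_def d_neg)

lemma cocycle_diff: "x \<in> cocycles A \<Longrightarrow> y \<in> cocycles A \<Longrightarrow> x \<ominus>\<^bsub>A\<^esub> y \<in> cocycles A"
  by (simp add: a_minus_def cocycle_add cocycle_neg)

lemma cocycle_smult: "a \<in> carrier K \<Longrightarrow> x \<in> cocycles A \<Longrightarrow> a \<odot>\<^bsub>A\<^esub> x \<in> cocycles A"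
  by (simp add: cocycles_def d_smult)

lemma cocycle_twist: "x \<in> cocycles A \<Longrightarrow> \<tau> x \<in> cocycles A"
  by (simp add: cocycles_def d_twist twist_zero)

lemma cocycle_mult: "x \<in> cocycles A \<Longrightarrow> y \<in> cocycles A \<Longrightarrow> x \<otimes>\<^bsub>A\<^esub> y \<in> cocycles A"
  by (simp add: cocycles_def leibniz_twist)

lemma cocycle_one: "\<one>\<^bsub>A\<^esub> \<in> cocycles A"
proof -
  have "d \<one>\<^bsub>A\<^esub> = d \<one>\<^bsub>A\<^esub> \<oplus>\<^bsub>A\<^esub> d \<one>\<^bsub>A\<^esub>"
    using leibniz[OF one_grade, of "\<one>\<^bsub>A\<^esub>"] by (simp add: M.parity_pow)
  then have "d \<one>\<^bsub>A\<^esub> = \<zero>\<^bsub>A\<^esub>"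
    using M.add.r_cancel_one' by auto
  then show ?thesis by (simp add: cocycles_def)
qed

text \<open>The components of \<open>d x = 0\<close> vanish, and they are the values of
  \<open>d\<close> on the components of \<open>x\<close>. Hence the cocycles inherit the
  grading.\<close>

lemma cocycle_component: "x \<in> cocycles A \<Longrightarrow> component A x k \<in> cocycles A"
  using d_component[of x k] linear_map_zero[OF component_linear abgrp abgrp]
  by (simp add: cocycles_def)

lemma coboundary_cocycle: "x \<in> carrier A \<Longrightarrow> d x \<in> cocycles A"
  by (simp add: cocycles_def differential_square)

lemma subring_cocycles: "subring (cocycles A) A"
  by (rule subringI) (auto simp: cocycle_one cocycle_mult cocycle_add cocycle_neg cocycle_closed)

lemma subgroup_coboundaries: "subgroup (coboundaries A) (add_monoid (A\<lparr>carrier := cocycles A\<rparr>))"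
proof -
  interpret Z: ring "A\<lparr>carrier := cocycles A\<rparr>"
    using subring_cocycles by (rule subring_is_ring)
  show ?thesis
  proof (rule Z.add.subgroupI)
    show "coboundaries A \<subseteq> carrier (A\<lparr>carrier := cocycles A\<rparr>)"
      by (auto simp: coboundaries_def coboundary_cocycle)
    show "coboundaries A \<noteq> {}"
      by (auto simp: coboundaries_def)
  next
    fix x assume "x \<in> coboundaries A"
    then obtain u where u: "u \<in> carrier A" "x = d u" by (auto simp: coboundaries_def)
    have "\<ominus>\<^bsub>A\<lparr>carrier := cocycles A\<rparr>\<^esub> x = d (\<ominus>\<^bsub>A\<^esub> u)"
      using u coboundary_cocycle
      by (intro Z.minus_equality) (simp_all add: d_neg cocycle_neg M.l_neg)
    then show "\<ominus>\<^bsub>A\<lparr>carrier := cocycles A\<rparr>\<^esub> x \<in> coboundaries A"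
      using u by (auto simp: coboundaries_def)
  next
    fix x y assume "x \<in> coboundaries A" "y \<in> coboundaries A"
    then show "x \<oplus>\<^bsub>A\<lparr>carrier := cocycles A\<rparr>\<^esub> y \<in> coboundaries A"
      by (auto simp: coboundaries_def d_add[symmetric])
  qed
qed

lemma ideal_coboundaries: "ideal (coboundaries A) (A\<lparr>carrier := cocycles A\<rparr>)"
proof (rule idealI)
  show "ring (A\<lparr>carrier := cocycles A\<rparr>)"
    using subring_cocycles by (rule subring_is_ring)
  show "subgroup (coboundaries A) (add_monoid (A\<lparr>carrier := cocycles A\<rparr>))"
    by (rule subgroup_coboundaries)
next
  fix x y assume "x \<in> coboundaries A" and y: "y \<in> carrier (A\<lparr>carrier := cocycles A\<rparr>)"
  then obtain u where u: "u \<in> carrier A" "x = d u" by (auto simp: coboundaries_def)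
  \<comment> \<open>The inner twist cancels the Leibniz sign, and the term with
    \<open>d (\<tau> y)\<close> vanishes because \<open>y\<close> is closed.\<close>
  have "y \<otimes>\<^bsub>A\<^esub> d u = d (\<tau> y \<otimes>\<^bsub>A\<^esub> u)"
    using y u by (simp add: leibniz_twist cocycles_def d_twist twist_zero twist_twist)
  then show "y \<otimes>\<^bsub>A\<lparr>carrier := cocycles A\<rparr>\<^esub> x \<in> coboundaries A"
    using y u by (auto simp: coboundaries_def cocycle_closed)
  have "d u \<otimes>\<^bsub>A\<^esub> y = d (u \<otimes>\<^bsub>A\<^esub> y)"
    using y u by (simp add: leibniz_twist cocycles_def)
  then show "x \<otimes>\<^bsub>A\<lparr>carrier := cocycles A\<rparr>\<^esub> y \<in> coboundaries A"
    using y u by (auto simp: coboundaries_def cocycle_closed)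
qed

lemma cls_mem_iff:
  assumes "x \<in> carrier A"
  shows "y \<in> cls x \<longleftrightarrow> (\<exists>u\<in>carrier A. y = x \<oplus>\<^bsub>A\<^esub> d u)"
  using assms
  by (auto simp: cohomology_class_def a_r_coset_def r_coset_def coboundaries_def M.a_comm)

lemma cls_eq_iff:
  assumes "x \<in> carrier A" "y \<in> carrier A"
  shows "cls x = cls y \<longleftrightarrow> (\<exists>u\<in>carrier A. x = y \<oplus>\<^bsub>A\<^esub> d u)"
proof
  assume "cls x = cls y"
  moreover have "x \<in> cls x"
    using assms by (subst cls_mem_iff) (auto intro!: bexI[of _ "\<zero>\<^bsub>A\<^esub>"] simp: d_zero)
  ultimately show "\<exists>u\<in>carrier A. x = y \<oplus>\<^bsub>A\<^esub> d u"
    using assms by (simp add: cls_mem_iff)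
next
  assume "\<exists>u\<in>carrier A. x = y \<oplus>\<^bsub>A\<^esub> d u"
  then obtain u where u: "u \<in> carrier A" "x = y \<oplus>\<^bsub>A\<^esub> d u" by blast
  show "cls x = cls y"
  proof (intro Set.set_eqI iffI)
    fix w assume "w \<in> cls x"
    then obtain v where "v \<in> carrier A" "w = x \<oplus>\<^bsub>A\<^esub> d v" using assms by (auto simp: cls_mem_iff)
    then show "w \<in> cls y"
      using assms u by (auto simp: cls_mem_iff d_add M.a_assoc intro!: bexI[of _ "u \<oplus>\<^bsub>A\<^esub> v"])
  next
    fix w assume "w \<in> cls y"
    then obtain v where v: "v \<in> carrier A" "w = y \<oplus>\<^bsub>A\<^esub> d v" using assms by (auto simp: cls_mem_iff)
    have "w = x \<oplus>\<^bsub>A\<^esub> (d v \<ominus>\<^bsub>A\<^esub> d u)"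
      using assms(2) u v d_closed[OF u(1)] d_closed[OF v(1)] by algebra
    then show "w \<in> cls x"
      using assms u v by (auto simp: cls_mem_iff d_diff intro!: bexI[of _ "v \<ominus>\<^bsub>A\<^esub> u"])
  qed
qed

lemma cls_eqI: "\<lbrakk>y \<in> carrier A; u \<in> carrier A; x = y \<oplus>\<^bsub>A\<^esub> d u\<rbrakk> \<Longrightarrow> cls x = cls y"
  by (subst cls_eq_iff) auto

lemma cls_self: "x \<in> carrier A \<Longrightarrow> x \<in> cls x"
  by (subst cls_mem_iff) (auto intro!: bexI[of _ "\<zero>\<^bsub>A\<^esub>"] simp: d_zero)

section \<open>The cohomology as a graded commutative algebra\<close>

abbreviation HA :: "('k, 'a set) graded_algebra" where "HA \<equiv> cohomology A"

text \<open>A coset depends only on the addition, so the quotient formed inside the ring of cocycles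
  has the same cosets as one formed in \<open>A\<close>.\<close>

lemma coset_cocycles: "coboundaries A +>\<^bsub>A\<lparr>carrier := cocycles A\<rparr>\<^esub> x = cls x"
  by (simp add: cohomology_class_def a_r_coset_def r_coset_def)

lemma carrier_cohomology: "carrier HA = cls ` cocycles A"
  by (auto simp: cohomology_def Let_def FactRing_def A_RCOSETS_def RCOSETS_def
      coset_cocycles[unfolded a_r_coset_def] a_r_coset_def r_coset_def cohomology_class_def)

lemma cohomology_cases:
  assumes "X \<in> carrier HA"
  obtains x where "x \<in> cocycles A" "X = cls x"
  using assms by (auto simp: carrier_cohomology)

lemma cls_closed [simp, intro]: "x \<in> cocycles A \<Longrightarrow> cls x \<in> carrier HA"
  by (simp add: carrier_cohomology)

lemma cls_add:
  assumes "x \<in> cocycles A" "y \<in> cocycles A"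
  shows "cls x \<oplus>\<^bsub>HA\<^esub> cls y = cls (x \<oplus>\<^bsub>A\<^esub> y)"
proof -
  interpret I: ideal "coboundaries A" "A\<lparr>carrier := cocycles A\<rparr>" by (rule ideal_coboundaries)
  show ?thesis
    using I.a_rcos_sum[of x y] assms
    by (simp add: cohomology_def Let_def FactRing_def coset_cocycles set_add_def)
qed

lemma cls_mult:
  assumes "x \<in> cocycles A" "y \<in> cocycles A"
  shows "cls x \<otimes>\<^bsub>HA\<^esub> cls y = cls (x \<otimes>\<^bsub>A\<^esub> y)"
proof -
  interpret I: ideal "coboundaries A" "A\<lparr>carrier := cocycles A\<rparr>" by (rule ideal_coboundaries)
  show ?thesis
    using I.rcoset_mult_add[of x y] assms
    by (simp add: cohomology_def Let_def FactRing_def coset_cocycles)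
qed

lemma cohomology_one: "\<one>\<^bsub>HA\<^esub> = cls \<one>\<^bsub>A\<^esub>"
  by (simp add: cohomology_def Let_def FactRing_def coset_cocycles)

lemma cohomology_zero: "\<zero>\<^bsub>HA\<^esub> = cls \<zero>\<^bsub>A\<^esub>"
proof -
  have "cls \<zero>\<^bsub>A\<^esub> = coboundaries A"
    by (auto simp: cls_mem_iff coboundaries_def)
  then show ?thesis by (simp add: cohomology_def Let_def FactRing_def)
qed

text \<open>The scalar action is a union over representatives. It collapses because all of them give
  one class and a coset is not empty.\<close>

lemma cls_smult:
  assumes "a \<in> carrier K" "x \<in> cocycles A"
  shows "a \<odot>\<^bsub>HA\<^esub> cls x = cls (a \<odot>\<^bsub>A\<^esub> x)"
proof -
  have x: "x \<in> carrier A" using assms cocycle_closed by blast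
  have "cls (a \<odot>\<^bsub>A\<^esub> y) = cls (a \<odot>\<^bsub>A\<^esub> x)" if y: "y \<in> cls x" for y
  proof -
    obtain u where "u \<in> carrier A" "y = x \<oplus>\<^bsub>A\<^esub> d u" using y x by (auto simp: cls_mem_iff)
    then show ?thesis
      using assms x by (intro cls_eqI[of _ "a \<odot>\<^bsub>A\<^esub> u"]) (simp_all add: smult_r_distr d_smult)
  qed
  then have "(\<Union>y\<in>cls x. cls (a \<odot>\<^bsub>A\<^esub> y)) = (\<Union>y\<in>cls x. cls (a \<odot>\<^bsub>A\<^esub> x))"
    by (intro SUP_cong refl)
  then show ?thesis
    using cls_self[OF x] by (simp add: cohomology_def Let_def) blast
qed

lemma grade_cohomology: "grade HA k = cls ` (cocycles A \<inter> grade A k)"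
  by (simp add: cohomology_def Let_def)

lemma cls_grade: "x \<in> cocycles A \<Longrightarrow> x \<in> grade A k \<Longrightarrow> cls x \<in> grade HA k"
  by (auto simp: grade_cohomology)

lemma ring_cohomology: "ring HA"
proof (rule ringI)
  show "abelian_group HA"
  proof (rule abelian_groupI)
    show "\<exists>Y\<in>carrier HA. Y \<oplus>\<^bsub>HA\<^esub> X = \<zero>\<^bsub>HA\<^esub>" if X: "X \<in> carrier HA" for X
    proof -
      obtain x where x: "x \<in> cocycles A" "X = cls x" using X cohomology_cases by blast
      then show ?thesis
        by (intro bexI[of _ "cls (\<ominus>\<^bsub>A\<^esub> x)"])
          (auto simp: cls_add cocycle_neg cohomology_zero cocycle_closed M.l_neg)
    qed
  qed (auto elim!: cohomology_cases
      simp: cls_add cocycle_add cohomology_zero cocycle_zero cocycle_closed M.a_ac)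
  show "monoid HA"
    by (rule monoidI) (auto elim!: cohomology_cases
      simp: cls_mult cocycle_mult cohomology_one cocycle_one cocycle_closed m_assoc)
qed (auto elim!: cohomology_cases
    simp: cls_mult cls_add cocycle_mult cocycle_add cocycle_closed l_distr r_distr)

lemma module_cohomology: "Module.module K HA"
proof (rule moduleI)
  show "cring K" ..
  show "abelian_group HA" using ring_cohomology by (rule ring.is_abelian_group)
qed (auto elim!: cohomology_cases
    simp: cls_smult cls_add cocycle_smult cocycle_add cocycle_closed smult_l_distr smult_r_distr smult_assoc1)

lemma cls_neg: 
  assumes "x \<in> cocycles A"
  shows "cls (\<ominus>\<^bsub>A\<^esub> x) = \<ominus>\<^bsub>HA\<^esub> cls x"
proof -
  interpret H: ring HA by (rule ring_cohomology)
  show ?thesis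
    using assms
    by (intro H.minus_equality[symmetric])
      (auto simp: cls_add cocycle_neg cohomology_zero cocycle_closed M.l_neg)
qed

text \<open>Representatives differ by some \<open>d u\<close>, whose component in degree
  \<open>k\<close> is \<open>d\<close> of the component of \<open>u\<close> in degree
  \<open>k - 1\<close>. So components of classes are well defined.\<close>

lemma cls_component:
  assumes "x \<in> cocycles A" "y \<in> cocycles A" "cls x = cls y"
  shows "cls (component A x k) = cls (component A y k)"
proof -
  obtain u where u: "u \<in> carrier A" "x = y \<oplus>\<^bsub>A\<^esub> d u"
    using assms cls_eq_iff cocycle_closed by meson
  have "component A x k = component A y k \<oplus>\<^bsub>A\<^esub> d (component A u (k - 1))"
    using u assms cocycle_closed d_component[of u "k - 1"] by (simp add: component_add)
  then show ?thesis
    using u assms cocycle_closed by (intro cls_eqI) auto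
qed

text \<open>Passing to classes is additive only on cocycles. The sum is therefore first recognised
  as a sum in the ring of cocycles, to which \<open>finsum_additive\<close> applies.\<close>

lemma cls_finsum:
  assumes "c \<in> F \<rightarrow> cocycles A"
  shows "cls (finsum A c F) = finsum HA (\<lambda>k. cls (c k)) F"
proof -
  interpret H: ring HA by (rule ring_cohomology)
  interpret Z: ring "A\<lparr>carrier := cocycles A\<rparr>"
    using subring_cocycles by (rule subring_is_ring)
  have eq: "finsum (A\<lparr>carrier := cocycles A\<rparr>) c F = finsum A c F"
  proof (cases "finite F")
    case True
    then show ?thesis
      using assms
    proof (induction F)
      case (insert k F)
      have "c \<in> F \<rightarrow> carrier A" "c k \<in> carrier A" using insert(4) cocycle_closed by auto
      moreover have "finsum (A\<lparr>carrier := cocycles A\<rparr>) c (insert k F)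
          = c k \<oplus>\<^bsub>A\<^esub> finsum (A\<lparr>carrier := cocycles A\<rparr>) c F"
        using insert by (subst Z.finsum_insert) auto
      ultimately show ?case using insert by simp
    qed simp
  qed (simp add: M.finsum_infinite Z.finsum_infinite)
  have "cls (finsum (A\<lparr>carrier := cocycles A\<rparr>) c F) = finsum HA (\<lambda>k. cls (c k)) F"
    using assms
    by (intro finsum_additive[of "A\<lparr>carrier := cocycles A\<rparr>" HA cls c F])
      (auto simp: Z.abelian_monoid_axioms H.abelian_monoid_axioms cls_add cohomology_zero)
  then show ?thesis by (simp add: eq)
qed

lemma gca_cohomology: "gca K HA"
proof -
  interpret H: ring HA by (rule ring_cohomology)
  interpret HM: Module.module K HA by (rule module_cohomology)
  have grade_sub: "grade HA k \<subseteq> carrier HA" for k by (auto simp: grade_cohomology)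
  show ?thesis
  proof (intro gca.intro gca_axioms.intro)
    show "Module.module K HA" by (rule module_cohomology)
    show "ring HA" by (rule ring_cohomology)
  next
    fix c X Y assume "c \<in> carrier K" "X \<in> carrier HA" "Y \<in> carrier HA"
    then show "(c \<odot>\<^bsub>HA\<^esub> X) \<otimes>\<^bsub>HA\<^esub> Y = c \<odot>\<^bsub>HA\<^esub> (X \<otimes>\<^bsub>HA\<^esub> Y)"
      "X \<otimes>\<^bsub>HA\<^esub> (c \<odot>\<^bsub>HA\<^esub> Y) = c \<odot>\<^bsub>HA\<^esub> (X \<otimes>\<^bsub>HA\<^esub> Y)"
      by (auto elim!: cohomology_cases
          simp: cls_smult cls_mult cocycle_smult cocycle_mult cocycle_closed smult_mult_left smult_mult_right)
  next
    fix k
    show "submodule (grade HA k) K HA"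
    proof (rule HM.submoduleI)
      show "\<zero>\<^bsub>HA\<^esub> \<in> grade HA k"
        using cocycle_zero grade_zero[of k] by (auto simp: grade_cohomology cohomology_zero)
      fix X assume "X \<in> grade HA k"
      then obtain x where x: "x \<in> cocycles A" "x \<in> grade A k" "X = cls x" by (auto simp: grade_cohomology)
      then show "\<ominus>\<^bsub>HA\<^esub> X \<in> grade HA k"
        by (auto simp: cls_neg[symmetric] cls_grade cocycle_neg grade_neg)
      show "c \<odot>\<^bsub>HA\<^esub> X \<in> grade HA k" if "c \<in> carrier K" for c
        using that x by (auto simp: cls_smult cls_grade cocycle_smult grade_smult)
      fix Y assume "Y \<in> grade HA k"
      then obtain y where y: "y \<in> cocycles A" "y \<in> grade A k" "Y = cls y" by (auto simp: grade_cohomology)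
      then show "X \<oplus>\<^bsub>HA\<^esub> Y \<in> grade HA k"
        using x by (auto simp: cls_add cls_grade cocycle_add grade_add)
    qed (rule grade_sub)
  next
    fix X assume "X \<in> carrier HA"
    then obtain x where x: "x \<in> cocycles A" "X = cls x" by (rule cohomology_cases)
    have xA: "x \<in> carrier A" using x cocycle_closed by blast
    show "\<exists>!c. is_decomposition HA X c"
    proof (rule ex1I)
      let ?c = "\<lambda>k. cls (component A x k)" and ?F = "{k. component A x k \<noteq> \<zero>\<^bsub>A\<^esub>}"
      have sub: "{k. ?c k \<noteq> \<zero>\<^bsub>HA\<^esub>} \<subseteq> ?F" by (auto simp: cohomology_zero)
      have "X = finsum HA ?c ?F"
        using component_sum[OF xA component_finite[OF xA] order_refl]
          cls_finsum[of "component A x" ?F] x cocycle_component by simp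
      also have "\<dots> = finsum HA ?c {k. ?c k \<noteq> \<zero>\<^bsub>HA\<^esub>}"
        using component_finite[OF xA] sub x cocycle_component
        by (intro H.add.finprod_mono_neutral_cong_right) auto
      finally show "is_decomposition HA X ?c"
        unfolding is_decomposition_def
        using finite_subset[OF sub component_finite[OF xA]] x(1) xA
        by (auto intro!: cls_grade cocycle_component component_grade)
    next
      fix C assume C: "is_decomposition HA X C"
      let ?F = "{k. C k \<noteq> \<zero>\<^bsub>HA\<^esub>}"
      have F: "finite ?F" and XC: "X = finsum HA C ?F" using C by (auto simp: is_decomposition_def)
      have "\<exists>c. c \<in> cocycles A \<inter> grade A k \<and> C k = cls c" for k
        using C by (auto simp: is_decomposition_def grade_cohomology)
      then obtain c0 where c0: "\<And>k. c0 k \<in> cocycles A \<inter> grade A k" "\<And>k. C k = cls (c0 k)" by metis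
      \<comment> \<open>A chosen representative of the zero class may be a nonzero coboundary.
        Resetting it to zero off the support keeps the lifted family finitely supported.\<close>
      define c where "c k = (if k \<in> ?F then c0 k else \<zero>\<^bsub>A\<^esub>)" for k
      have c: "c k \<in> cocycles A" "c k \<in> grade A k" "C k = cls (c k)" for k
        using c0[of k] cocycle_zero by (auto simp: c_def cohomology_zero)
      have comp: "component A (finsum A c ?F) = c"
        by (rule component_eqI[of c ?F]) (fact c(2) F | simp add: c_def)+
      have zs: "finsum A c ?F \<in> cocycles A"
      proof -
        have "finsum A c G \<in> cocycles A" if "finite G" for G
          using that by (induction G) (use c(1) cocycle_closed in \<open>auto simp: cocycle_zero cocycle_add\<close>)
        then show ?thesis using F by blast
      qed
      \<comment> \<open>The lifted sum is cohomologous to \<open>x\<close>, so by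
        \<open>cls_component\<close> both have the same components up to coboundaries; those of the
        lift are the given terms.\<close>
      have "X = cls (finsum A c ?F)"
        using XC cls_finsum[of c ?F] c(1) by (simp add: c(3)[symmetric])
      then have "cls (component A x k) = cls (c k)" for k
        using cls_component[OF x(1) zs] x(2) comp by simp
      then show "C = (\<lambda>k. cls (component A x k))"
        by (simp add: c(3)[symmetric])
    qed
  next
    show "\<one>\<^bsub>HA\<^esub> \<in> grade HA 0"
      by (simp add: cohomology_one cls_grade cocycle_one one_grade)
  next
    fix X Y i j assume "X \<in> grade HA i" "Y \<in> grade HA j"
    then obtain x y where x: "x \<in> cocycles A" "x \<in> grade A i" "X = cls x"
      and y: "y \<in> cocycles A" "y \<in> grade A j" "Y = cls y" by (auto simp: grade_cohomology)
    show "X \<otimes>\<^bsub>HA\<^esub> Y \<in> grade HA (i + j)"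
      using x y by (simp add: cls_mult cls_grade cocycle_mult mult_grade)
    show "X \<otimes>\<^bsub>HA\<^esub> Y = [parity_sign (i * j)] \<cdot>\<^bsub>HA\<^esub> (Y \<otimes>\<^bsub>HA\<^esub> X)"
      using x y graded_commutative[OF x(2) y(2)]
      by (simp add: cls_mult cocycle_mult cls_neg[symmetric] H.parity_pow M.parity_pow cocycle_closed)
  qed
qed

lemma component_cls:
  assumes "x \<in> cocycles A"
  shows "component HA (cls x) k = cls (component A x k)"
proof -
  interpret H: gca K HA by (rule gca_cohomology)
  let ?F = "{k. component A x k \<noteq> \<zero>\<^bsub>A\<^esub>}"
  have xA: "x \<in> carrier A" using assms cocycle_closed by blast
  have "component HA (cls x) = (\<lambda>k. cls (component A x k))"
  proof (rule H.component_eqI[of _ ?F])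
    show "cls x = finsum HA (\<lambda>k. cls (component A x k)) ?F"
      using component_sum[OF xA component_finite[OF xA] order_refl]
          cls_finsum[of "component A x" ?F] assms cocycle_component by simp
  qed (use assms xA in \<open>auto intro!: cls_grade cocycle_component component_grade component_finite
      simp: cohomology_zero\<close>)
  then show ?thesis by simp
qed

end

section \<open>Low-degree Hochschild and Harrison cochains\<close>

lemma length2_conv: "length xs = 2 \<longleftrightarrow> (\<exists>a b. xs = [a, b])"
  by (auto simp: numeral_2_eq_2 length_Suc_conv)

lemma length3_conv: "length xs = 3 \<longleftrightarrow> (\<exists>a b c. xs = [a, b, c])"
  by (auto simp: numeral_3_eq_3 length_Suc_conv)

lemma length4_conv: "length xs = 4 \<longleftrightarrow> (\<exists>a b c e. xs = [a, b, c, e])"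
  by (auto simp: numeral_eq_Suc length_Suc_conv)

lemma tuples2_iff: "xs \<in> tuples B 2 \<longleftrightarrow> (\<exists>a\<in>carrier B. \<exists>b\<in>carrier B. xs = [a, b])"
  by (auto simp: tuples_def length2_conv)

lemma tuples3_iff:
  "xs \<in> tuples B 3 \<longleftrightarrow> (\<exists>a\<in>carrier B. \<exists>b\<in>carrier B. \<exists>c\<in>carrier B. xs = [a, b, c])"
  by (auto simp: tuples_def length3_conv)

lemma tuples4_iff:
  "xs \<in> tuples B 4 \<longleftrightarrow>
    (\<exists>a\<in>carrier B. \<exists>b\<in>carrier B. \<exists>c\<in>carrier B. \<exists>e\<in>carrier B. xs = [a, b, c, e])"
  by (auto simp: tuples_def length4_conv)

lemma homogeneous_of_Cons:
  "homogeneous_of B (x # xs) ks \<longleftrightarrow> (\<exists>k ks'. ks = k # ks' \<and> x \<in> grade B k \<and> homogeneous_of B xs ks')"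
  by (auto simp: homogeneous_of_def list_all2_Cons1)

lemma homogeneous_of_Nil: "homogeneous_of B [] ks \<longleftrightarrow> ks = []"
  by (simp add: homogeneous_of_def)

text \<open>The module structure guarantees that sums and multiples stay in the carrier, where the
  two maps agree.\<close>

lemma linear_map_cong:
  assumes f: "linear_map K M N f" and eq: "\<And>x. x \<in> carrier M \<Longrightarrow> f x = g x" and M: "Module.module K M"
  shows "linear_map K M N g"
proof -
  interpret Module.module K M by fact
  show ?thesis
    by (rule linear_mapI)
      (simp_all add: eq[symmetric] linear_map_closed[OF f] linear_map_add[OF f] linear_map_smult[OF f])
qed

context gca
begin

lemma tuplesI [simp, intro]:
  "\<lbrakk>a \<in> carrier B; b \<in> carrier B\<rbrakk> \<Longrightarrow> [a, b] \<in> tuples B 2"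
  "\<lbrakk>a \<in> carrier B; b \<in> carrier B\<rbrakk> \<Longrightarrow> [a, b] \<in> tuples B (Suc (Suc 0))"
  "\<lbrakk>a \<in> carrier B; b \<in> carrier B; c \<in> carrier B\<rbrakk> \<Longrightarrow> [a, b, c] \<in> tuples B 3"
  "\<lbrakk>a \<in> carrier B; b \<in> carrier B; c \<in> carrier B\<rbrakk> \<Longrightarrow> [a, b, c] \<in> tuples B (Suc (Suc (Suc 0)))"
  "\<lbrakk>a \<in> carrier B; b \<in> carrier B; c \<in> carrier B; e \<in> carrier B\<rbrakk> \<Longrightarrow> [a, b, c, e] \<in> tuples B 4"
  "\<lbrakk>a \<in> carrier B; b \<in> carrier B; c \<in> carrier B; e \<in> carrier B\<rbrakk>
    \<Longrightarrow> [a, b, c, e] \<in> tuples B (Suc (Suc (Suc (Suc 0))))"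
  by (simp_all add: tuples_def)

lemma hoch_diff2:
  assumes f: "f \<in> tuples B 2 \<rightarrow> carrier B" and x: "a \<in> carrier B" "b \<in> carrier B" "c \<in> carrier B"
  shows "hoch_diff B 2 (- 1) f [a, b, c] =
    \<tau> a \<otimes>\<^bsub>B\<^esub> f [b, c] \<oplus>\<^bsub>B\<^esub> (\<ominus>\<^bsub>B\<^esub> f [a \<otimes>\<^bsub>B\<^esub> b, c] \<oplus>\<^bsub>B\<^esub> f [a, b \<otimes>\<^bsub>B\<^esub> c])
      \<ominus>\<^bsub>B\<^esub> f [a, b] \<otimes>\<^bsub>B\<^esub> c"
proof -
  have cl: "f [p, q] \<in> carrier B" if "p \<in> carrier B" "q \<in> carrier B" for p q
    using f that by auto
  have "{1..2} = {1, 2::nat}" by auto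
  then show ?thesis
    using x cl by (simp add: hoch_diff_def sign_twist_minus_one M.parity_pow a_minus_def parity_sign_def
        M.int_one_pow M.int_minus_one_pow numeral_2_eq_2 flip: numeral_3_eq_3)
qed

lemma hoch_diff2_closed:
  assumes f: "f \<in> tuples B 2 \<rightarrow> carrier B" and xs: "xs \<in> tuples B 3"
  shows "hoch_diff B 2 (- 1) f xs \<in> carrier B"
proof -
  obtain a b c where x: "xs = [a, b, c]" and cl: "a \<in> carrier B" "b \<in> carrier B" "c \<in> carrier B"
    using xs by (auto simp: tuples3_iff)
  have "f [p, q] \<in> carrier B" if "p \<in> carrier B" "q \<in> carrier B" for p q
    using f that by auto
  then show ?thesis unfolding x hoch_diff2[OF f cl] using cl by simp
qed

lemma hoch_diff3:
  assumes f: "f \<in> tuples B 3 \<rightarrow> carrier B"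
    and x: "a \<in> carrier B" "b \<in> carrier B" "c \<in> carrier B" "e \<in> carrier B"
  shows "hoch_diff B 3 (- 1) f [a, b, c, e] =
    \<tau> a \<otimes>\<^bsub>B\<^esub> f [b, c, e]
      \<oplus>\<^bsub>B\<^esub> (\<ominus>\<^bsub>B\<^esub> f [a \<otimes>\<^bsub>B\<^esub> b, c, e] \<oplus>\<^bsub>B\<^esub> (f [a, b \<otimes>\<^bsub>B\<^esub> c, e] \<ominus>\<^bsub>B\<^esub> f [a, b, c \<otimes>\<^bsub>B\<^esub> e]))
      \<oplus>\<^bsub>B\<^esub> f [a, b, c] \<otimes>\<^bsub>B\<^esub> e"
proof -
  have cl: "f [p, q, r] \<in> carrier B" if "p \<in> carrier B" "q \<in> carrier B" "r \<in> carrier B" for p q r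
    using f that by auto
  \<comment> \<open>The last sign is that of p + 1 with p = 3. The numerals are unfolded below so
    that the list operations compute, hence the parity in successor form.\<close>
  have "{1..3} = {1, 2, 3::nat}" "\<not> Suc (Suc 0) dvd Suc (Suc (Suc 0))" by (auto, presburger)
  then show ?thesis
    using x cl by (simp add: hoch_diff_def sign_twist_minus_one M.parity_pow a_minus_def parity_sign_def
        M.int_one_pow M.int_minus_one_pow numeral_2_eq_2 numeral_3_eq_3)
qed

lemma CHoch2I:
  assumes l: "\<And>b. b \<in> carrier B \<Longrightarrow> linear_map K B B (\<lambda>a. F a b)"
    and r: "\<And>a. a \<in> carrier B \<Longrightarrow> linear_map K B B (F a)"
    and g: "\<And>a b i j. a \<in> grade B i \<Longrightarrow> b \<in> grade B j \<Longrightarrow> F a b \<in> grade B (i + j + q)"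
  shows "(\<lambda>xs\<in>tuples B 2. F (xs ! 0) (xs ! 1)) \<in> CHoch K B 2 q"
  unfolding CHoch_def
proof (intro CollectI conjI ballI allI impI)
  let ?f = "\<lambda>xs\<in>tuples B 2. F (xs ! 0) (xs ! 1)"
  have cl: "F a b \<in> carrier B" if "a \<in> carrier B" "b \<in> carrier B" for a b
    using linear_map_closed[OF l] that by blast
  show "?f \<in> tuples B 2 \<rightarrow>\<^sub>E carrier B"
    by (auto simp: tuples2_iff cl)
  fix xs assume "xs \<in> tuples B 2"
  then obtain a b where ab: "a \<in> carrier B" "b \<in> carrier B" "xs = [a, b]" by (auto simp: tuples2_iff)
  show "linear_map K B B (\<lambda>x. ?f (xs[i := x]))" if "i < 2" for i
  proof -
    consider "i = 0" | "i = 1" using \<open>i < 2\<close> by linarith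
    then show ?thesis
    proof cases
      case 1
      show ?thesis
        by (rule linear_map_cong[OF l[of b]]) (use ab 1 in \<open>auto intro: module_axioms\<close>)
    next
      case 2
      show ?thesis
        by (rule linear_map_cong[OF r[of a]]) (use ab 2 in \<open>auto intro: module_axioms\<close>)
    qed
  qed
  show "?f xs \<in> grade B (sum_list ks + q)" if "homogeneous_of B xs ks" for ks
    using that ab g by (auto simp: homogeneous_of_Cons homogeneous_of_Nil add.assoc)
qed

lemma CHoch3I:
  assumes l: "\<And>b c. b \<in> carrier B \<Longrightarrow> c \<in> carrier B \<Longrightarrow> linear_map K B B (\<lambda>a. F a b c)"
    and mi: "\<And>a c. a \<in> carrier B \<Longrightarrow> c \<in> carrier B \<Longrightarrow> linear_map K B B (\<lambda>b. F a b c)"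
    and r: "\<And>a b. a \<in> carrier B \<Longrightarrow> b \<in> carrier B \<Longrightarrow> linear_map K B B (F a b)"
    and g: "\<And>a b c i j k. a \<in> grade B i \<Longrightarrow> b \<in> grade B j \<Longrightarrow> c \<in> grade B k
        \<Longrightarrow> F a b c \<in> grade B (i + j + k + q)"
  shows "(\<lambda>xs\<in>tuples B 3. F (xs ! 0) (xs ! 1) (xs ! 2)) \<in> CHoch K B 3 q"
  unfolding CHoch_def
proof (intro CollectI conjI ballI allI impI)
  let ?f = "\<lambda>xs\<in>tuples B 3. F (xs ! 0) (xs ! 1) (xs ! 2)"
  have cl: "F a b c \<in> carrier B" if "a \<in> carrier B" "b \<in> carrier B" "c \<in> carrier B" for a b c
    using linear_map_closed[OF l] that by blast
  show "?f \<in> tuples B 3 \<rightarrow>\<^sub>E carrier B"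
    by (auto simp: tuples3_iff cl)
  fix xs assume "xs \<in> tuples B 3"
  then obtain a b c where abc: "a \<in> carrier B" "b \<in> carrier B" "c \<in> carrier B" "xs = [a, b, c]"
    by (auto simp: tuples3_iff)
  show "linear_map K B B (\<lambda>x. ?f (xs[i := x]))" if "i < 3" for i
  proof -
    consider "i = 0" | "i = 1" | "i = 2" using \<open>i < 3\<close> by linarith
    then show ?thesis
    proof cases
      case 1
      show ?thesis
        by (rule linear_map_cong[OF l[of b c]]) (use abc 1 in \<open>auto intro: module_axioms\<close>)
    next
      case 2
      show ?thesis
        by (rule linear_map_cong[OF mi[of a c]]) (use abc 2 in \<open>auto intro: module_axioms\<close>)
    next
      case 3
      show ?thesis
        by (rule linear_map_cong[OF r[of a b]]) (use abc 3 in \<open>auto intro: module_axioms simp: numeral_2_eq_2\<close>)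
    qed
  qed
  show "?f xs \<in> grade B (sum_list ks + q)" if "homogeneous_of B xs ks" for ks
    using that abc g by (auto simp: homogeneous_of_Cons homogeneous_of_Nil numeral_2_eq_2 simp flip: add.assoc)
qed

end

section \<open>Shuffles of two and three letters and their signed sums\<close>

lemma permutes_lessThan_2: "{\<sigma>. \<sigma> permutes {..<2::nat}} = {id, transpose 0 1}"
proof -
  have "{..<2::nat} = {0, 1}" by auto
  then show ?thesis by (simp add: permutes_doubleton_iff Collect_disj_eq) (auto simp: transpose_def fun_eq_iff)
qed

lemma shuffle_perms_1_2: "shuffle_perms 1 2 = {id, transpose 0 1}"
proof -
  have "{1..<2::nat} = {1}" by auto
  then have "shuffle_perms 1 2 = {\<sigma>. \<sigma> permutes {..<2::nat}}"
    by (auto simp: shuffle_perms_def strict_mono_on_def)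
  then show ?thesis using permutes_lessThan_2 by simp
qed

lemma permutes_lessThan_3:
  "{\<sigma>. \<sigma> permutes {..<3::nat}} = {id, transpose 0 1, transpose 0 2, transpose 1 2,
     transpose 0 2 \<circ> transpose 0 1, transpose 0 1 \<circ> transpose 0 2}" (is "?P = ?Q")
proof
  have 3: "{..<3::nat} = {0, 1, 2}" by auto
  show "?Q \<subseteq> ?P"
    unfolding 3 by (auto intro!: permutes_compose permutes_swap_id permutes_id)
  show "?P \<subseteq> ?Q"
  proof
    fix \<sigma> assume "\<sigma> \<in> ?P"
    then have p: "\<sigma> permutes {0, 1, 2}" unfolding 3 by simp
    then have "\<sigma> ` {0, 1, 2} = {0, 1, 2}" by (rule permutes_image)
    then have "\<sigma> 0 \<in> {0, 1, 2}" "\<sigma> 1 \<in> {0, 1, 2}" "\<sigma> 2 \<in> {0, 1, 2}" by blast+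
    moreover have "\<sigma> 0 \<noteq> \<sigma> 1" "\<sigma> 0 \<noteq> \<sigma> 2" "\<sigma> 1 \<noteq> \<sigma> 2"
      using permutes_inj[OF p] by (auto simp: inj_eq)
    \<comment> \<open>A permutation of three letters is determined by its three values, so the final
      case split over these values covers everything.\<close>
    moreover have ext: "\<sigma> = \<rho>" if "\<rho> permutes {0, 1, 2}" "\<sigma> 0 = \<rho> 0" "\<sigma> 1 = \<rho> 1" "\<sigma> 2 = \<rho> 2" for \<rho>
    proof
      show "\<sigma> x = \<rho> x" for x
        using that permutes_not_in[OF p, of x] permutes_not_in[OF that(1), of x] by (cases "x \<in> {0, 1, 2}") auto
    qed
    moreover have "\<rho> permutes {0, 1, 2}" if "\<rho> \<in> ?Q" for \<rho>
      using that by (auto intro!: permutes_compose permutes_swap_id permutes_id)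
    ultimately show "\<sigma> \<in> ?Q"
      by (elim insertE emptyE) (simp_all add: transpose_def)
  qed
qed


lemma strict_mono_on_insert_singleton:
  fixes f :: "nat \<Rightarrow> nat"
  assumes "a < b" shows "strict_mono_on {a, b} f \<longleftrightarrow> f a < f b"
  using assms unfolding strict_mono_on_def by force

lemma strict_mono_on_singleton: "strict_mono_on {a :: nat} (f :: nat \<Rightarrow> nat)"
  by (simp add: strict_mono_on_def)

text \<open>Filters an explicitly listed set one element at a time by rewriting.\<close>

lemma Collect_insert_conj:
  "{x. x \<in> insert a S \<and> P x} = (if P a then insert a {x. x \<in> S \<and> P x} else {x. x \<in> S \<and> P x})"
  by auto

text \<open>The block {0} imposes no condition. The three shuffles place the first letter before,
  between or after the other two, whose order is kept.\<close>

lemma shuffle_perms_1_3: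
  "shuffle_perms 1 3 = {id, transpose 0 1, transpose 0 1 \<circ> transpose 0 2}"
proof -
  have *: "{1..<3::nat} = {1, 2}" "{..<1::nat} = {0}" by auto
  have "shuffle_perms 1 3 = {\<sigma> \<in> {\<sigma>. \<sigma> permutes {..<3::nat}}. \<sigma> 1 < \<sigma> 2}"
    unfolding shuffle_perms_def *
    by (simp add: strict_mono_on_insert_singleton strict_mono_on_singleton)
  moreover have "id (1::nat) < id (2::nat)" " (transpose 0 1 (1::nat) < transpose 0 1 (2::nat))"
    "\<not> (transpose 0 2 (1::nat) < transpose 0 2 (2::nat))" "\<not> (transpose 1 2 (1::nat) < transpose 1 2 (2::nat))"
    "\<not> ((transpose 0 2 \<circ> transpose 0 1) (1::nat) < (transpose 0 2 \<circ> transpose 0 1) (2::nat))"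
    " ((transpose 0 1 \<circ> transpose 0 2) (1::nat) < (transpose 0 1 \<circ> transpose 0 2) (2::nat))"
    by (simp_all add: transpose_def)
  ultimately show ?thesis
    unfolding permutes_lessThan_3 by (simp only: Collect_insert_conj empty_iff simp_thms if_True if_False empty_def[symmetric])
qed

text \<open>Dually, the last letter is placed in one of three positions relative to the first
  two.\<close>

lemma shuffle_perms_2_3:
  "shuffle_perms 2 3 = {id, transpose 1 2, transpose 0 2 \<circ> transpose 0 1}"
proof -
  have *: "{2..<3::nat} = {2}" "{..<2::nat} = {0, 1}" by auto
  have "shuffle_perms 2 3 = {\<sigma> \<in> {\<sigma>. \<sigma> permutes {..<3::nat}}. \<sigma> 0 < \<sigma> 1}"
    unfolding shuffle_perms_def *
    by (simp add: strict_mono_on_insert_singleton strict_mono_on_singleton)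
  moreover have "id (0::nat) < id (1::nat)" "\<not> (transpose 0 1 (0::nat) < transpose 0 1 (1::nat))"
    "\<not> (transpose 0 2 (0::nat) < transpose 0 2 (1::nat))" " (transpose 1 2 (0::nat) < transpose 1 2 (1::nat))"
    " ((transpose 0 2 \<circ> transpose 0 1) (0::nat) < (transpose 0 2 \<circ> transpose 0 1) (1::nat))"
    "\<not> ((transpose 0 1 \<circ> transpose 0 2) (0::nat) < (transpose 0 1 \<circ> transpose 0 2) (1::nat))"
    by (simp_all add: transpose_def)
  ultimately show ?thesis
    unfolding permutes_lessThan_3 by (simp only: Collect_insert_conj empty_iff simp_thms if_True if_False empty_def[symmetric])
qed

lemma koszul_exponent2: "koszul_exponent \<sigma> [i, j] = (if \<sigma> 1 < \<sigma> 0 then i * j else 0)"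
proof -
  have *: "{(p, l). p < l \<and> l < length [i, j] \<and> \<sigma> l < \<sigma> p}
      = {x \<in> {(0, 1)}. \<sigma> (snd x) < \<sigma> (fst x)}"
    by (auto simp: less_Suc_eq)
  show ?thesis
    unfolding koszul_exponent_def * by (subst sum.inter_filter) auto
qed

lemma koszul_exponent3:
  "koszul_exponent \<sigma> [i, j, k] = (if \<sigma> 1 < \<sigma> 0 then i * j else 0) + (if \<sigma> 2 < \<sigma> 0 then i * k else 0)
    + (if \<sigma> 2 < \<sigma> 1 then j * k else 0)"
proof -
  have *: "{(p, l). p < l \<and> l < length [i, j, k] \<and> \<sigma> l < \<sigma> p}
      = {x \<in> {(0, 1), (0, 2), (1, 2)}. \<sigma> (snd x) < \<sigma> (fst x)}"
    by (auto simp: less_Suc_eq numeral_2_eq_2)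
  show ?thesis
    unfolding koszul_exponent_def * by (subst sum.inter_filter) (auto simp: numeral_2_eq_2)
qed

lemma inj_transpose_neq: "a \<noteq> b \<Longrightarrow> transpose a b \<noteq> id"
  by (metis id_apply transpose_apply_first)

text \<open>Its vanishing is graded symmetry: in arity two the sign of the transposition contributes
  a minus, and this is the only shuffle condition.\<close>

lemma shuffle_sum2:
  assumes "abelian_group B" "f [a, b] \<in> carrier B" "f [b, a] \<in> carrier B"
  shows "(\<Oplus>\<^bsub>B\<^esub>\<sigma>\<in>shuffle_perms 1 2. [(sign \<sigma> * parity_sign (koszul_exponent \<sigma> [i, j]))] \<cdot>\<^bsub>B\<^esub>
             f (permute_list (inv_into UNIV \<sigma>) [a, b]))
    = f [a, b] \<ominus>\<^bsub>B\<^esub> [parity_sign (i * j)] \<cdot>\<^bsub>B\<^esub> f [b, a]"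
proof -
  interpret abelian_group B by fact
  have "transpose 0 (Suc 0) \<noteq> id" by (rule inj_transpose_neq) simp
  then show ?thesis
    using assms
    unfolding shuffle_perms_1_2
    by (auto simp: koszul_exponent2 sign_swap_id permute_list_def transpose_def int_one_pow
        int_minus_one_pow parity_sign_def a_minus_def)
qed


lemma (in abelian_group) finsum_three:
  assumes "x \<noteq> y" "x \<noteq> w" "y \<noteq> w" "g x \<in> carrier G" "g y \<in> carrier G" "g w \<in> carrier G"
  shows "finsum G g {x, y, w} = g x \<oplus> (g y \<oplus> g w)"
  using assms by simp

lemma (in abelian_group) minus_eq_zero_iff:
  assumes "x \<in> carrier G" "y \<in> carrier G"
  shows "x \<ominus> y = \<zero> \<longleftrightarrow> x = y"
  using assms minus_equality[of x "\<ominus> y"] by (auto simp: a_minus_def r_neg minus_minus)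

lemma (in abelian_group) minus_parity_pow:
  "x \<in> carrier G \<Longrightarrow> [(- 1 * parity_sign k)] \<cdot> x = \<ominus> ([parity_sign k] \<cdot> x)"
  by (simp add: parity_sign_def int_one_pow int_minus_one_pow)

lemma (in abelian_group) parity_pow_closed [simp, intro]:
  "x \<in> carrier G \<Longrightarrow> [parity_sign k] \<cdot> x \<in> carrier G"
  by (simp add: parity_pow)

lemma sign_two_swaps: "a \<noteq> b \<Longrightarrow> c \<noteq> e \<Longrightarrow> sign (transpose a b \<circ> transpose c e) = 1"
  by (simp add: sign_compose permutation_swap_id sign_swap_id)

lemma permute_list3: "permute_list f [a, b, c] = [[a, b, c] ! f 0, [a, b, c] ! f 1, [a, b, c] ! f 2]"
  by (simp add: permute_list_def numeral_2_eq_2)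

lemma inv_two_swaps: "inv_into UNIV (transpose a b \<circ> transpose c e) = transpose c e \<circ> transpose a b"
  by (simp add: o_inv_distrib)

lemma shuffle_sum_1_3:
  assumes "abelian_group B" "f [a, b, c] \<in> carrier B" "f [b, a, c] \<in> carrier B" "f [b, c, a] \<in> carrier B"
  shows "(\<Oplus>\<^bsub>B\<^esub>\<sigma>\<in>shuffle_perms 1 3. [(sign \<sigma> * parity_sign (koszul_exponent \<sigma> [i, j, k]))] \<cdot>\<^bsub>B\<^esub>
             f (permute_list (inv_into UNIV \<sigma>) [a, b, c]))
    = f [a, b, c] \<oplus>\<^bsub>B\<^esub> (\<ominus>\<^bsub>B\<^esub> ([parity_sign (i * j)] \<cdot>\<^bsub>B\<^esub> f [b, a, c])
        \<oplus>\<^bsub>B\<^esub> [parity_sign (i * j + i * k)] \<cdot>\<^bsub>B\<^esub> f [b, c, a])"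
proof -
  interpret abelian_group B by fact
  let ?s = "transpose 0 1 :: nat \<Rightarrow> nat" and ?t = "transpose 0 1 \<circ> transpose 0 2 :: nat \<Rightarrow> nat"
  have "?s 0 \<noteq> id 0" "?t 0 \<noteq> id 0" "?s 0 \<noteq> ?t 0"
    by (simp_all add: transpose_def)
  then have ne: "?s \<noteq> id" "?t \<noteq> id" "?s \<noteq> ?t"
    by metis+
  \<comment> \<open>Since \<sigma> moves the argument \<open>j\<close> to position \<sigma>
    \<open>j\<close>, the list is read through the inverse. The 3-cycle \<open>?t\<close> sends 0 to
    2, which puts \<open>a\<close> last.\<close>
  have p: "permute_list (inv_into UNIV id) [a, b, c] = [a, b, c]" "permute_list (inv_into UNIV ?s) [a, b, c] = [b, a, c]"
    "permute_list (inv_into UNIV ?t) [a, b, c] = [b, c, a]"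
    unfolding inv_two_swaps by (simp_all add: permute_list3 transpose_def)
  have k: "koszul_exponent id [i, j, k] = 0" "koszul_exponent ?s [i, j, k] = i * j"
    "koszul_exponent ?t [i, j, k] = i * j + i * k"
    by (simp_all add: koszul_exponent3 transpose_def)
  have sg: "sign ?s = -1" "sign ?t = 1" by (simp_all add: sign_two_swaps sign_swap_id)
  show ?thesis
    unfolding shuffle_perms_1_3 using assms ne
    by (subst finsum_three) (simp_all only: p k sg sign_id mult_1_left minus_parity_pow, simp_all
      add: parity_sign_def int_one_pow)
qed

lemma shuffle_sum_2_3:
  assumes "abelian_group B" "f [a, b, c] \<in> carrier B" "f [a, c, b] \<in> carrier B" "f [c, a, b] \<in> carrier B"
  shows "(\<Oplus>\<^bsub>B\<^esub>\<sigma>\<in>shuffle_perms 2 3. [(sign \<sigma> * parity_sign (koszul_exponent \<sigma> [i, j, k]))] \<cdot>\<^bsub>B\<^esub>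
             f (permute_list (inv_into UNIV \<sigma>) [a, b, c]))
    = f [a, b, c] \<oplus>\<^bsub>B\<^esub> (\<ominus>\<^bsub>B\<^esub> ([parity_sign (j * k)] \<cdot>\<^bsub>B\<^esub> f [a, c, b])
        \<oplus>\<^bsub>B\<^esub> [parity_sign (i * k + j * k)] \<cdot>\<^bsub>B\<^esub> f [c, a, b])"
proof -
  interpret abelian_group B by fact
  let ?s = "transpose 1 2 :: nat \<Rightarrow> nat" and ?t = "transpose 0 2 \<circ> transpose 0 1 :: nat \<Rightarrow> nat"
  have "?s 1 \<noteq> id 1" "?t 0 \<noteq> id 0" "?s 0 \<noteq> ?t 0"
    by (simp_all add: transpose_def)
  then have ne: "?s \<noteq> id" "?t \<noteq> id" "?s \<noteq> ?t"
    by metis+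
  have p: "permute_list (inv_into UNIV id) [a, b, c] = [a, b, c]" "permute_list (inv_into UNIV ?s) [a, b, c] = [a, c, b]"
    "permute_list (inv_into UNIV ?t) [a, b, c] = [c, a, b]"
    unfolding inv_two_swaps by (simp_all add: permute_list3 transpose_def)
  have k: "koszul_exponent id [i, j, k] = 0" "koszul_exponent ?s [i, j, k] = j * k"
    "koszul_exponent ?t [i, j, k] = i * k + j * k"
    by (simp_all add: koszul_exponent3 transpose_def)
  have sg: "sign ?s = -1" "sign ?t = 1" by (simp_all add: sign_two_swaps sign_swap_id)
  show ?thesis
    unfolding shuffle_perms_2_3 using assms ne
    by (subst finsum_three) (simp_all only: p k sg sign_id mult_1_left minus_parity_pow, simp_all
      add: parity_sign_def int_one_pow)
qed

context gca
begin

lemma CHarr2_iff: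
  "f \<in> CHarr K B 2 q \<longleftrightarrow> f \<in> CHoch K B 2 q \<and>
    (\<forall>a b i j. a \<in> grade B i \<longrightarrow> b \<in> grade B j \<longrightarrow> f [a, b] = [parity_sign (i * j)] \<cdot>\<^bsub>B\<^esub> f [b, a])"
proof (cases "f \<in> CHoch K B 2 q")
  case True
  then have cl: "f [a, b] \<in> carrier B" if "a \<in> carrier B" "b \<in> carrier B" for a b
    using that by (auto simp: CHoch_def)
  have "f \<in> CHarr K B 2 q \<longleftrightarrow>
    (\<forall>a b i j. a \<in> grade B i \<longrightarrow> b \<in> grade B j \<longrightarrow> f [a, b] \<ominus>\<^bsub>B\<^esub> [parity_sign (i * j)] \<cdot>\<^bsub>B\<^esub> f [b, a] = \<zero>\<^bsub>B\<^esub>)"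
    (is "_ \<longleftrightarrow> ?R")
  proof
    assume f: "f \<in> CHarr K B 2 q"
    show ?R
    proof (intro allI impI)
      fix a b i j assume ab: "a \<in> grade B i" "b \<in> grade B j"
      then have "homogeneous_of B [a, b] [i, j]" "[a, b] \<in> tuples B 2"
        by (simp_all add: homogeneous_of_def grade_carrier)
      then have "(\<Oplus>\<^bsub>B\<^esub>\<sigma>\<in>shuffle_perms 1 2. [(sign \<sigma> * parity_sign (koszul_exponent \<sigma> [i, j]))] \<cdot>\<^bsub>B\<^esub>
             f (permute_list (inv_into UNIV \<sigma>) [a, b])) = \<zero>\<^bsub>B\<^esub>"
        using f unfolding CHarr_def by simp
      then show "f [a, b] \<ominus>\<^bsub>B\<^esub> [parity_sign (i * j)] \<cdot>\<^bsub>B\<^esub> f [b, a] = \<zero>\<^bsub>B\<^esub>"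
        using ab by (subst (asm) shuffle_sum2[OF abgrp]) (auto intro: cl grade_carrier)
    qed
  next
    assume r: ?R
    show "f \<in> CHarr K B 2 q"
      unfolding CHarr_def
    proof (intro CollectI conjI allI impI ballI True)
      fix p xs ks
      assume "0 < p \<and> p < (2::nat)" "xs \<in> tuples B 2" and hom: "homogeneous_of B xs ks"
      then obtain a b where ab: "a \<in> carrier B" "b \<in> carrier B" "xs = [a, b]" and p: "p = 1"
        by (auto simp: tuples2_iff)
      obtain i j where ij: "ks = [i, j]" "a \<in> grade B i" "b \<in> grade B j"
        using hom ab by (auto simp: homogeneous_of_Cons homogeneous_of_Nil)
      show "(\<Oplus>\<^bsub>B\<^esub>\<sigma>\<in>shuffle_perms p 2. [(sign \<sigma> * parity_sign (koszul_exponent \<sigma> ks))] \<cdot>\<^bsub>B\<^esub>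
             f (permute_list (inv_into UNIV \<sigma>) xs)) = \<zero>\<^bsub>B\<^esub>"
        unfolding p ij ab(3) using ab r ij by (subst shuffle_sum2[OF abgrp]) (auto intro: cl)
    qed
  qed
  also have "\<dots> \<longleftrightarrow> (\<forall>a b i j. a \<in> grade B i \<longrightarrow> b \<in> grade B j \<longrightarrow> f [a, b] = [parity_sign (i * j)] \<cdot>\<^bsub>B\<^esub> f [b, a])"
    by (intro all_cong1 imp_cong refl M.minus_eq_zero_iff) (auto intro: cl grade_carrier)
  finally show ?thesis using True by blast
qed (auto simp: CHarr_def)

lemma CHarr3I:
  assumes f: "f \<in> CHoch K B 3 q"
    and 1: "\<And>a b c i j k. \<lbrakk>a \<in> grade B i; b \<in> grade B j; c \<in> grade B k\<rbrakk> \<Longrightarrow>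
      f [a, b, c] \<oplus>\<^bsub>B\<^esub> (\<ominus>\<^bsub>B\<^esub> ([parity_sign (i * j)] \<cdot>\<^bsub>B\<^esub> f [b, a, c])
        \<oplus>\<^bsub>B\<^esub> [parity_sign (i * j + i * k)] \<cdot>\<^bsub>B\<^esub> f [b, c, a]) = \<zero>\<^bsub>B\<^esub>"
    and 2: "\<And>a b c i j k. \<lbrakk>a \<in> grade B i; b \<in> grade B j; c \<in> grade B k\<rbrakk> \<Longrightarrow>
      f [a, b, c] \<oplus>\<^bsub>B\<^esub> (\<ominus>\<^bsub>B\<^esub> ([parity_sign (j * k)] \<cdot>\<^bsub>B\<^esub> f [a, c, b])
        \<oplus>\<^bsub>B\<^esub> [parity_sign (i * k + j * k)] \<cdot>\<^bsub>B\<^esub> f [c, a, b]) = \<zero>\<^bsub>B\<^esub>"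
  shows "f \<in> CHarr K B 3 q"
  unfolding CHarr_def
proof (intro CollectI conjI allI impI ballI f)
  fix p xs ks
  assume "0 < p \<and> p < (3::nat)" "xs \<in> tuples B 3" and hom: "homogeneous_of B xs ks"
  then obtain a b c where abc: "a \<in> carrier B" "b \<in> carrier B" "c \<in> carrier B" "xs = [a, b, c]"
    by (auto simp: tuples3_iff)
  obtain i j k where ijk: "ks = [i, j, k]" "a \<in> grade B i" "b \<in> grade B j" "c \<in> grade B k"
    using hom abc by (auto simp: homogeneous_of_Cons homogeneous_of_Nil)
  have cl: "f [a, b, c] \<in> carrier B" if "a \<in> carrier B" "b \<in> carrier B" "c \<in> carrier B" for a b c
    using f that by (auto simp: CHoch_def)
  have "p = 1 \<or> p = 2" using \<open>0 < p \<and> p < 3\<close> by linarith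
  then show "(\<Oplus>\<^bsub>B\<^esub>\<sigma>\<in>shuffle_perms p 3. [(sign \<sigma> * parity_sign (koszul_exponent \<sigma> ks))] \<cdot>\<^bsub>B\<^esub>
             f (permute_list (inv_into UNIV \<sigma>) xs)) = \<zero>\<^bsub>B\<^esub>"
    using shuffle_sum_1_3[OF abgrp, of f a b c i j k] shuffle_sum_2_3[OF abgrp, of f a b c i j k]
      1[OF ijk(2-4)] 2[OF ijk(2-4)] abc ijk cl
    by auto
qed

end

section \<open>Transfer models and their ternary cocycle\<close>

text \<open>The class of a cocycle, read in \<open>H\<close> through the bijection that
  \<open>\<iota>\<close> induces on cohomology. Working with elements and primitives avoids
  cosets.\<close>

definition rep_coord :: "('k, 'h, 'x) graded_algebra_scheme \<Rightarrow> ('k, 'a, 'y) dg_algebra_scheme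
    \<Rightarrow> ('h \<Rightarrow> 'a) \<Rightarrow> 'a \<Rightarrow> 'h"
  where "rep_coord H A \<iota> x =
    (THE e. e \<in> carrier H \<and> (\<exists>u\<in>carrier A. x = \<iota> e \<oplus>\<^bsub>A\<^esub> differential A u))"

text \<open>If the products \<open>a b\<close> and \<open>b c\<close> vanish in \<open>H\<close>,
  the last two terms disappear in a model and the rest is the usual representative, up to sign, of
  the triple Massey product.\<close>

definition assoc_defect :: "('k, 'h, 'x) graded_algebra_scheme \<Rightarrow> ('k, 'a, 'y) dg_algebra_scheme
    \<Rightarrow> ('h \<Rightarrow> 'a) \<Rightarrow> ('h \<Rightarrow> 'h \<Rightarrow> 'a) \<Rightarrow> 'h \<Rightarrow> 'h \<Rightarrow> 'h \<Rightarrow> 'a"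
  where "assoc_defect H A \<iota> m a b c =
    m a b \<otimes>\<^bsub>A\<^esub> \<iota> c \<ominus>\<^bsub>A\<^esub> sign_twist A 1 (\<iota> a) \<otimes>\<^bsub>A\<^esub> m b c
      \<oplus>\<^bsub>A\<^esub> m (a \<otimes>\<^bsub>H\<^esub> b) c \<ominus>\<^bsub>A\<^esub> m a (b \<otimes>\<^bsub>H\<^esub> c)"

definition transfer3 :: "('k, 'h, 'x) graded_algebra_scheme \<Rightarrow> ('k, 'a, 'y) dg_algebra_scheme
    \<Rightarrow> ('h \<Rightarrow> 'a) \<Rightarrow> ('h \<Rightarrow> 'h \<Rightarrow> 'a) \<Rightarrow> 'h list \<Rightarrow> 'h"
  where "transfer3 H A \<iota> m =
    (\<lambda>xs\<in>tuples H 3. rep_coord H A \<iota> (assoc_defect H A \<iota> m (xs ! 0) (xs ! 1) (xs ! 2)))"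

text \<open>Assumption \<open>rep_ex1\<close> says that \<open>\<iota>\<close> induces a bijection from \<open>H\<close> onto the cohomology of \<open>A\<close>.
  The data \<open>\<iota>\<close>, \<open>m\<close> are the first two components of a $C_\infty$-quasi-isomorphism from \<open>H\<close> to \<open>A\<close>.\<close>

locale transfer_model = H: gca K H + dgca K A
  for K and H :: "('k, 'h, 'x) graded_algebra_scheme"
    and A :: "('k, 'a, 'y) dg_algebra_scheme" (structure) +
  fixes \<iota> :: "'h \<Rightarrow> 'a" and m :: "'h \<Rightarrow> 'h \<Rightarrow> 'a"
  assumes iota_linear: "linear_map K H A \<iota>"
    and iota_grade: "x \<in> grade H k \<Longrightarrow> \<iota> x \<in> grade A k"
    and d_iota: "x \<in> carrier H \<Longrightarrow> d (\<iota> x) = \<zero>"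
    and rep_ex1: "y \<in> cocycles A \<Longrightarrow>
      \<exists>!e. e \<in> carrier H \<and> (\<exists>u\<in>carrier A. y = \<iota> e \<oplus> d u)"
    and m_linear_left: "b \<in> carrier H \<Longrightarrow> linear_map K H A (\<lambda>a. m a b)"
    and m_linear_right: "a \<in> carrier H \<Longrightarrow> linear_map K H A (m a)"
    and m_grade: "\<lbrakk>a \<in> grade H i; b \<in> grade H j\<rbrakk> \<Longrightarrow> m a b \<in> grade A (i + j - 1)"
    and m_sym: "\<lbrakk>a \<in> grade H i; b \<in> grade H j\<rbrakk> \<Longrightarrow> m b a = [parity_sign (i * j)] \<cdot> m a b"
    and d_m: "\<lbrakk>a \<in> carrier H; b \<in> carrier H\<rbrakk> \<Longrightarrow>
      d (m a b) = \<iota> a \<otimes> \<iota> b \<ominus> \<iota> (a \<otimes>\<^bsub>H\<^esub> b)"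
begin

abbreviation \<rho> :: "'a \<Rightarrow> 'h" where "\<rho> \<equiv> rep_coord H A \<iota>"
abbreviation z :: "'h \<Rightarrow> 'h \<Rightarrow> 'h \<Rightarrow> 'a" where "z \<equiv> assoc_defect H A \<iota> m"

lemmas iota_closed [simp, intro] = linear_map_closed[OF iota_linear]
lemmas iota_add = linear_map_add[OF iota_linear]
lemmas iota_smult = linear_map_smult[OF iota_linear]
lemmas iota_neg = linear_map_neg[OF iota_linear H.abgrp abgrp]

lemma m_in_carrier [simp, intro]: "\<lbrakk>a \<in> carrier H; b \<in> carrier H\<rbrakk> \<Longrightarrow> m a b \<in> carrier A"
  using linear_map_closed[OF m_linear_right] by blast

lemma m_add_left: "\<lbrakk>a \<in> carrier H; a' \<in> carrier H; b \<in> carrier H\<rbrakk> \<Longrightarrow> m (a \<oplus>\<^bsub>H\<^esub> a') b = m a b \<oplus> m a' b"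
  using linear_map_add[OF m_linear_left] by blast

lemma m_add_right: "\<lbrakk>a \<in> carrier H; b \<in> carrier H; b' \<in> carrier H\<rbrakk> \<Longrightarrow> m a (b \<oplus>\<^bsub>H\<^esub> b') = m a b \<oplus> m a b'"
  using linear_map_add[OF m_linear_right] by blast

lemma m_smult_left: "\<lbrakk>c \<in> carrier K; a \<in> carrier H; b \<in> carrier H\<rbrakk> \<Longrightarrow> m (c \<odot>\<^bsub>H\<^esub> a) b = c \<odot> m a b"
  using linear_map_smult[OF m_linear_left] by blast

lemma m_smult_right: "\<lbrakk>c \<in> carrier K; a \<in> carrier H; b \<in> carrier H\<rbrakk> \<Longrightarrow> m a (c \<odot>\<^bsub>H\<^esub> b) = c \<odot> m a b"
  using linear_map_smult[OF m_linear_right] by blast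

lemma m_neg_left: "\<lbrakk>a \<in> carrier H; b \<in> carrier H\<rbrakk> \<Longrightarrow> m (\<ominus>\<^bsub>H\<^esub> a) b = \<ominus> m a b"
  using linear_map_neg[OF m_linear_left H.abgrp abgrp] by blast

lemma m_neg_right: "\<lbrakk>a \<in> carrier H; b \<in> carrier H\<rbrakk> \<Longrightarrow> m a (\<ominus>\<^bsub>H\<^esub> b) = \<ominus> m a b"
  using linear_map_neg[OF m_linear_right H.abgrp abgrp] by blast

lemma iota_cocycle: "a \<in> carrier H \<Longrightarrow> \<iota> a \<in> cocycles A"
  by (simp add: cocycles_def d_iota)

lemma iota_twist: "a \<in> carrier H \<Longrightarrow> \<tau> (\<iota> a) = \<iota> (H.\<tau> a)"
  using gca_degree_map_twist[OF H.gca_axioms gca_axioms iota_linear, of 0] iota_grade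
  by (simp add: M.parity_pow)

lemma rho_rep: "x \<in> cocycles A \<Longrightarrow> \<rho> x \<in> carrier H \<and> (\<exists>u\<in>carrier A. x = \<iota> (\<rho> x) \<oplus> d u)"
  unfolding rep_coord_def by (rule theI') (rule rep_ex1)

lemma rho_closed [simp, intro]: "x \<in> cocycles A \<Longrightarrow> \<rho> x \<in> carrier H"
  using rho_rep by blast

text \<open>The rules for \<open>\<rho>\<close> below come from this: exhibit a candidate coordinate
  and a primitive of the difference.\<close>

lemma rho_eqI:
  assumes "e \<in> carrier H" "u \<in> carrier A" "x = \<iota> e \<oplus> d u"
  shows "\<rho> x = e"
proof -
  have "x \<in> cocycles A"
    using assms by (simp add: cocycle_add iota_cocycle coboundary_cocycle)
  then show ?thesis
    unfolding rep_coord_def using assms by (intro the1_equality rep_ex1) auto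
qed

lemma rho_iota: "a \<in> carrier H \<Longrightarrow> \<rho> (\<iota> a) = a"
  by (rule rho_eqI[of _ "\<zero>"]) (simp_all add: d_zero)

lemma rho_d: "u \<in> carrier A \<Longrightarrow> \<rho> (d u) = \<zero>\<^bsub>H\<^esub>"
  by (rule rho_eqI[of _ u]) (simp_all add: linear_map_zero[OF iota_linear H.abgrp abgrp])

lemma rho_add:
  assumes "x \<in> cocycles A" "y \<in> cocycles A"
  shows "\<rho> (x \<oplus> y) = \<rho> x \<oplus>\<^bsub>H\<^esub> \<rho> y"
proof -
  obtain u v where u: "u \<in> carrier A" "x = \<iota> (\<rho> x) \<oplus> d u" and v: "v \<in> carrier A" "y = \<iota> (\<rho> y) \<oplus> d v"
    using assms rho_rep by meson
  have c: "\<rho> x \<in> carrier H" "\<rho> y \<in> carrier H" using assms by auto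
  have "x \<oplus> y = (\<iota> (\<rho> x) \<oplus> d u) \<oplus> (\<iota> (\<rho> y) \<oplus> d v)" using u v by simp
  also have "\<dots> = \<iota> (\<rho> x \<oplus>\<^bsub>H\<^esub> \<rho> y) \<oplus> d (u \<oplus> v)"
    using c u(1) v(1) by (simp add: iota_add d_add M.a_ac)
  finally show ?thesis using c u v by (intro rho_eqI[of _ "u \<oplus> v"]) auto
qed

lemma rho_smult:
  assumes "c \<in> carrier K" "x \<in> cocycles A"
  shows "\<rho> (c \<odot> x) = c \<odot>\<^bsub>H\<^esub> \<rho> x"
proof -
  obtain u where u: "u \<in> carrier A" "x = \<iota> (\<rho> x) \<oplus> d u"
    using assms rho_rep by meson
  have cl: "\<rho> x \<in> carrier H" using assms by auto
  have "c \<odot> x = c \<odot> (\<iota> (\<rho> x) \<oplus> d u)" using u by simp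
  also have "\<dots> = \<iota> (c \<odot>\<^bsub>H\<^esub> \<rho> x) \<oplus> d (c \<odot> u)"
    using cl u(1) assms by (simp add: iota_smult d_smult smult_r_distr)
  finally show ?thesis using cl u assms by (intro rho_eqI[of _ "c \<odot> u"]) auto
qed

lemma rho_neg: "x \<in> cocycles A \<Longrightarrow> \<rho> (\<ominus> x) = \<ominus>\<^bsub>H\<^esub> \<rho> x"
  using rho_add[of "\<ominus> x" x] rho_d[of "\<zero>"]
  by (intro H.minus_equality[symmetric]) (simp_all add: cocycle_neg M.l_neg cocycle_closed d_zero)

lemma rho_diff: "\<lbrakk>x \<in> cocycles A; y \<in> cocycles A\<rbrakk> \<Longrightarrow> \<rho> (x \<ominus> y) = \<rho> x \<ominus>\<^bsub>H\<^esub> \<rho> y"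
  by (simp add: a_minus_def rho_add rho_neg cocycle_neg)

lemma rho_parity: "x \<in> cocycles A \<Longrightarrow> \<rho> ([parity_sign k] \<cdot> x) = [parity_sign k] \<cdot>\<^bsub>H\<^esub> \<rho> x"
  by (simp add: M.parity_pow H.M.parity_pow rho_neg cocycle_closed)

text \<open>By \<open>d_m\<close>, the map \<open>\<iota>\<close> is multiplicative up to
  coboundaries, so the identification with \<open>H\<close> respects products.\<close>

lemma rho_mult:
  assumes "x \<in> cocycles A" "y \<in> cocycles A"
  shows "\<rho> (x \<otimes> y) = \<rho> x \<otimes>\<^bsub>H\<^esub> \<rho> y"
proof -
  obtain u v where u: "u \<in> carrier A" "x = \<iota> (\<rho> x) \<oplus> d u" and v: "v \<in> carrier A" "y = \<iota> (\<rho> y) \<oplus> d v"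
    using assms rho_rep by meson
  have c: "\<rho> x \<in> carrier H" "\<rho> y \<in> carrier H" using assms by auto
  \<comment> \<open>The three summands are primitives of the three errors: the product defect of
    \<open>\<iota>\<close>, the term \<open>\<iota> (\<rho> x)\<close> times \<open>d v\<close>, and
    \<open>d u\<close> times \<open>y\<close>. The last two use that
    \<open>\<iota> (\<rho> x)\<close> and \<open>y\<close> are closed.\<close>
  let ?w = "m (\<rho> x) (\<rho> y) \<oplus> (\<tau> (\<iota> (\<rho> x)) \<otimes> v \<oplus> u \<otimes> y)"
  have y: "y \<in> carrier A" "d y = \<zero>" using assms cocycle_closed cocycle_d by auto
  have dw: "d ?w = (\<iota> (\<rho> x) \<otimes> \<iota> (\<rho> y) \<ominus> \<iota> (\<rho> x \<otimes>\<^bsub>H\<^esub> \<rho> y)) \<oplus> (\<iota> (\<rho> x) \<otimes> d v \<oplus> d u \<otimes> y)"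
    using c u(1) v(1) y by (simp add: d_add d_m leibniz_twist d_twist d_iota twist_zero twist_twist)
  have "x \<otimes> y = \<iota> (\<rho> x) \<otimes> y \<oplus> d u \<otimes> y"
    by (subst u(2)) (use c u(1) y in \<open>simp add: l_distr\<close>)
  also have "\<iota> (\<rho> x) \<otimes> y = \<iota> (\<rho> x) \<otimes> (\<iota> (\<rho> y) \<oplus> d v)"
    using v(2) by (rule arg_cong)
  also have "\<dots> \<oplus> d u \<otimes> y = \<iota> (\<rho> x \<otimes>\<^bsub>H\<^esub> \<rho> y) \<oplus> d ?w"
    unfolding dw
    using iota_closed[OF c(1)] iota_closed[OF c(2)] iota_closed[OF H.m_closed[OF c]]
      d_closed[OF u(1)] d_closed[OF v(1)] y(1) by algebra
  finally have "x \<otimes> y = \<iota> (\<rho> x \<otimes>\<^bsub>H\<^esub> \<rho> y) \<oplus> d ?w" .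
  then show ?thesis
    by (rule rho_eqI[rotated 2]) (use c u(1) v(1) y in simp_all)
qed

text \<open>Taking the component of degree \<open>k\<close> in
  \<open>x = \<iota> (\<rho> x) + d u\<close> gives another such presentation of \<open>x\<close>,
  and the coordinate is unique.\<close>

lemma rho_grade:
  assumes x: "x \<in> cocycles A" "x \<in> grade A k"
  shows "\<rho> x \<in> grade H k"
proof -
  obtain u where u: "u \<in> carrier A" "x = \<iota> (\<rho> x) \<oplus> d u"
    using x rho_rep by meson
  have c: "\<rho> x \<in> carrier H" using x by auto
  have "x = component A x k" using x(2) by (simp add: component_homogeneous)
  also have "\<dots> = component A (\<iota> (\<rho> x)) k \<oplus> component A (d u) k"
    by (subst u(2)) (use c u(1) in \<open>simp add: component_add\<close>)
  also have "\<dots> = \<iota> (component H (\<rho> x) k) \<oplus> d (component A u (k - 1))"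
    using d_component[OF u(1), of "k - 1"] c iota_grade
      gca_degree_map_component[OF H.gca_axioms gca_axioms iota_linear, of 0 "\<rho> x" k] by simp
  finally have "\<rho> x = component H (\<rho> x) k"
    using c u(1) by (intro rho_eqI[of _ "component A u (k - 1)"]) auto
  then show ?thesis using H.component_grade[OF c] by metis
qed

lemma z_closed [simp, intro]:
  "\<lbrakk>a \<in> carrier H; b \<in> carrier H; c \<in> carrier H\<rbrakk> \<Longrightarrow> z a b c \<in> carrier A"
  by (simp add: assoc_defect_def)

text \<open>The differential turns each \<open>m\<close> into a product defect. The two terms with
  products leave \<open>\<iota> a \<iota> (b c) - \<iota> (a b) \<iota> c\<close>, which the two
  corrections cancel; the remaining copies of \<open>\<iota> (a b c)\<close> agree by
  associativity.\<close>

lemma z_cocycle: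
  assumes "a \<in> carrier H" "b \<in> carrier H" "c \<in> carrier H"
  shows "z a b c \<in> cocycles A"
proof (rule cocycleI)
  have "d (z a b c) = (\<iota> a \<otimes> \<iota> b \<ominus> \<iota> (a \<otimes>\<^bsub>H\<^esub> b)) \<otimes> \<iota> c
      \<ominus> \<iota> a \<otimes> (\<iota> b \<otimes> \<iota> c \<ominus> \<iota> (b \<otimes>\<^bsub>H\<^esub> c))
      \<oplus> (\<iota> (a \<otimes>\<^bsub>H\<^esub> b) \<otimes> \<iota> c \<ominus> \<iota> (a \<otimes>\<^bsub>H\<^esub> (b \<otimes>\<^bsub>H\<^esub> c)))
      \<ominus> (\<iota> a \<otimes> \<iota> (b \<otimes>\<^bsub>H\<^esub> c) \<ominus> \<iota> (a \<otimes>\<^bsub>H\<^esub> (b \<otimes>\<^bsub>H\<^esub> c)))"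
    using assms
    by (simp add: assoc_defect_def d_add d_diff d_m leibniz_twist d_twist d_iota twist_zero twist_twist H.m_assoc)
  also have "\<dots> = \<zero>"
    using iota_closed[OF assms(1)] iota_closed[OF assms(2)] iota_closed[OF assms(3)]
      iota_closed[OF H.m_closed[OF assms(1,2)]] iota_closed[OF H.m_closed[OF assms(2,3)]]
      iota_closed[OF H.m_closed[OF assms(1) H.m_closed[OF assms(2,3)]]]
    by algebra
  finally show "d (z a b c) = \<zero>" .
qed (use assms in auto)

lemma z_linear:
  assumes "a \<in> carrier H" "b \<in> carrier H"
  shows "linear_map K H A (\<lambda>x. z x a b)" "linear_map K H A (\<lambda>x. z a x b)" "linear_map K H A (z a b)"
proof -
  note s = assoc_defect_def iota_add iota_smult twist_add twist_smult m_add_left m_add_right m_smult_left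
    m_smult_right l_distr r_distr smult_mult_left smult_mult_right H.l_distr H.r_distr H.smult_mult_left
    H.smult_mult_right smult_r_distr smult_diff
  have ad: "(p \<oplus> p') \<ominus> (q \<oplus> q') \<oplus> (r \<oplus> r') \<ominus> (t \<oplus> t')
      = (p \<ominus> q \<oplus> r \<ominus> t) \<oplus> (p' \<ominus> q' \<oplus> r' \<ominus> t')"
    if "p \<in> carrier A" "q \<in> carrier A" "r \<in> carrier A" "t \<in> carrier A"
      "p' \<in> carrier A" "q' \<in> carrier A" "r' \<in> carrier A" "t' \<in> carrier A" for p q r t p' q' r' t'
    using that by algebra
  show "linear_map K H A (\<lambda>x. z x a b)" "linear_map K H A (\<lambda>x. z a x b)" "linear_map K H A (z a b)"
    by (rule linear_mapI; use assms in \<open>simp add: s ad\<close>)+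
qed

lemma z_grade:
  assumes "a \<in> grade H i" "b \<in> grade H j" "c \<in> grade H k"
  shows "z a b c \<in> grade A (i + j + k - 1)"
proof -
  have "m a b \<otimes> \<iota> c \<in> grade A (i + j + k - 1)"
    using mult_grade[OF m_grade[OF assms(1,2)] iota_grade[OF assms(3)]] by (simp add: algebra_simps)
  moreover have "\<tau> (\<iota> a) \<otimes> m b c \<in> grade A (i + j + k - 1)"
    using mult_grade[OF twist_grade[OF iota_grade[OF assms(1)]] m_grade[OF assms(2,3)]]
    by (simp add: algebra_simps)
  moreover have "m (a \<otimes>\<^bsub>H\<^esub> b) c \<in> grade A (i + j + k - 1)"
    using m_grade[OF H.mult_grade[OF assms(1,2)] assms(3)] .
  moreover have "m a (b \<otimes>\<^bsub>H\<^esub> c) \<in> grade A (i + j + k - 1)"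
    using m_grade[OF assms(1) H.mult_grade[OF assms(2,3)]] by (simp add: algebra_simps)
  ultimately show ?thesis
    unfolding assoc_defect_def by (intro grade_diff grade_add)
qed

lemma transfer3_eq:
  "\<lbrakk>a \<in> carrier H; b \<in> carrier H; c \<in> carrier H\<rbrakk> \<Longrightarrow> transfer3 H A \<iota> m [a, b, c] = \<rho> (z a b c)"
  by (simp add: transfer3_def)

lemma transfer3_CHoch: "transfer3 H A \<iota> m \<in> CHoch K H 3 (- 1)"
  unfolding transfer3_def
proof (rule H.CHoch3I)
  fix a b assume ab: "a \<in> carrier H" "b \<in> carrier H"
  note l = linear_map_add[OF z_linear(1)[OF ab]] linear_map_add[OF z_linear(2)[OF ab]]
    linear_map_add[OF z_linear(3)[OF ab]] linear_map_smult[OF z_linear(1)[OF ab]]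
    linear_map_smult[OF z_linear(2)[OF ab]] linear_map_smult[OF z_linear(3)[OF ab]]
  show "linear_map K H H (\<lambda>x. \<rho> (z x a b))" "linear_map K H H (\<lambda>x. \<rho> (z a x b))"
    "linear_map K H H (\<lambda>x. \<rho> (z a b x))"
    by (rule linear_mapI; use ab in \<open>simp add: l rho_add rho_smult z_cocycle\<close>)+
next
  fix a b c i j k assume "a \<in> grade H i" "b \<in> grade H j" "c \<in> grade H k"
  then show "\<rho> (z a b c) \<in> grade H (i + j + k + - 1)"
    using rho_grade[OF z_cocycle z_grade] H.grade_carrier by simp
qed

end

section \<open>The shuffle and Hochschild relations for the ternary cochain\<close>

context transfer_model
begin

text \<open>The shuffle relations hold already in \<open>A\<close>, before passing to classes: they
  follow from the graded symmetry of \<open>m\<close> and the graded commutativity of both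
  products.\<close>

lemma z_shuffle:
  assumes a: "a \<in> grade H i" and b: "b \<in> grade H j" and c: "c \<in> grade H k"
  shows "z a b c \<oplus> (\<ominus> ([parity_sign (i * j)] \<cdot> z b a c)
        \<oplus> [parity_sign (i * j + i * k)] \<cdot> z b c a) = \<zero>"
    and "z a b c \<oplus> (\<ominus> ([parity_sign (j * k)] \<cdot> z a c b)
        \<oplus> [parity_sign (i * k + j * k)] \<cdot> z c a b) = \<zero>"
proof -
  have cl: "a \<in> carrier H" "b \<in> carrier H" "c \<in> carrier H"
    using a b c H.grade_carrier by auto
  note m_swap = m_sym[OF a b] m_sym[OF a c] m_sym[OF b c]
    m_sym[OF a H.mult_grade[OF b c]] m_sym[OF H.mult_grade[OF a b] c]
  note h_swap = H.graded_commutative[OF b a] H.graded_commutative[OF c a] H.graded_commutative[OF c b]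
  note a_swap = graded_commutative[OF m_grade[OF b c] iota_grade[OF a]]
    graded_commutative[OF iota_grade[OF c] m_grade[OF a b]]
  note tw = twist_homogeneous[OF iota_grade[OF a]] twist_homogeneous[OF iota_grade[OF b]]
    twist_homogeneous[OF iota_grade[OF c]]
  note sg = M.parity_pow H.M.parity_pow m_neg_left m_neg_right l_minus r_minus M.minus_minus
  \<comment> \<open>Every term of the permuted defects is, up to sign, one of these eight. The lists
    of swaps above bring the factors into this order.\<close>
  let ?X = "m a b \<otimes> \<iota> c" and ?Y = "\<iota> a \<otimes> m b c" and ?W = "\<iota> b \<otimes> m a c"
    and ?V = "m a c \<otimes> \<iota> b"
    and ?P = "m (a \<otimes>\<^bsub>H\<^esub> b) c" and ?Q = "m a (b \<otimes>\<^bsub>H\<^esub> c)" and ?R = "m b (a \<otimes>\<^bsub>H\<^esub> c)"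
    and ?S = "m (a \<otimes>\<^bsub>H\<^esub> c) b"
  have z: "?X \<in> carrier A" "?Y \<in> carrier A" "?W \<in> carrier A" "?V \<in> carrier A"
    "?P \<in> carrier A" "?Q \<in> carrier A" "?R \<in> carrier A" "?S \<in> carrier A"
    using cl by simp_all
  have abc: "z a b c = ?X \<ominus> [parity_sign i] \<cdot> ?Y \<oplus> ?P \<ominus> ?Q"
    using cl by (simp add: assoc_defect_def tw sg)
  have bac: "z b a c = [parity_sign (i * j)] \<cdot> ?X \<ominus> [parity_sign j] \<cdot> ?W
      \<oplus> [parity_sign (i * j)] \<cdot> ?P \<ominus> ?R"
    using cl by (simp add: assoc_defect_def tw m_swap h_swap sg)
  have bca: "z b c a = [parity_sign ((j + k - 1) * i)] \<cdot> ?Y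
      \<ominus> [parity_sign (j + i * k)] \<cdot> ?W
      \<oplus> [parity_sign (i * (j + k))] \<cdot> ?Q \<ominus> [parity_sign (i * k)] \<cdot> ?R"
    using cl by (simp add: assoc_defect_def tw m_swap h_swap a_swap sg)
  have acb: "z a c b = ?V \<ominus> [parity_sign (i + j * k)] \<cdot> ?Y \<oplus> ?S
      \<ominus> [parity_sign (j * k)] \<cdot> ?Q"
    using cl by (simp add: assoc_defect_def tw m_swap h_swap sg)
  have cab: "z c a b = [parity_sign (i * k)] \<cdot> ?V
      \<ominus> [parity_sign (k + k * (i + j - 1))] \<cdot> ?X
      \<oplus> [parity_sign (i * k)] \<cdot> ?S \<ominus> [parity_sign ((i + j) * k)] \<cdot> ?P"
    using cl by (simp add: assoc_defect_def tw m_swap h_swap a_swap sg)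
  \<comment> \<open>Once the terms are opaque, each of the eight parity patterns of
    \<open>i\<close>, \<open>j\<close>, \<open>k\<close> is a linear identity.\<close>
  define X Y W V P Q R S where "X = ?X" and "Y = ?Y" and "W = ?W" and "V = ?V"
    and "P = ?P" and "Q = ?Q" and "R = ?R" and "S = ?S"
  note defs = X_def Y_def W_def V_def P_def Q_def R_def S_def
  note z' = z[folded defs]
  have e: "even (i - 1) = odd i" for i :: int by simp
  show "z a b c \<oplus> (\<ominus> ([parity_sign (i * j)] \<cdot> z b a c)
        \<oplus> [parity_sign (i * j + i * k)] \<cdot> z b c a) = \<zero>"
    unfolding abc bac bca defs[symmetric]
    apply (cases "even i"; cases "even j"; cases "even k"; simp add: M.parity_pow z')
    using z' by algebra+
  show "z a b c \<oplus> (\<ominus> ([parity_sign (j * k)] \<cdot> z a c b)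
        \<oplus> [parity_sign (i * k + j * k)] \<cdot> z c a b) = \<zero>"
    unfolding abc acb cab defs[symmetric]
    apply (cases "even i"; cases "even j"; cases "even k"; simp add: M.parity_pow z')
    using z' by algebra+
qed

lemma transfer3_CHarr: "transfer3 H A \<iota> m \<in> CHarr K H 3 (- 1)"
proof (rule H.CHarr3I[OF transfer3_CHoch])
  fix a b c i j k assume g: "a \<in> grade H i" "b \<in> grade H j" "c \<in> grade H k"
  then have cl: "a \<in> carrier H" "b \<in> carrier H" "c \<in> carrier H" using H.grade_carrier by auto
  have pz: "[parity_sign k] \<cdot> x \<in> cocycles A" if "x \<in> cocycles A" for k x
    using that by (simp add: M.parity_pow cocycle_closed cocycle_neg)
  note r = transfer3_eq rho_add[symmetric] rho_neg[symmetric] rho_parity[symmetric] z_cocycle pz cocycle_add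
    cocycle_neg rho_d[of "\<zero>", simplified d_zero]
  show "transfer3 H A \<iota> m [a, b, c] \<oplus>\<^bsub>H\<^esub> (\<ominus>\<^bsub>H\<^esub> ([parity_sign (i * j)] \<cdot>\<^bsub>H\<^esub> transfer3 H A \<iota> m [b, a, c])
        \<oplus>\<^bsub>H\<^esub> [parity_sign (i * j + i * k)] \<cdot>\<^bsub>H\<^esub> transfer3 H A \<iota> m [b, c, a]) = \<zero>\<^bsub>H\<^esub>"
    using cl z_shuffle(1)[OF g] by (simp add: r)
  show "transfer3 H A \<iota> m [a, b, c] \<oplus>\<^bsub>H\<^esub> (\<ominus>\<^bsub>H\<^esub> ([parity_sign (j * k)] \<cdot>\<^bsub>H\<^esub> transfer3 H A \<iota> m [a, c, b])
        \<oplus>\<^bsub>H\<^esub> [parity_sign (i * k + j * k)] \<cdot>\<^bsub>H\<^esub> transfer3 H A \<iota> m [c, a, b]) = \<zero>\<^bsub>H\<^esub>"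
    using cl z_shuffle(2)[OF g] by (simp add: r)
qed

text \<open>All terms with a single \<open>m\<close> of three or four arguments' products cancel,
  and so do the products with \<open>m b c\<close>. What is left is \<open>m a b\<close> times the
  product defect of \<open>c, e\<close>, minus the twisted product defect of \<open>a, b\<close>
  times \<open>m c e\<close>; this is the Leibniz rule for the product on the right.\<close>

lemma z_hochschild:
  assumes "a \<in> carrier H" "b \<in> carrier H" "c \<in> carrier H" "e \<in> carrier H"
  shows "\<tau> (\<iota> a) \<otimes> z b c e
      \<oplus> (\<ominus> z (a \<otimes>\<^bsub>H\<^esub> b) c e \<oplus> (z a (b \<otimes>\<^bsub>H\<^esub> c) e \<ominus> z a b (c \<otimes>\<^bsub>H\<^esub> e)))
      \<oplus> z a b c \<otimes> \<iota> e = d (\<tau> (m a b) \<otimes> m c e)"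
proof -
  define ia ib ic ie iab ice where "ia = \<tau> (\<iota> a)" and "ib = \<tau> (\<iota> b)" and "ic = \<iota> c" and "ie = \<iota> e"
    and "iab = \<tau> (\<iota> (a \<otimes>\<^bsub>H\<^esub> b))" and "ice = \<iota> (c \<otimes>\<^bsub>H\<^esub> e)"
  note id = this
  define p q r where "p = m a b" and "q = m b c" and "r = m c e"
  note md = this
  define s1 s2 s3 s4 where "s1 = m (b \<otimes>\<^bsub>H\<^esub> c) e" and "s2 = m b (c \<otimes>\<^bsub>H\<^esub> e)" and "s3 = m (a \<otimes>\<^bsub>H\<^esub> b) c"
    and "s4 = m a (b \<otimes>\<^bsub>H\<^esub> c)"
  note sd = this
  define t1 t2 t3 where "t1 = m (a \<otimes>\<^bsub>H\<^esub> (b \<otimes>\<^bsub>H\<^esub> c)) e" and "t2 = m (a \<otimes>\<^bsub>H\<^esub> b) (c \<otimes>\<^bsub>H\<^esub> e)"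
    and "t3 = m a (b \<otimes>\<^bsub>H\<^esub> (c \<otimes>\<^bsub>H\<^esub> e))"
  note td = this
  have C: "ia \<in> carrier A" "ib \<in> carrier A" "ic \<in> carrier A" "ie \<in> carrier A" "iab \<in> carrier A" "ice \<in> carrier A"
    "p \<in> carrier A" "q \<in> carrier A" "r \<in> carrier A" "s1 \<in> carrier A" "s2 \<in> carrier A" "s3 \<in> carrier A"
    "s4 \<in> carrier A" "t1 \<in> carrier A" "t2 \<in> carrier A" "t3 \<in> carrier A"
    unfolding id md sd td using assms by simp_all
  have "z b c e = q \<otimes> ie \<ominus> ib \<otimes> r \<oplus> s1 \<ominus> s2"
    by (simp add: assoc_defect_def id md sd)
  moreover have "z a b c = p \<otimes> ic \<ominus> ia \<otimes> q \<oplus> s3 \<ominus> s4"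
    by (simp add: assoc_defect_def id md sd)
  moreover
  have "\<ominus> z (a \<otimes>\<^bsub>H\<^esub> b) c e \<oplus> (z a (b \<otimes>\<^bsub>H\<^esub> c) e \<ominus> z a b (c \<otimes>\<^bsub>H\<^esub> e))
      = \<ominus> (s3 \<otimes> ie \<ominus> iab \<otimes> r \<oplus> t1 \<ominus> t2)
        \<oplus> ((s4 \<otimes> ie \<ominus> ia \<otimes> s1 \<oplus> t1 \<ominus> t3) \<ominus> (p \<otimes> ice \<ominus> ia \<otimes> s2 \<oplus> t2 \<ominus> t3))"
    using assms by (simp add: assoc_defect_def id md sd td H.m_assoc)
  moreover have "\<dots> = \<ominus> (s3 \<otimes> ie) \<oplus> iab \<otimes> r \<oplus> s4 \<otimes> ie \<ominus> ia \<otimes> s1 \<ominus> p \<otimes> ice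
      \<oplus> ia \<otimes> s2"
    using C by algebra
  moreover have "ia \<otimes> (q \<otimes> ie \<ominus> ib \<otimes> r \<oplus> s1 \<ominus> s2)
      \<oplus> (\<ominus> (s3 \<otimes> ie) \<oplus> iab \<otimes> r \<oplus> s4 \<otimes> ie \<ominus> ia \<otimes> s1 \<ominus> p \<otimes> ice
      \<oplus> ia \<otimes> s2)
      \<oplus> (p \<otimes> ic \<ominus> ia \<otimes> q \<oplus> s3 \<ominus> s4) \<otimes> ie
      = \<ominus> ((ia \<otimes> ib \<ominus> iab) \<otimes> r) \<oplus> p \<otimes> (ic \<otimes> ie \<ominus> ice)"
    using C by algebra
  moreover have "\<dots> = d (\<tau> (m a b) \<otimes> m c e)"
    using assms by (simp add: leibniz_twist d_twist twist_twist d_m twist_diff twist_mult id md l_minus)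
  ultimately show ?thesis by (simp add: id(1,4))
qed

lemma transfer3_harr_cocycle: "transfer3 H A \<iota> m \<in> harr_cocycles K H 3 (- 1)"
proof -
  have fc: "transfer3 H A \<iota> m \<in> tuples H 3 \<rightarrow> carrier H"
    using transfer3_CHoch by (auto simp: CHoch_def)
  have "hoch_diff H 3 (- 1) (transfer3 H A \<iota> m) xs = (\<lambda>xs\<in>tuples H (Suc 3). \<zero>\<^bsub>H\<^esub>) xs" for xs
  proof (cases "xs \<in> tuples H 4")
    \<comment> \<open>Off the four-tuples both sides are the default value of an extensional
      function.\<close>
    case False
    then show ?thesis by (simp add: hoch_diff_def)
  next
    case True
    then obtain a b c e where x: "xs = [a, b, c, e]" and cl: "a \<in> carrier H" "b \<in> carrier H" "c \<in> carrier H" "e \<in> carrier H"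
      by (auto simp: tuples4_iff)
    have "hoch_diff H 3 (- 1) (transfer3 H A \<iota> m) xs =
      \<rho> (\<tau> (\<iota> a)) \<otimes>\<^bsub>H\<^esub> \<rho> (z b c e)
      \<oplus>\<^bsub>H\<^esub> (\<ominus>\<^bsub>H\<^esub> \<rho> (z (a \<otimes>\<^bsub>H\<^esub> b) c e) \<oplus>\<^bsub>H\<^esub> (\<rho> (z a (b \<otimes>\<^bsub>H\<^esub> c) e) \<ominus>\<^bsub>H\<^esub> \<rho> (z a b (c \<otimes>\<^bsub>H\<^esub> e))))
      \<oplus>\<^bsub>H\<^esub> \<rho> (z a b c) \<otimes>\<^bsub>H\<^esub> \<rho> (\<iota> e)"
      unfolding x using cl by (subst H.hoch_diff3[OF fc]) (simp_all add: transfer3_eq iota_twist rho_iota)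
    also have "\<dots> = \<rho> (\<tau> (\<iota> a) \<otimes> z b c e
      \<oplus> (\<ominus> z (a \<otimes>\<^bsub>H\<^esub> b) c e \<oplus> (z a (b \<otimes>\<^bsub>H\<^esub> c) e \<ominus> z a b (c \<otimes>\<^bsub>H\<^esub> e)))
      \<oplus> z a b c \<otimes> \<iota> e)"
      using cl by (simp add: rho_add rho_neg rho_diff rho_mult cocycle_add cocycle_neg cocycle_diff cocycle_mult
          z_cocycle cocycle_twist iota_cocycle)
    also have "\<dots> = \<zero>\<^bsub>H\<^esub>"
      using cl by (simp add: z_hochschild rho_d)
    finally show ?thesis using cl x by simp
  qed
  then show ?thesis
    unfolding harr_cocycles_def using transfer3_CHarr by auto
qed

end

section \<open>Independence of the transfer model\<close>

text \<open>A chain homotopy \<open>lam\<close> from \<open>\<iota>\<close> to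
  \<open>\<iota>'\<close> need not respect products. Its failure, corrected by
  \<open>m' - m\<close>, is the closed element \<open>G a b\<close>. The product terms use
  \<open>\<iota>\<close> on the left of \<open>lam\<close> and \<open>\<iota>'\<close> on its right,
  so that their differentials telescope to
  \<open>\<iota>' a \<iota>' b - \<iota> a \<iota> b\<close>.\<close>

lemma transfer3_change_of_model:
  fixes A :: "('k, 'a, 'y) dg_algebra_scheme" (structure)
  assumes "transfer_model K H A \<iota> m" "transfer_model K H A \<iota>' m'"
    and lam: "linear_map K H A lam" "\<And>x k. x \<in> grade H k \<Longrightarrow> lam x \<in> grade A (k - 1)"
    and dlam: "\<And>x. x \<in> carrier H \<Longrightarrow> differential A (lam x) = \<iota>' x \<ominus> \<iota> x"
  shows "\<exists>g\<in>CHarr K H 2 (- 1). transfer3 H A \<iota> m =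
    (\<lambda>xs\<in>tuples H 3. transfer3 H A \<iota>' m' xs \<oplus>\<^bsub>H\<^esub> hoch_diff H 2 (- 1) g xs)"
proof -
  interpret M: transfer_model K H A \<iota> m by fact
  interpret M': transfer_model K H A \<iota>' m' by fact
  note [simp, intro] = linear_map_closed[OF lam(1)]
  note lam_add = linear_map_add[OF lam(1)] and lam_smult = linear_map_smult[OF lam(1)]
  note lam_neg = linear_map_neg[OF lam(1) M.H.abgrp M.abgrp]
  let ?t = "sign_twist A 1"
  \<comment> \<open>\<open>lam\<close> and the class of \<open>G\<close> are the components of a homotopy between the two models\<close>
  define G where "G a b = m' a b \<ominus> m a b \<ominus> lam a \<otimes> \<iota>' b \<ominus> ?t (\<iota> a) \<otimes> lam b
    \<oplus> lam (a \<otimes>\<^bsub>H\<^esub> b)" for a b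
  have G_closed [simp, intro]: "G a b \<in> carrier A" if "a \<in> carrier H" "b \<in> carrier H" for a b
    using that by (simp add: G_def)
  have G_cocycle: "G a b \<in> cocycles A" if ab: "a \<in> carrier H" "b \<in> carrier H" for a b
  proof (rule M.cocycleI)
    have "M.d (G a b) = (\<iota>' a \<otimes> \<iota>' b \<ominus> \<iota>' (a \<otimes>\<^bsub>H\<^esub> b)) \<ominus> (\<iota> a \<otimes> \<iota> b \<ominus> \<iota> (a \<otimes>\<^bsub>H\<^esub> b))
        \<ominus> (\<iota>' a \<ominus> \<iota> a) \<otimes> \<iota>' b \<ominus> \<iota> a \<otimes> (\<iota>' b \<ominus> \<iota> b) \<oplus> (\<iota>' (a \<otimes>\<^bsub>H\<^esub> b) \<ominus> \<iota> (a \<otimes>\<^bsub>H\<^esub> b))"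
      using ab by (simp add: G_def M.d_add M.d_diff M.d_m M'.d_m M.leibniz_twist dlam M.d_iota M'.d_iota
          M.d_twist M.twist_zero M.twist_twist)
    also have "\<dots> = \<zero>"
      using M.iota_closed[OF ab(1)] M.iota_closed[OF ab(2)] M'.iota_closed[OF ab(1)] M'.iota_closed[OF ab(2)]
        M.iota_closed[OF M.H.m_closed[OF ab]] M'.iota_closed[OF M.H.m_closed[OF ab]]
      by algebra
    finally show "M.d (G a b) = \<zero>" .
  qed (use ab in auto)
  have G_grade: "G a b \<in> grade A (i + j - 1)" if ab: "a \<in> grade H i" "b \<in> grade H j" for a b i j
  proof -
    have "lam a \<otimes> \<iota>' b \<in> grade A (i + j - 1)"
      using M.mult_grade[OF lam(2)[OF ab(1)] M'.iota_grade[OF ab(2)]] by (simp add: algebra_simps)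
    moreover have "?t (\<iota> a) \<otimes> lam b \<in> grade A (i + j - 1)"
      using M.mult_grade[OF M.twist_grade[OF M.iota_grade[OF ab(1)]] lam(2)[OF ab(2)]]
      by (simp add: algebra_simps)
    ultimately show ?thesis
      unfolding G_def
      by (intro M.grade_add M.grade_diff M.m_grade M'.m_grade lam M.H.mult_grade ab)
  qed
  have ad: "(p \<oplus> p') \<ominus> (q \<oplus> q') \<ominus> (r \<oplus> r') \<ominus> (t \<oplus> t') \<oplus> (w \<oplus> w')
      = (p \<ominus> q \<ominus> r \<ominus> t \<oplus> w) \<oplus> (p' \<ominus> q' \<ominus> r' \<ominus> t' \<oplus> w')"
    if "p \<in> carrier A" "q \<in> carrier A" "r \<in> carrier A" "t \<in> carrier A" "w \<in> carrier A"
      "p' \<in> carrier A" "q' \<in> carrier A" "r' \<in> carrier A" "t' \<in> carrier A" "w' \<in> carrier A"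
    for p q r t w p' q' r' t' w'
    using that by algebra
  note s = G_def M.iota_add M.iota_smult M'.iota_add M'.iota_smult M.twist_add M.twist_smult
    M.m_add_left M.m_add_right M.m_smult_left M.m_smult_right M'.m_add_left M'.m_add_right
    M'.m_smult_left M'.m_smult_right lam_add lam_smult M.l_distr M.r_distr M.smult_mult_left M.smult_mult_right
    M.H.l_distr M.H.r_distr M.H.smult_mult_left M.H.smult_mult_right M.smult_r_distr M.smult_diff
  have G_left: "linear_map K H A (\<lambda>a. G a b)" if "b \<in> carrier H" for b
    by (rule linear_mapI; use that in \<open>simp add: s ad\<close>)
  have G_right: "linear_map K H A (G a)" if "a \<in> carrier H" for a
    by (rule linear_mapI; use that in \<open>simp add: s ad\<close>)
  \<comment> \<open>Exchanging the arguments also exchanges the roles of \<open>\<iota>\<close> and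
    \<open>\<iota>'\<close> in the product terms. So \<open>G\<close> is symmetric only up to a
    coboundary, which is enough for its class to be a Harrison cochain.\<close>
  have G_sym: "G a b = [parity_sign (i * j)] \<cdot> G b a \<ominus> M.d (?t (lam a) \<otimes> lam b)"
    if ab: "a \<in> grade H i" "b \<in> grade H j" for a b i j
  proof -
    have cl: "a \<in> carrier H" "b \<in> carrier H" using ab M.H.grade_carrier by auto
    note sw = M.m_sym[OF ab] M'.m_sym[OF ab] M.H.graded_commutative[OF ab(2,1)]
      M.graded_commutative[OF lam(2)[OF ab(2)] M'.iota_grade[OF ab(1)]]
      M.graded_commutative[OF M.iota_grade[OF ab(2)] lam(2)[OF ab(1)]]
    note tw = M.twist_homogeneous[OF M.iota_grade[OF ab(1)]] M.twist_homogeneous[OF M.iota_grade[OF ab(2)]]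
      M.twist_homogeneous[OF M'.iota_grade[OF ab(1)]]
    define p q r t u v w where "p = m' a b" and "q = m a b" and "r = lam a \<otimes> \<iota>' b"
      and "t = \<iota> a \<otimes> lam b" and "u = \<iota>' a \<otimes> lam b" and "v = lam a \<otimes> \<iota> b" and "w = lam (a \<otimes>\<^bsub>H\<^esub> b)"
    note df = this
    have C: "p \<in> carrier A" "q \<in> carrier A" "r \<in> carrier A" "t \<in> carrier A" "u \<in> carrier A"
      "v \<in> carrier A" "w \<in> carrier A"
      using cl by (simp_all add: df)
    have 1: "G a b = p \<ominus> q \<ominus> r \<ominus> [parity_sign i] \<cdot> t \<oplus> w"
      using cl by (simp add: G_def df tw M.M.parity_pow M.l_minus)
    have 2: "G b a = [parity_sign (i * j)] \<cdot> p \<ominus> [parity_sign (i * j)] \<cdot> q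
        \<ominus> [parity_sign ((j - 1) * i)] \<cdot> u \<ominus> [parity_sign (j + j * (i - 1))] \<cdot> v
        \<oplus> [parity_sign (i * j)] \<cdot> w"
      using cl by (simp add: G_def df tw sw M.M.parity_pow M.H.M.parity_pow M.l_minus lam_neg mult.commute[of j i])
    have 3: "M.d (?t (lam a) \<otimes> lam b) = \<ominus> ([parity_sign i] \<cdot> u \<ominus> [parity_sign i] \<cdot> t) \<oplus> (r \<ominus> v)"
      using cl
      by (simp add: df M.leibniz_twist M.d_twist dlam M.twist_add M.twist_neg tw M.twist_twist M.M.parity_pow
          M.l_minus M.l_distr M.r_distr M.r_minus a_minus_def M.M.minus_add)
    show ?thesis
      unfolding 1 2 3
      apply (cases "even i"; cases "even j"; simp add: M.M.parity_pow C)
      using C by algebra+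
  qed
  \<comment> \<open>The two representatives of a class differ by \<open>d (lam _)\<close>, so both
    models read off the same coordinate.\<close>
  have rho_eq: "M'.\<rho> x = M.\<rho> x" if x: "x \<in> cocycles A" for x
  proof -
    obtain u where u: "u \<in> carrier A" "x = \<iota> (M.\<rho> x) \<oplus> M.d u"
      using M.rho_rep[OF x] by meson
    have c: "M.\<rho> x \<in> carrier H" using x by auto
    have "\<iota>' (M.\<rho> x) \<oplus> M.d (u \<ominus> lam (M.\<rho> x)) = \<iota>' (M.\<rho> x) \<oplus> (M.d u \<ominus> (\<iota>' (M.\<rho> x) \<ominus> \<iota> (M.\<rho> x)))"
      using c u(1) by (simp add: M.d_diff dlam)
    also have "\<dots> = \<iota> (M.\<rho> x) \<oplus> M.d u"
      using M.iota_closed[OF c] M'.iota_closed[OF c] M.d_closed[OF u(1)] by algebra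
    finally have "x = \<iota>' (M.\<rho> x) \<oplus> M.d (u \<ominus> lam (M.\<rho> x))" using u(2) by metis
    then show ?thesis by (rule M'.rho_eqI[rotated 2]) (use c u(1) in simp_all)
  qed
  define g where "g = (\<lambda>xs\<in>tuples H 2. M.\<rho> (G (xs ! 0) (xs ! 1)))"
  have g_eq: "g [a, b] = M.\<rho> (G a b)" if "a \<in> carrier H" "b \<in> carrier H" for a b
    using that by (simp add: g_def)
  have "g \<in> CHoch K H 2 (- 1)"
    unfolding g_def
  proof (rule M.H.CHoch2I)
    show "linear_map K H H (\<lambda>a. M.\<rho> (G a b))" if "b \<in> carrier H" for b
      by (rule linear_mapI; use that in \<open>simp add: linear_map_add[OF G_left] linear_map_smult[OF G_left]
          M.rho_add M.rho_smult G_cocycle\<close>)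
    show "linear_map K H H (\<lambda>b. M.\<rho> (G a b))" if "a \<in> carrier H" for a
      by (rule linear_mapI; use that in \<open>simp add: linear_map_add[OF G_right] linear_map_smult[OF G_right]
          M.rho_add M.rho_smult G_cocycle\<close>)
    show "M.\<rho> (G a b) \<in> grade H (i + j + - 1)" if "a \<in> grade H i" "b \<in> grade H j" for a b i j
      using M.rho_grade[OF G_cocycle G_grade[OF that]] that M.H.grade_carrier by auto
  qed
  moreover have "g [a, b] = [parity_sign (i * j)] \<cdot>\<^bsub>H\<^esub> g [b, a]"
    if ab: "a \<in> grade H i" "b \<in> grade H j" for a b i j
  proof -
    have cl: "a \<in> carrier H" "b \<in> carrier H" using ab M.H.grade_carrier by auto
    have pz: "[parity_sign (i * j)] \<cdot> G b a \<in> cocycles A"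
      using cl by (simp add: M.M.parity_pow G_cocycle M.cocycle_neg)
    show ?thesis
      using cl pz
      by (simp add: g_eq G_sym[OF ab] M.rho_add M.rho_neg M.cocycle_neg M.coboundary_cocycle M.rho_d M.rho_parity G_cocycle a_minus_def)
  qed
  ultimately have g: "g \<in> CHarr K H 2 (- 1)"
    unfolding M.H.CHarr2_iff by blast
  have "transfer3 H A \<iota> m [a, b, c] = transfer3 H A \<iota>' m' [a, b, c] \<oplus>\<^bsub>H\<^esub> hoch_diff H 2 (- 1) g [a, b, c]"
    if cl: "a \<in> carrier H" "b \<in> carrier H" "c \<in> carrier H" for a b c
  proof -
    have ab: "a \<otimes>\<^bsub>H\<^esub> b \<in> carrier H" and bc: "b \<otimes>\<^bsub>H\<^esub> c \<in> carrier H" using cl by auto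
    \<comment> \<open>The class of \<open>D\<close> is minus the Hochschild differential of
      \<open>g\<close>; this is why the coboundary is added to the primed cochain in the
      conclusion.\<close>
    define D where "D = G a b \<otimes> \<iota>' c \<ominus> ?t (\<iota> a) \<otimes> G b c \<oplus> G (a \<otimes>\<^bsub>H\<^esub> b) c \<ominus> G a (b \<otimes>\<^bsub>H\<^esub> c)"
    \<comment> \<open>The primitive pairs the old \<open>m\<close> with \<open>lam\<close> on the
      right and the new \<open>m'\<close> with \<open>lam\<close> on the left, matching the mixed
      convention in \<open>G\<close>.\<close>
    define E where "E = ?t (m a b) \<otimes> lam c \<oplus> ?t (lam a) \<otimes> m' b c"
    have E: "E \<in> carrier A" using cl by (simp add: E_def)
    have dE: "M.d E = (\<ominus> ((?t (\<iota> a) \<otimes> ?t (\<iota> b) \<ominus> ?t (\<iota> (a \<otimes>\<^bsub>H\<^esub> b))) \<otimes> lam c)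
          \<oplus> m a b \<otimes> (\<iota>' c \<ominus> \<iota> c))
        \<oplus> (\<ominus> ((?t (\<iota>' a) \<ominus> ?t (\<iota> a)) \<otimes> m' b c)
          \<oplus> lam a \<otimes> (\<iota>' b \<otimes> \<iota>' c \<ominus> \<iota>' (b \<otimes>\<^bsub>H\<^esub> c)))"
      using cl by (simp add: E_def M.d_add M.leibniz_twist M.d_twist M.twist_twist M.d_m M'.d_m dlam
          M.twist_diff M.twist_mult M.l_minus)
    \<comment> \<open>The chain-level comparison. Applying \<open>\<rho>\<close> removes
      \<open>d E\<close> and leaves the Harrison coboundary.\<close>
    have zz: "M'.z a b c = M.z a b c \<oplus> (D \<oplus> M.d E)"
    proof -
      define p p' q q' where "p = m a b" and "p' = m' a b" and "q = m b c" and "q' = m' b c"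
      note d1 = this
      define ic ic' ib' tia tia' tib tiab ibc' where "ic = \<iota> c" and "ic' = \<iota>' c" and "ib' = \<iota>' b"
        and "tia = ?t (\<iota> a)" and "tia' = ?t (\<iota>' a)" and "tib = ?t (\<iota> b)" and "tiab = ?t (\<iota> (a \<otimes>\<^bsub>H\<^esub> b))"
        and "ibc' = \<iota>' (b \<otimes>\<^bsub>H\<^esub> c)"
      note d2 = this
      define la lb lc lab lbc labc where "la = lam a" and "lb = lam b" and "lc = lam c" and "lab = lam (a \<otimes>\<^bsub>H\<^esub> b)"
        and "lbc = lam (b \<otimes>\<^bsub>H\<^esub> c)" and "labc = lam (a \<otimes>\<^bsub>H\<^esub> (b \<otimes>\<^bsub>H\<^esub> c))"
      note d3 = this
      define s s' t t' where "s = m (a \<otimes>\<^bsub>H\<^esub> b) c" and "s' = m' (a \<otimes>\<^bsub>H\<^esub> b) c" and "t = m a (b \<otimes>\<^bsub>H\<^esub> c)"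
        and "t' = m' a (b \<otimes>\<^bsub>H\<^esub> c)"
      note d4 = this
      have C: "p \<in> carrier A" "p' \<in> carrier A" "q \<in> carrier A" "q' \<in> carrier A"
        "ic \<in> carrier A" "ic' \<in> carrier A" "ib' \<in> carrier A" "tia \<in> carrier A" "tia' \<in> carrier A"
        "tib \<in> carrier A" "tiab \<in> carrier A" "ibc' \<in> carrier A"
        "la \<in> carrier A" "lb \<in> carrier A" "lc \<in> carrier A" "lab \<in> carrier A" "lbc \<in> carrier A" "labc \<in> carrier A"
        "s \<in> carrier A" "s' \<in> carrier A" "t \<in> carrier A" "t' \<in> carrier A"
        unfolding d1 d2 d3 d4 using cl by simp_all
      have Gabc: "G (a \<otimes>\<^bsub>H\<^esub> b) c \<ominus> G a (b \<otimes>\<^bsub>H\<^esub> c) =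
          (s' \<ominus> s \<ominus> lab \<otimes> ic' \<ominus> tiab \<otimes> lc \<oplus> labc)
          \<ominus> (t' \<ominus> t \<ominus> la \<otimes> ibc' \<ominus> tia \<otimes> lbc \<oplus> labc)"
        using cl by (simp add: G_def d1 d2 d3 d4 M.H.m_assoc)
      also have "\<dots> = (s' \<ominus> s) \<ominus> (t' \<ominus> t)
          \<oplus> (la \<otimes> ibc' \<oplus> tia \<otimes> lbc \<ominus> lab \<otimes> ic' \<ominus> tiab \<otimes> lc)"
        using C by algebra
      finally have g1: "G (a \<otimes>\<^bsub>H\<^esub> b) c \<ominus> G a (b \<otimes>\<^bsub>H\<^esub> c) = \<dots>" .
      have g2: "G a b \<otimes> \<iota>' c \<ominus> ?t (\<iota> a) \<otimes> G b c = (p' \<ominus> p) \<otimes> ic' \<ominus> tia \<otimes> (q' \<ominus> q)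
          \<ominus> (la \<otimes> (ib' \<otimes> ic') \<oplus> tia \<otimes> lbc \<ominus> lab \<otimes> ic' \<ominus> tia \<otimes> (tib \<otimes> lc))"
      proof -
        have "G a b = p' \<ominus> p \<ominus> la \<otimes> ib' \<ominus> tia \<otimes> lb \<oplus> lab"
          "G b c = q' \<ominus> q \<ominus> lb \<otimes> ic' \<ominus> tib \<otimes> lc \<oplus> lbc"
          by (simp_all add: G_def d1 d2 d3)
        moreover have "(p' \<ominus> p \<ominus> la \<otimes> ib' \<ominus> tia \<otimes> lb \<oplus> lab) \<otimes> ic'
            \<ominus> tia \<otimes> (q' \<ominus> q \<ominus> lb \<otimes> ic' \<ominus> tib \<otimes> lc \<oplus> lbc)
          = (p' \<ominus> p) \<otimes> ic' \<ominus> tia \<otimes> (q' \<ominus> q)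
          \<ominus> (la \<otimes> (ib' \<otimes> ic') \<oplus> tia \<otimes> lbc \<ominus> lab \<otimes> ic' \<ominus> tia \<otimes> (tib \<otimes> lc))"
          using C by algebra
        ultimately show ?thesis by (simp add: d2)
      qed
      have z1: "M'.z a b c = p' \<otimes> ic' \<ominus> tia' \<otimes> q' \<oplus> s' \<ominus> t'"
        "M.z a b c = p \<otimes> ic \<ominus> tia \<otimes> q \<oplus> s \<ominus> t"
        by (simp_all add: assoc_defect_def d1 d2 d4)
      \<comment> \<open>The terms of \<open>D\<close> that involve \<open>lam\<close> reduce to the
        two product defects that \<open>d E\<close> supplies with the opposite sign.\<close>
      have L: "(la \<otimes> ibc' \<oplus> tia \<otimes> lbc \<ominus> lab \<otimes> ic' \<ominus> tiab \<otimes> lc)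
          \<ominus> (la \<otimes> (ib' \<otimes> ic') \<oplus> tia \<otimes> lbc \<ominus> lab \<otimes> ic' \<ominus> tia \<otimes> (tib \<otimes> lc))
        = (tia \<otimes> tib \<ominus> tiab) \<otimes> lc \<ominus> la \<otimes> (ib' \<otimes> ic' \<ominus> ibc')"
        using C by algebra
      \<comment> \<open>The rest of the identity is linear once products are treated as opaque;
        \<open>L\<close> enters as the hypothesis \<open>eq\<close>.\<close>
      have R: "(u1 \<ominus> u2 \<ominus> L1) \<oplus> (u3 \<ominus> u4 \<oplus> L2) \<oplus> ((\<ominus> P1 \<oplus> P2) \<oplus> (\<ominus> P3 \<oplus> P4))
          = (u1 \<oplus> P2) \<ominus> (u2 \<oplus> P3) \<oplus> u3 \<ominus> u4"
        if eq: "L2 \<ominus> L1 = P1 \<ominus> P4"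
          and cl: "u1 \<in> carrier A" "u2 \<in> carrier A" "u3 \<in> carrier A" "u4 \<in> carrier A" "L1 \<in> carrier A"
            "L2 \<in> carrier A" "P1 \<in> carrier A" "P2 \<in> carrier A" "P3 \<in> carrier A" "P4 \<in> carrier A"
        for u1 u2 u3 u4 L1 L2 P1 P2 P3 P4
      proof -
        have "(u1 \<ominus> u2 \<ominus> L1) \<oplus> (u3 \<ominus> u4 \<oplus> L2) \<oplus> ((\<ominus> P1 \<oplus> P2) \<oplus> (\<ominus> P3 \<oplus> P4))
          = (u1 \<oplus> P2) \<ominus> (u2 \<oplus> P3) \<oplus> u3 \<ominus> u4 \<oplus> ((L2 \<ominus> L1) \<ominus> (P1 \<ominus> P4))"
          using cl by algebra
        then show ?thesis using cl unfolding eq by (simp add: M.M.minus_eq_zero_iff)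
      qed
      define f1 f2 where "f1 = G a b \<otimes> \<iota>' c" and "f2 = ?t (\<iota> a) \<otimes> G b c"
      have "D = (f1 \<ominus> f2) \<oplus> (G (a \<otimes>\<^bsub>H\<^esub> b) c \<ominus> G a (b \<otimes>\<^bsub>H\<^esub> c))"
        unfolding D_def f1_def[symmetric] f2_def[symmetric]
        using cl by (simp add: f1_def f2_def a_minus_def M.M.a_assoc)
      then have "D \<oplus> M.d E = (((p' \<ominus> p) \<otimes> ic' \<ominus> tia \<otimes> (q' \<ominus> q)
          \<ominus> (la \<otimes> (ib' \<otimes> ic') \<oplus> tia \<otimes> lbc \<ominus> lab \<otimes> ic' \<ominus> tia \<otimes> (tib \<otimes> lc)))
        \<oplus> ((s' \<ominus> s) \<ominus> (t' \<ominus> t)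
          \<oplus> (la \<otimes> ibc' \<oplus> tia \<otimes> lbc \<ominus> lab \<otimes> ic' \<ominus> tiab \<otimes> lc)))
        \<oplus> ((\<ominus> ((tia \<otimes> tib \<ominus> tiab) \<otimes> lc) \<oplus> p \<otimes> (ic' \<ominus> ic))
          \<oplus> (\<ominus> ((tia' \<ominus> tia) \<otimes> q') \<oplus> la \<otimes> (ib' \<otimes> ic' \<ominus> ibc')))"
        unfolding dE g1 f1_def f2_def g2 by (simp only: d1 d2 d3)
      also have "\<dots> = ((p' \<ominus> p) \<otimes> ic' \<oplus> p \<otimes> (ic' \<ominus> ic))
          \<ominus> (tia \<otimes> (q' \<ominus> q) \<oplus> (tia' \<ominus> tia) \<otimes> q') \<oplus> (s' \<ominus> s) \<ominus> (t' \<ominus> t)"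
        by (rule R[OF L]) (use C in simp_all)
      also have "\<dots> = (p' \<otimes> ic' \<ominus> p \<otimes> ic) \<ominus> (tia' \<otimes> q' \<ominus> tia \<otimes> q)
          \<oplus> (s' \<ominus> s) \<ominus> (t' \<ominus> t)"
        using C by algebra
      finally have "M.z a b c \<oplus> (D \<oplus> M.d E) = (p \<otimes> ic \<ominus> tia \<otimes> q \<oplus> s \<ominus> t) \<oplus> ((p' \<otimes> ic' \<ominus> p \<otimes> ic)
          \<ominus> (tia' \<otimes> q' \<ominus> tia \<otimes> q) \<oplus> (s' \<ominus> s) \<ominus> (t' \<ominus> t))"
        unfolding z1 by simp
      also have "\<dots> = p' \<otimes> ic' \<ominus> tia' \<otimes> q' \<oplus> s' \<ominus> t'"
        using C by algebra
      finally show ?thesis unfolding z1 by (rule sym)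
    qed
    have D: "D \<in> cocycles A"
      using cl ab bc
      by (simp add: D_def M.cocycle_add M.cocycle_diff M.cocycle_mult M.cocycle_twist G_cocycle
          M.iota_cocycle M'.iota_cocycle)
    have "M.\<rho> (\<iota>' c) = c"
      using rho_eq[OF M'.iota_cocycle] M'.rho_iota cl by simp
    then have rD: "M.\<rho> D = g [a, b] \<otimes>\<^bsub>H\<^esub> c \<ominus>\<^bsub>H\<^esub> M.H.\<tau> a \<otimes>\<^bsub>H\<^esub> g [b, c] \<oplus>\<^bsub>H\<^esub> g [a \<otimes>\<^bsub>H\<^esub> b, c] \<ominus>\<^bsub>H\<^esub> g [a, b \<otimes>\<^bsub>H\<^esub> c]"
      using cl ab bc
      by (simp add: D_def M.cocycle_add M.cocycle_diff M.cocycle_mult M.cocycle_twist G_cocycle g_eq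
          M.iota_cocycle M'.iota_cocycle M.rho_add M.rho_diff M.rho_mult M.iota_twist M.rho_iota)
    have gf: "g \<in> tuples H 2 \<rightarrow> carrier H"
      using g by (auto simp: CHarr_def CHoch_def)
    have gc: "g [p, q] \<in> carrier H" if "p \<in> carrier H" "q \<in> carrier H" for p q
      using gf that by auto
    have zc: "M.\<rho> (M.z a b c) \<in> carrier H"
      using cl M.z_cocycle by auto
    have "transfer3 H A \<iota>' m' [a, b, c] = M.\<rho> (M.z a b c) \<oplus>\<^bsub>H\<^esub> M.\<rho> D"
      using cl D E
      by (simp add: M'.transfer3_eq rho_eq M'.z_cocycle zz M.rho_add M.z_cocycle M.cocycle_add
          M.coboundary_cocycle M.rho_d)
    moreover define f1 f2 f3 f4 where "f1 = g [a, b] \<otimes>\<^bsub>H\<^esub> c" and "f2 = M.H.\<tau> a \<otimes>\<^bsub>H\<^esub> g [b, c]"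
      and "f3 = g [a \<otimes>\<^bsub>H\<^esub> b, c]" and "f4 = g [a, b \<otimes>\<^bsub>H\<^esub> c]"
    moreover have F: "f1 \<in> carrier H" "f2 \<in> carrier H" "f3 \<in> carrier H" "f4 \<in> carrier H"
      using cl ab bc gc by (simp_all add: f1_def f2_def f3_def f4_def)
    moreover have "M.\<rho> (M.z a b c) \<oplus>\<^bsub>H\<^esub> (f1 \<ominus>\<^bsub>H\<^esub> f2 \<oplus>\<^bsub>H\<^esub> f3 \<ominus>\<^bsub>H\<^esub> f4) \<oplus>\<^bsub>H\<^esub> (f2 \<oplus>\<^bsub>H\<^esub> (\<ominus>\<^bsub>H\<^esub> f3 \<oplus>\<^bsub>H\<^esub> f4) \<ominus>\<^bsub>H\<^esub> f1)
        = M.\<rho> (M.z a b c)"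
      using F zc by algebra
    ultimately show ?thesis
      using cl by (simp add: M.H.hoch_diff2[OF gf cl] rD M.transfer3_eq)
  qed
  then have "transfer3 H A \<iota> m = (\<lambda>xs\<in>tuples H 3. transfer3 H A \<iota>' m' xs \<oplus>\<^bsub>H\<^esub> hoch_diff H 2 (- 1) g xs)"
    by (intro ext) (auto simp: tuples3_iff restrict_def transfer3_def[of H A \<iota> m])
  then show ?thesis using g by blast
qed

section \<open>Graded complements and sections\<close>

definition graded_submodule ::
  "('k, 'm) ring_scheme \<Rightarrow> ('k, 'a, 'x) graded_algebra_scheme \<Rightarrow> 'a set \<Rightarrow> bool"
  where "graded_submodule K B C \<longleftrightarrow> submodule C K B \<and> (\<forall>x\<in>C. \<forall>k. component B x k \<in> C)"

context gca
begin

lemma graded_submoduleD: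
  assumes "graded_submodule K B C"
  shows "C \<subseteq> carrier B" "\<zero>\<^bsub>B\<^esub> \<in> C" "x \<in> C \<Longrightarrow> y \<in> C \<Longrightarrow> x \<oplus>\<^bsub>B\<^esub> y \<in> C"
    "x \<in> C \<Longrightarrow> \<ominus>\<^bsub>B\<^esub> x \<in> C" "a \<in> carrier K \<Longrightarrow> x \<in> C \<Longrightarrow> a \<odot>\<^bsub>B\<^esub> x \<in> C"
    "x \<in> C \<Longrightarrow> component B x k \<in> C"
proof -
  have s: "submodule C K B" using assms by (simp add: graded_submodule_def)
  show "C \<subseteq> carrier B" "x \<in> C \<Longrightarrow> y \<in> C \<Longrightarrow> x \<oplus>\<^bsub>B\<^esub> y \<in> C"
    "x \<in> C \<Longrightarrow> \<ominus>\<^bsub>B\<^esub> x \<in> C" "a \<in> carrier K \<Longrightarrow> x \<in> C \<Longrightarrow> a \<odot>\<^bsub>B\<^esub> x \<in> C"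
    using submoduleE[OF s] by auto
  show "\<zero>\<^bsub>B\<^esub> \<in> C" using submodule.axioms(1)[OF s] subgroup.one_closed by force
  show "x \<in> C \<Longrightarrow> component B x k \<in> C" using assms by (simp add: graded_submodule_def)
qed

lemma graded_submoduleI:
  assumes "C \<subseteq> carrier B" "\<zero>\<^bsub>B\<^esub> \<in> C" "\<And>x y. x \<in> C \<Longrightarrow> y \<in> C \<Longrightarrow> x \<oplus>\<^bsub>B\<^esub> y \<in> C"
    "\<And>x. x \<in> C \<Longrightarrow> \<ominus>\<^bsub>B\<^esub> x \<in> C" "\<And>a x. a \<in> carrier K \<Longrightarrow> x \<in> C \<Longrightarrow> a \<odot>\<^bsub>B\<^esub> x \<in> C"
    "\<And>x k. x \<in> C \<Longrightarrow> component B x k \<in> C"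
  shows "graded_submodule K B C"
  unfolding graded_submodule_def using assms by (auto intro!: submoduleI)

lemma graded_submodule_zero: "graded_submodule K B {\<zero>\<^bsub>B\<^esub>}"
  by (rule graded_submoduleI) (auto simp: linear_map_zero[OF component_linear abgrp abgrp])

lemma graded_submodule_Union_chain:
  assumes C: "C \<noteq> {}" "subset.chain {S. graded_submodule K B S} C"
  shows "graded_submodule K B (\<Union>C)"
proof (rule graded_submoduleI)
  have g: "graded_submodule K B S" if "S \<in> C" for S using C that by (auto simp: subset.chain_def)
  show "\<Union>C \<subseteq> carrier B" "\<zero>\<^bsub>B\<^esub> \<in> \<Union>C"
    using g graded_submoduleD(1,2) C(1) by blast+
  show "\<ominus>\<^bsub>B\<^esub> x \<in> \<Union>C" "component B x k \<in> \<Union>C" if "x \<in> \<Union>C" for x k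
    using g graded_submoduleD(4,6) that by blast+
  show "a \<odot>\<^bsub>B\<^esub> x \<in> \<Union>C" if "a \<in> carrier K" "x \<in> \<Union>C" for a x
    using g graded_submoduleD(5) that by blast
  fix x y assume "x \<in> \<Union>C" "y \<in> \<Union>C"
  then obtain S T where ST: "S \<in> C" "x \<in> S" "T \<in> C" "y \<in> T" by blast
  then have "S \<subseteq> T \<or> T \<subseteq> S" using C(2) unfolding subset.chain_def by blast
  then show "x \<oplus>\<^bsub>B\<^esub> y \<in> \<Union>C"
    using ST graded_submoduleD(3)[OF g] by blast
qed

text \<open>As \<open>x\<close> is homogeneous, a multiple of it affects the component in one degree
  only, so the enlarged submodule is again graded.\<close>

lemma graded_submodule_adjoin:
  assumes C: "graded_submodule K B C" and x: "x \<in> grade B i"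
  shows "graded_submodule K B {c \<oplus>\<^bsub>B\<^esub> a \<odot>\<^bsub>B\<^esub> x | c a. c \<in> C \<and> a \<in> carrier K}" (is "graded_submodule K B ?D")
proof (rule graded_submoduleI)
  note D = graded_submoduleD[OF C]
  have xc: "x \<in> carrier B" using x grade_carrier by blast
  have DI: "c \<oplus>\<^bsub>B\<^esub> a \<odot>\<^bsub>B\<^esub> x \<in> ?D" if "c \<in> C" "a \<in> carrier K" for c a using that by blast
  have cB: "c \<in> carrier B" if "c \<in> C" for c using D(1) that by blast
  show "?D \<subseteq> carrier B" using cB xc by auto
  show "\<zero>\<^bsub>B\<^esub> \<in> ?D" using DI[OF D(2) R.zero_closed] xc by simp
  fix y assume "y \<in> ?D"
  then obtain c a where y: "y = c \<oplus>\<^bsub>B\<^esub> a \<odot>\<^bsub>B\<^esub> x" and ca: "c \<in> C" "a \<in> carrier K" by blast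
  note cy = cB[OF ca(1)]
  show "\<ominus>\<^bsub>B\<^esub> y \<in> ?D"
    using DI[OF D(4)[OF ca(1)] R.a_inv_closed[OF ca(2)]] cy ca xc
    by (simp add: y smult_l_minus M.minus_add)
  show "b \<odot>\<^bsub>B\<^esub> y \<in> ?D" if "b \<in> carrier K" for b
    using DI[OF D(5)[OF that ca(1)] R.m_closed[OF that ca(2)]] cy ca xc that
    by (simp add: y smult_r_distr smult_assoc1)
  show "component B y k \<in> ?D" for k
    using DI[OF D(6)[OF ca(1), of k], of "if k = i then a else \<zero>\<^bsub>K\<^esub>"] cy ca xc
    by (auto simp: y component_add component_smult component_homogeneous[OF x] split: if_splits)
  fix w assume "w \<in> ?D"
  then obtain e b where w: "w = e \<oplus>\<^bsub>B\<^esub> b \<odot>\<^bsub>B\<^esub> x" and eb: "e \<in> C" "b \<in> carrier K" by blast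
  show "y \<oplus>\<^bsub>B\<^esub> w \<in> ?D"
    using DI[OF D(3)[OF ca(1) eb(1)] R.a_closed[OF ca(2) eb(2)]] cy cB[OF eb(1)] ca eb xc
    by (simp add: y w smult_l_distr M.a_ac)
qed

text \<open>By Zorn there is a maximal graded \<open>C\<close> inside \<open>M\<close> that meets
  \<open>N\<close> trivially. A homogeneous \<open>x\<close> of \<open>M\<close> outside
  \<open>C + N\<close> could be adjoined: if \<open>c + a x\<close> lies in \<open>N\<close> with
  \<open>a\<close> nonzero, dividing by \<open>a\<close> would put \<open>x\<close> into
  \<open>C + N\<close>. This contradicts maximality.\<close>

lemma graded_complement:
  assumes K: "field K" and N: "graded_submodule K B N" and M: "graded_submodule K B M" and NM: "N \<subseteq> M"
  obtains C where "graded_submodule K B C" "C \<subseteq> M" "C \<inter> N = {\<zero>\<^bsub>B\<^esub>}"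
    "\<And>x. x \<in> M \<Longrightarrow> \<exists>c\<in>C. \<exists>n\<in>N. x = c \<oplus>\<^bsub>B\<^esub> n"
proof -
  note DN = graded_submoduleD[OF N] and DM = graded_submoduleD[OF M]
  let ?F = "{C. graded_submodule K B C \<and> C \<subseteq> M \<and> C \<inter> N = {\<zero>\<^bsub>B\<^esub>}}"
  have "\<exists>C\<in>?F. \<forall>X\<in>?F. C \<subseteq> X \<longrightarrow> X = C"
  proof (rule subset_Zorn_nonempty)
    show "?F \<noteq> {}"
      using graded_submodule_zero DN(2) DM(2) by auto
    fix Q assume Q: "Q \<noteq> {}" "subset.chain ?F Q"
    then have "subset.chain {S. graded_submodule K B S} Q" by (auto simp: subset.chain_def)
    then have "graded_submodule K B (\<Union>Q)" by (rule graded_submodule_Union_chain[OF Q(1)])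
    moreover have "S \<subseteq> M" "S \<inter> N = {\<zero>\<^bsub>B\<^esub>}" if "S \<in> Q" for S
      using Q(2) that by (auto simp: subset.chain_def)
    ultimately show "\<Union>Q \<in> ?F" using Q(1) by blast
  qed
  then obtain C where C0: "C \<in> ?F" and max: "\<forall>X\<in>?F. C \<subseteq> X \<longrightarrow> X = C" by (rule bexE)
  have C: "graded_submodule K B C" "C \<subseteq> M" "C \<inter> N = {\<zero>\<^bsub>B\<^esub>}" using C0 by simp_all
  note DC = graded_submoduleD[OF C(1)]
  let ?S = "{c \<oplus>\<^bsub>B\<^esub> n | c n. c \<in> C \<and> n \<in> N}"
  have SI: "c \<oplus>\<^bsub>B\<^esub> n \<in> ?S" if "c \<in> C" "n \<in> N" for c n using that by blast
  \<comment> \<open>Adjoining keeps the grading only for homogeneous elements; a general element of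
    \<open>M\<close> is treated afterwards through its components.\<close>
  have homog: "x \<in> ?S" if xM: "x \<in> M" and x: "x \<in> grade B i" for x i
  proof (rule ccontr)
    assume xS: "x \<notin> ?S"
    have xc: "x \<in> carrier B" using x grade_carrier by blast
    let ?D = "{c \<oplus>\<^bsub>B\<^esub> a \<odot>\<^bsub>B\<^esub> x | c a. c \<in> C \<and> a \<in> carrier K}"
    have "?D \<inter> N = {\<zero>\<^bsub>B\<^esub>}"
    proof
      show "?D \<inter> N \<subseteq> {\<zero>\<^bsub>B\<^esub>}"
      proof
        fix y assume "y \<in> ?D \<inter> N"
        then obtain c a where y: "y = c \<oplus>\<^bsub>B\<^esub> a \<odot>\<^bsub>B\<^esub> x" "y \<in> N" and ca: "c \<in> C" "a \<in> carrier K" by blast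
        have cB: "c \<in> carrier B" and yB: "y \<in> carrier B" using DC(1) DN(1) ca y by auto
        have "a = \<zero>\<^bsub>K\<^esub>"
        proof (rule ccontr)
          assume "a \<noteq> \<zero>\<^bsub>K\<^esub>"
          then have u: "a \<in> Units K" using ca field.field_Units[OF K] by blast
          define b where "b = inv\<^bsub>K\<^esub> a"
          have b: "b \<in> carrier K" "b \<otimes>\<^bsub>K\<^esub> a = \<one>\<^bsub>K\<^esub>"
            using u by (simp_all add: b_def)
          have "x = b \<odot>\<^bsub>B\<^esub> (a \<odot>\<^bsub>B\<^esub> x)"
            using b ca xc by (simp add: smult_assoc1[symmetric])
          also have "a \<odot>\<^bsub>B\<^esub> x = \<ominus>\<^bsub>B\<^esub> c \<oplus>\<^bsub>B\<^esub> y"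
            using cB ca xc by (simp add: y(1) M.r_neg1)
          also have "b \<odot>\<^bsub>B\<^esub> (\<ominus>\<^bsub>B\<^esub> c \<oplus>\<^bsub>B\<^esub> y) = b \<odot>\<^bsub>B\<^esub> (\<ominus>\<^bsub>B\<^esub> c) \<oplus>\<^bsub>B\<^esub> b \<odot>\<^bsub>B\<^esub> y"
            using b cB yB by (simp add: smult_r_distr)
          finally have "x \<in> ?S"
            using SI[OF DC(5)[OF b(1) DC(4)[OF ca(1)]] DN(5)[OF b(1) y(2)]] by (simp only:)
          with xS show False by (rule notE)
        qed
        then have "y = c" using y cB xc by simp
        then show "y \<in> {\<zero>\<^bsub>B\<^esub>}" using y ca C(3) by blast
      qed
      have "\<zero>\<^bsub>B\<^esub> \<in> ?D"
        using DC(2) xc by (intro CollectI exI[of _ "\<zero>\<^bsub>B\<^esub>"] exI[of _ "\<zero>\<^bsub>K\<^esub>"]) simp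
      then show "{\<zero>\<^bsub>B\<^esub>} \<subseteq> ?D \<inter> N" using DN(2) by blast
    qed
    moreover have "?D \<subseteq> M"
      using DM(3,5) C(2) xM by blast
    ultimately have "?D \<in> ?F"
      using graded_submodule_adjoin[OF C(1) x] by blast
    moreover have "C \<subseteq> ?D"
    proof
      fix c assume "c \<in> C"
      then show "c \<in> ?D"
        using DC(1) xc by (intro CollectI exI[of _ c] exI[of _ "\<zero>\<^bsub>K\<^esub>"]) auto
    qed
    ultimately have "?D = C" using max by (meson bspec)
    moreover have "x \<in> ?D"
      using DC(2) xc by (intro CollectI exI[of _ "\<zero>\<^bsub>B\<^esub>"] exI[of _ "\<one>\<^bsub>K\<^esub>"]) simp
    ultimately have "x \<in> C" by (simp only:)
    from SI[OF this DN(2)] have "x \<in> ?S" using xc by (simp only: M.r_zero)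
    with xS show False by (rule notE)
  qed
  have Sadd: "x \<oplus>\<^bsub>B\<^esub> y \<in> ?S" if "x \<in> ?S" "y \<in> ?S" for x y
  proof -
    from that(1) obtain c n where x: "x = c \<oplus>\<^bsub>B\<^esub> n" and cn: "c \<in> C" "n \<in> N" by blast
    from that(2) obtain e p where y: "y = e \<oplus>\<^bsub>B\<^esub> p" and ep: "e \<in> C" "p \<in> N" by blast
    note * = cn(1) cn(2) ep(1) ep(2)
    have "x \<oplus>\<^bsub>B\<^esub> y = (c \<oplus>\<^bsub>B\<^esub> e) \<oplus>\<^bsub>B\<^esub> (n \<oplus>\<^bsub>B\<^esub> p)"
      using subsetD[OF DC(1)] subsetD[OF DN(1)] * by (simp add: x y M.a_ac)
    then show ?thesis using SI[OF DC(3)[OF *(1,3)] DN(3)[OF *(2,4)]] by (simp only:)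
  qed
  have "x \<in> ?S" if x: "x \<in> M" for x
  proof -
    have xB: "x \<in> carrier B" using x DM(1) by blast
    have "finsum B (component B x) F \<in> ?S" if "finite F" for F
      using that
    proof (induction F)
      case empty
      show ?case using SI[OF DC(2) DN(2)] by simp
    next
      case (insert k F)
      have "component B x k \<in> ?S" by (rule homog[OF DM(6)[OF x] component_grade[OF xB]])
      then show ?case using insert Sadd xB by (subst M.finsum_insert) auto
    qed
    from this[OF component_finite[OF xB]] show ?thesis
      by (simp only: component_sum[OF xB component_finite[OF xB] order_refl, symmetric])
  qed
  then have "\<exists>c\<in>C. \<exists>n\<in>N. x = c \<oplus>\<^bsub>B\<^esub> n" if "x \<in> M" for x
    using that by blast
  then show thesis by (rule that[OF C])
qed

end

context dgca
begin

lemma graded_submodule_cocycles: "graded_submodule K A (cocycles A)"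
  by (rule graded_submoduleI)
    (auto simp: cocycle_closed cocycle_zero cocycle_add cocycle_neg cocycle_smult cocycle_component)

lemma graded_submodule_coboundaries: "graded_submodule K A (coboundaries A)"
proof (rule graded_submoduleI)
  have I: "d x \<in> coboundaries A" if "x \<in> carrier A" for x using that by (simp add: coboundaries_def)
  show "coboundaries A \<subseteq> carrier A" by (auto simp: coboundaries_def)
  show "\<zero>\<^bsub>A\<^esub> \<in> coboundaries A" using I[OF M.zero_closed] by (simp add: d_zero)
  fix x assume "x \<in> coboundaries A"
  then obtain u where u: "u \<in> carrier A" "x = d u" by (auto simp: coboundaries_def)
  show "\<ominus>\<^bsub>A\<^esub> x \<in> coboundaries A" using I[of "\<ominus>\<^bsub>A\<^esub> u"] u by (simp add: d_neg)
  show "a \<odot>\<^bsub>A\<^esub> x \<in> coboundaries A" if "a \<in> carrier K" for a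
    using I[of "a \<odot>\<^bsub>A\<^esub> u"] u that by (simp add: d_smult)
  show "component A x k \<in> coboundaries A" for k
    using I[of "component A u (k - 1)"] u d_component[of u "k - 1"] by simp
  fix y assume "y \<in> coboundaries A"
  then obtain v where v: "v \<in> carrier A" "y = d v" by (auto simp: coboundaries_def)
  show "x \<oplus>\<^bsub>A\<^esub> y \<in> coboundaries A" using I[of "u \<oplus>\<^bsub>A\<^esub> v"] u v by (simp add: d_add)
qed

lemma graded_submodule_carrier: "graded_submodule K A (carrier A)"
  by (rule graded_submoduleI) auto

text \<open>A linear right inverse of \<open>d\<close> of degree -1, with conditions on coboundaries
  only. Thus a Hodge homotopy qualifies, and so does the partial inverse obtained from a complement
  of the cocycles.\<close>

definition is_primitive_map :: "('a \<Rightarrow> 'a) \<Rightarrow> bool" where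
  "is_primitive_map s \<longleftrightarrow>
    (\<forall>x\<in>coboundaries A. s x \<in> carrier A \<and> d (s x) = x) \<and>
    (\<forall>x\<in>coboundaries A. \<forall>y\<in>coboundaries A. s (x \<oplus>\<^bsub>A\<^esub> y) = s x \<oplus>\<^bsub>A\<^esub> s y) \<and>
    (\<forall>a\<in>carrier K. \<forall>x\<in>coboundaries A. s (a \<odot>\<^bsub>A\<^esub> x) = a \<odot>\<^bsub>A\<^esub> s x) \<and>
    (\<forall>k. \<forall>x\<in>coboundaries A \<inter> grade A k. s x \<in> grade A (k - 1))"

text \<open>On a graded complement \<open>C\<close> of the cocycles the differential is injective,
  and its image is all of the coboundaries; the map is the inverse.\<close>

lemma ex_primitive_map:
  assumes K: "field K"
  shows "\<exists>s. is_primitive_map s"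
proof -
  obtain C where C: "graded_submodule K A C" "C \<subseteq> carrier A" "C \<inter> cocycles A = {\<zero>\<^bsub>A\<^esub>}"
    and dec: "\<And>x. x \<in> carrier A \<Longrightarrow> \<exists>c\<in>C. \<exists>n\<in>cocycles A. x = c \<oplus>\<^bsub>A\<^esub> n"
    by (rule graded_complement[OF K graded_submodule_cocycles graded_submodule_carrier])
      (auto simp: cocycle_closed)
  note DC = graded_submoduleD[OF C(1)]
  have CA: "c \<in> carrier A" if "c \<in> C" for c using that C(2) by blast
  have uniq: "c = c'" if "c \<in> C" "c' \<in> C" "d c = d c'" for c c'
  proof -
    have "c \<ominus>\<^bsub>A\<^esub> c' \<in> C \<inter> cocycles A"
      using that DC(3,4) CA by (simp add: a_minus_def cocycles_def d_add d_neg M.r_neg)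
    then show ?thesis using C(3) CA that M.minus_eq_zero_iff by blast
  qed
  have ex: "\<exists>c. c \<in> C \<and> d c = x" if xB: "x \<in> coboundaries A" for x
  proof -
    obtain u where u: "u \<in> carrier A" "x = d u" using xB by (auto simp: coboundaries_def)
    obtain c n where c: "c \<in> C" and n: "n \<in> cocycles A" "u = c \<oplus>\<^bsub>A\<^esub> n" using dec[OF u(1)] by blast
    have "d c = x" using CA[OF c] n by (simp add: u(2) d_add cocycle_d cocycle_closed)
    then show ?thesis using c by blast
  qed
  define s where "s x = (SOME c. c \<in> C \<and> d c = x)" for x
  have s: "s x \<in> C" "d (s x) = x" if "x \<in> coboundaries A" for x
    using someI_ex[OF ex[OF that]] by (simp_all add: s_def)
  \<comment> \<open>Because the chosen primitive is unique in \<open>C\<close>, the choice is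
    automatically linear and graded: each candidate only has to lie in \<open>C\<close> and have the
    right differential.\<close>
  have eq: "s x = c" if "x \<in> coboundaries A" "c \<in> C" "d c = x" for x c
    using uniq s that by simp
  note DB = graded_submoduleD[OF graded_submodule_coboundaries]
  have "s (x \<oplus>\<^bsub>A\<^esub> y) = s x \<oplus>\<^bsub>A\<^esub> s y" if "x \<in> coboundaries A" "y \<in> coboundaries A" for x y
    using that by (intro eq DB DC s) (auto simp: d_add s CA)
  moreover have "s (a \<odot>\<^bsub>A\<^esub> x) = a \<odot>\<^bsub>A\<^esub> s x" if "a \<in> carrier K" "x \<in> coboundaries A" for a x
    using that by (intro eq DB DC s) (auto simp: d_smult s CA)
  moreover have "s x \<in> grade A (k - 1)" if "x \<in> coboundaries A" "x \<in> grade A k" for x k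
  proof -
    \<comment> \<open>This component lies in \<open>C\<close> and has the same differential as
      \<open>s x\<close>, so uniqueness applies.\<close>
    have "s x = component A (s x) (k - 1)"
      using that d_component[OF CA[OF s(1)[OF that(1)]], of "k - 1"]
      by (intro eq DC s) (simp_all add: s(2) component_homogeneous)
    then show ?thesis using component_grade[OF CA[OF s(1)[OF that(1)]]] by metis
  qed
  ultimately show ?thesis
    unfolding is_primitive_map_def using s CA by (intro exI[of _ s]) blast
qed

text \<open>A graded complement of the coboundaries in the cocycles contains exactly one
  representative of each class; as before, uniqueness makes the choice linear and graded.\<close>

lemma ex_representatives:
  assumes K: "field K"
  shows "\<exists>r. linear_map K HA A r \<and> (\<forall>k. \<forall>X\<in>grade HA k. r X \<in> grade A k) \<and>
    (\<forall>X\<in>carrier HA. r X \<in> cocycles A \<and> cls (r X) = X)"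
proof -
  obtain C where C: "graded_submodule K A C" "C \<subseteq> cocycles A" "C \<inter> coboundaries A = {\<zero>\<^bsub>A\<^esub>}"
    and dec: "\<And>x. x \<in> cocycles A \<Longrightarrow> \<exists>c\<in>C. \<exists>n\<in>coboundaries A. x = c \<oplus>\<^bsub>A\<^esub> n"
    by (rule graded_complement[OF K graded_submodule_coboundaries graded_submodule_cocycles])
      (auto simp: coboundaries_def coboundary_cocycle)
  note DC = graded_submoduleD[OF C(1)]
  have CZ: "c \<in> cocycles A" if "c \<in> C" for c using that C(2) by blast
  have CA: "c \<in> carrier A" if "c \<in> C" for c using that CZ cocycle_closed by blast
  have uniq: "c = c'" if cc': "c \<in> C" "c' \<in> C" "cls c = cls c'" for c c'
  proof -
    obtain u where u: "u \<in> carrier A" "c = c' \<oplus>\<^bsub>A\<^esub> d u"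
      using cc' CA cls_eq_iff by meson
    have "c \<ominus>\<^bsub>A\<^esub> c' = d u"
      using CA[OF cc'(2)] d_closed[OF u(1)] unfolding u(2) by algebra
    then have "c \<ominus>\<^bsub>A\<^esub> c' \<in> coboundaries A"
      using u(1) by (auto simp: coboundaries_def)
    moreover have "c \<ominus>\<^bsub>A\<^esub> c' \<in> C"
      using cc' DC(3,4) by (simp add: a_minus_def)
    ultimately have "c \<ominus>\<^bsub>A\<^esub> c' \<in> C \<inter> coboundaries A" by blast
    then show ?thesis using C(3) CA that M.minus_eq_zero_iff by blast
  qed
  have ex: "\<exists>c. c \<in> C \<and> cls c = X" if X: "X \<in> carrier HA" for X
  proof -
    obtain x where x: "x \<in> cocycles A" "X = cls x" using X by (rule cohomology_cases)
    obtain c n where c: "c \<in> C" and n: "n \<in> coboundaries A" "x = c \<oplus>\<^bsub>A\<^esub> n" using dec[OF x(1)] by blast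
    obtain u where u: "u \<in> carrier A" "n = d u" using n(1) by (auto simp: coboundaries_def)
    have "cls x = cls c" using CA[OF c] u n by (intro cls_eqI[of _ u]) simp_all
    then show ?thesis using c x by blast
  qed
  define r where "r X = (SOME c. c \<in> C \<and> cls c = X)" for X
  have r: "r X \<in> C" "cls (r X) = X" if "X \<in> carrier HA" for X
    using someI_ex[OF ex[OF that]] by (simp_all add: r_def)
  have eq: "r X = c" if "X \<in> carrier HA" "c \<in> C" "cls c = X" for X c
    using uniq r that by simp
  interpret H: gca K HA by (rule gca_cohomology)
  have "linear_map K HA A r"
  proof (rule linear_mapI)
    show "r X \<in> carrier A" if "X \<in> carrier HA" for X using r CA that by blast
    show "r (X \<oplus>\<^bsub>HA\<^esub> Y) = r X \<oplus>\<^bsub>A\<^esub> r Y" if "X \<in> carrier HA" "Y \<in> carrier HA" for X Y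
      using that by (intro eq DC r) (auto simp: cls_add[symmetric] r CZ)
    show "r (a \<odot>\<^bsub>HA\<^esub> X) = a \<odot>\<^bsub>A\<^esub> r X" if "a \<in> carrier K" "X \<in> carrier HA" for a X
      using that by (intro eq DC r) (auto simp: cls_smult[symmetric] r CZ)
  qed
  moreover have "r X \<in> grade A k" if X: "X \<in> grade HA k" for X k
  proof -
    have XH: "X \<in> carrier HA" using X H.grade_carrier by blast
    have "r X = component A (r X) k"
      using XH component_cls[OF CZ[OF r(1)[OF XH]], of k] H.component_homogeneous[OF X]
      by (intro eq DC r) (simp_all add: r(2))
    then show ?thesis using component_grade[OF CA[OF r(1)[OF XH]]] by metis
  qed
  ultimately show ?thesis using r CZ by (intro exI[of _ r]) blast
qed

end

section \<open>Harrison classes under isomorphisms\<close>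

lemma gca_homD:
  assumes "gca_hom K B C f"
  shows "linear_map K B C f" "x \<in> carrier B \<Longrightarrow> f x \<in> carrier C"
    "x \<in> carrier B \<Longrightarrow> y \<in> carrier B \<Longrightarrow> f (x \<otimes>\<^bsub>B\<^esub> y) = f x \<otimes>\<^bsub>C\<^esub> f y"
    "f \<one>\<^bsub>B\<^esub> = \<one>\<^bsub>C\<^esub>" "x \<in> grade B k \<Longrightarrow> f x \<in> grade C k"
proof -
  show "linear_map K B C f" using assms by (simp add: gca_hom_def)
  show "x \<in> grade B k \<Longrightarrow> f x \<in> grade C k" using assms unfolding gca_hom_def by blast
qed (use assms in \<open>auto simp: gca_hom_def ring_hom_def\<close>)

lemma gca_homI:
  assumes "linear_map K B C f"
    "\<And>x y. x \<in> carrier B \<Longrightarrow> y \<in> carrier B \<Longrightarrow> f (x \<otimes>\<^bsub>B\<^esub> y) = f x \<otimes>\<^bsub>C\<^esub> f y"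
    "f \<one>\<^bsub>B\<^esub> = \<one>\<^bsub>C\<^esub>" "\<And>x k. x \<in> grade B k \<Longrightarrow> f x \<in> grade C k"
  shows "gca_hom K B C f"
  using assms unfolding gca_hom_def by (auto simp: linear_map_def ring_hom_def)

lemma gca_isoD: "gca_iso K B C f \<Longrightarrow> gca_hom K B C f" "gca_iso K B C f \<Longrightarrow> bij_betw f (carrier B) (carrier C)"
  by (simp_all add: gca_iso_def)

lemma gca_iso_id: "gca_iso K B B (\<lambda>x. x)"
  by (auto simp: gca_iso_def gca_hom_def linear_map_def ring_hom_def bij_betw_def)

lemma linear_map_compose:
  "linear_map K B C f \<Longrightarrow> linear_map K C D g \<Longrightarrow> linear_map K B D (\<lambda>x. g (f x))"
  by (rule linear_mapI) (simp_all add: linear_map_closed linear_map_add linear_map_smult)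

lemma gca_iso_compose:
  assumes "gca_iso K B C f" "gca_iso K C D g"
  shows "gca_iso K B D (\<lambda>x. g (f x))"
proof -
  note f = gca_homD[OF gca_isoD(1)[OF assms(1)]] and g = gca_homD[OF gca_isoD(1)[OF assms(2)]]
  have "bij_betw (g \<circ> f) (carrier B) (carrier D)"
    by (rule bij_betw_trans[OF gca_isoD(2)[OF assms(1)] gca_isoD(2)[OF assms(2)]])
  then have "bij_betw (\<lambda>x. g (f x)) (carrier B) (carrier D)" by (simp add: comp_def)
  moreover have "gca_hom K B D (\<lambda>x. g (f x))"
    by (rule gca_homI) (simp_all add: linear_map_compose[OF f(1) g(1)] f g)
  ultimately show ?thesis by (simp add: gca_iso_def)
qed

lemma gca_iso_inverse:
  assumes "gca K B" "gca K C" "gca_iso K B C f"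
  shows "gca_iso K C B (inv_into (carrier B) f)"
proof -
  interpret B: gca K B by fact
  interpret C: gca K C by fact
  note f = gca_homD[OF gca_isoD(1)[OF assms(3)]]
  note bij = gca_isoD(2)[OF assms(3)]
  let ?g = "inv_into (carrier B) f"
  have g: "?g y \<in> carrier B" "f (?g y) = y" if "y \<in> carrier C" for y
    using that bij inv_into_into[of y f "carrier B"] f_inv_into_f[of y f "carrier B"] by (auto simp: bij_betw_def)
  have eq: "?g y = x" if "x \<in> carrier B" "y = f x" for x y
    using that bij inv_into_f_f[of f "carrier B" x] by (simp add: bij_betw_def)
  have "linear_map K C B ?g"
    by (rule linear_mapI; (rule g | rule eq); simp add: g linear_map_add[OF f(1)] linear_map_smult[OF f(1)])
  moreover have "?g (x \<otimes>\<^bsub>C\<^esub> y) = ?g x \<otimes>\<^bsub>B\<^esub> ?g y" if "x \<in> carrier C" "y \<in> carrier C" for x y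
    using that by (intro eq) (simp_all add: g f)
  moreover have "?g \<one>\<^bsub>C\<^esub> = \<one>\<^bsub>B\<^esub>"
    by (intro eq) (simp_all add: f)
  moreover have "?g y \<in> grade B k" if y: "y \<in> grade C k" for y k
  proof -
    have yc: "y \<in> carrier C" using y C.grade_carrier by blast
    \<comment> \<open>For homogeneous \<open>y\<close> the right side is \<open>y\<close> itself;
      injectivity of \<open>f\<close> then makes the preimage homogeneous of the same
      degree.\<close>
    have "f (component B (?g y) k) = component C y k"
      using gca_degree_map_component[OF assms(1,2) f(1), of 0 "?g y" k] f(5) g[OF yc] by simp
    then have "?g y = component B (?g y) k"
      using g[OF yc] y by (intro eq) (simp_all add: C.component_homogeneous)
    then show ?thesis using B.component_grade[OF g(1)[OF yc]] by metis
  qed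
  ultimately have "gca_hom K C B ?g" by (intro gca_homI)
  then show ?thesis using bij by (simp add: gca_iso_def bij_betw_inv_into)
qed

lemma CHoch2D:
  assumes "f \<in> CHoch K B 2 q"
  shows "f \<in> extensional (tuples B 2)" "f \<in> tuples B 2 \<rightarrow> carrier B"
    "\<And>a b. a \<in> carrier B \<Longrightarrow> b \<in> carrier B \<Longrightarrow> f [a, b] \<in> carrier B"
    "\<And>b. gca K B \<Longrightarrow> b \<in> carrier B \<Longrightarrow> linear_map K B B (\<lambda>a. f [a, b])"
    "\<And>a. a \<in> carrier B \<Longrightarrow> linear_map K B B (\<lambda>b. f [a, b])"
    "\<And>a b i j. gca K B \<Longrightarrow> a \<in> grade B i \<Longrightarrow> b \<in> grade B j \<Longrightarrow> f [a, b] \<in> grade B (i + j + q)"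
proof -
  show f: "f \<in> extensional (tuples B 2)" "f \<in> tuples B 2 \<rightarrow> carrier B"
    using assms by (auto simp: CHoch_def PiE_def)
  show "f [a, b] \<in> carrier B" if "a \<in> carrier B" "b \<in> carrier B" for a b
    using f(2) that by (auto simp: tuples_def)
  have l: "linear_map K B B (\<lambda>x. f ([a, b][i := x]))" if "a \<in> carrier B" "b \<in> carrier B" "i < 2" for a b i
  proof -
    have "[a, b] \<in> tuples B 2" using that by (simp add: tuples_def)
    then show ?thesis using assms that(3) unfolding CHoch_def by blast
  qed
  show "linear_map K B B (\<lambda>a. f [a, b])" if "b \<in> carrier B" for b
    \<comment> \<open>The entry at position 0 is overwritten, so \<open>b\<close> is a mere
      placeholder there.\<close>
    using l[of b b 0] that by simp
  show "linear_map K B B (\<lambda>b. f [a, b])" if "a \<in> carrier B" for a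
    using l[of a a 1] that by simp
  show "f [a, b] \<in> grade B (i + j + q)" if "gca K B" "a \<in> grade B i" "b \<in> grade B j" for a b i j
  proof -
    have "[a, b] \<in> tuples B 2" "homogeneous_of B [a, b] [i, j]"
      using that gca.grade_carrier by (fastforce simp: tuples_def homogeneous_of_def)+
    then have "f [a, b] \<in> grade B (sum_list [i, j] + q)"
      using assms unfolding CHoch_def by blast
    then show ?thesis by (simp add: add.assoc)
  qed
qed

lemma extensional2_eqI:
  assumes "f \<in> extensional (tuples B 2)" "\<And>a b. a \<in> carrier B \<Longrightarrow> b \<in> carrier B \<Longrightarrow> f [a, b] = F a b"
  shows "f = (\<lambda>xs\<in>tuples B 2. F (xs ! 0) (xs ! 1))"
proof (rule extensionalityI[OF assms(1)])
  show "f xs = (\<lambda>xs\<in>tuples B 2. F (xs ! 0) (xs ! 1)) xs" if "xs \<in> tuples B 2" for xs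
    using that assms(2) by (auto simp: tuples2_iff)
qed simp

context gca
begin

lemma CHarr2_add:
  assumes f: "f \<in> CHarr K B 2 q" and g: "g \<in> CHarr K B 2 q"
  shows "(\<lambda>xs\<in>tuples B 2. f xs \<oplus>\<^bsub>B\<^esub> g xs) \<in> CHarr K B 2 q" (is "?h \<in> _")
proof -
  have F: "f \<in> CHoch K B 2 q" and G: "g \<in> CHoch K B 2 q" using f g by (simp_all add: CHarr2_iff)
  note DF = CHoch2D[OF F] and DG = CHoch2D[OF G]
  have h: "?h = (\<lambda>xs\<in>tuples B 2. f [xs ! 0, xs ! 1] \<oplus>\<^bsub>B\<^esub> g [xs ! 0, xs ! 1])"
    by (rule extensional2_eqI[OF restrict_extensional]) simp
  have "?h \<in> CHoch K B 2 q"
    unfolding h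
  proof (rule CHoch2I)
    fix b assume b: "b \<in> carrier B"
    note l = linear_map_add[OF DF(4)[OF gca_axioms b]] linear_map_add[OF DG(4)[OF gca_axioms b]]
      linear_map_smult[OF DF(4)[OF gca_axioms b]] linear_map_smult[OF DG(4)[OF gca_axioms b]]
    show "linear_map K B B (\<lambda>a. f [a, b] \<oplus>\<^bsub>B\<^esub> g [a, b])"
      by (rule linear_mapI) (simp_all add: b DF(3) DG(3) l smult_r_distr M.a_ac)
  next
    fix a assume a: "a \<in> carrier B"
    note l = linear_map_add[OF DF(5)[OF a]] linear_map_add[OF DG(5)[OF a]]
      linear_map_smult[OF DF(5)[OF a]] linear_map_smult[OF DG(5)[OF a]]
    show "linear_map K B B (\<lambda>b. f [a, b] \<oplus>\<^bsub>B\<^esub> g [a, b])"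
      by (rule linear_mapI) (simp_all add: a DF(3) DG(3) l smult_r_distr M.a_ac)
  next
    fix a b i j assume "a \<in> grade B i" "b \<in> grade B j"
    then show "f [a, b] \<oplus>\<^bsub>B\<^esub> g [a, b] \<in> grade B (i + j + q)"
      using DF(6) DG(6) gca_axioms by (intro grade_add) auto
  qed
  moreover have "?h [a, b] = [parity_sign (i * j)] \<cdot>\<^bsub>B\<^esub> ?h [b, a]"
    if ab: "a \<in> grade B i" "b \<in> grade B j" for a b i j
  proof -
    have cl: "a \<in> carrier B" "b \<in> carrier B" using ab grade_carrier by auto
    have "f [a, b] = [parity_sign (i * j)] \<cdot>\<^bsub>B\<^esub> f [b, a]" "g [a, b] = [parity_sign (i * j)] \<cdot>\<^bsub>B\<^esub> g [b, a]"
      using f g ab unfolding CHarr2_iff by blast+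
    then show ?thesis
      using cl DF(3)[OF cl(2,1)] DG(3)[OF cl(2,1)]
      by (simp add: M.parity_pow M.minus_add split del: if_split) (simp add: M.minus_add)
  qed
  ultimately show ?thesis unfolding CHarr2_iff by blast
qed

lemma hoch_diff2_add:
  assumes f: "f \<in> tuples B 2 \<rightarrow> carrier B" and g: "g \<in> tuples B 2 \<rightarrow> carrier B" and xs: "xs \<in> tuples B 3"
  shows "hoch_diff B 2 (- 1) (\<lambda>xs\<in>tuples B 2. f xs \<oplus>\<^bsub>B\<^esub> g xs) xs
    = hoch_diff B 2 (- 1) f xs \<oplus>\<^bsub>B\<^esub> hoch_diff B 2 (- 1) g xs"
proof -
  obtain a b c where x: "xs = [a, b, c]" and cl: "a \<in> carrier B" "b \<in> carrier B" "c \<in> carrier B"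
    using xs by (auto simp: tuples3_iff)
  have F: "f [p, q] \<in> carrier B" "g [p, q] \<in> carrier B" if "p \<in> carrier B" "q \<in> carrier B" for p q
    using f g that by auto
  have h: "(\<lambda>xs\<in>tuples B 2. f xs \<oplus>\<^bsub>B\<^esub> g xs) \<in> tuples B 2 \<rightarrow> carrier B"
    using f g by auto
  have R: "(t \<oplus>\<^bsub>B\<^esub> t') \<oplus>\<^bsub>B\<^esub> (\<ominus>\<^bsub>B\<^esub> (p \<oplus>\<^bsub>B\<^esub> p') \<oplus>\<^bsub>B\<^esub> (q \<oplus>\<^bsub>B\<^esub> q')) \<ominus>\<^bsub>B\<^esub> (r \<oplus>\<^bsub>B\<^esub> r')
      = (t \<oplus>\<^bsub>B\<^esub> (\<ominus>\<^bsub>B\<^esub> p \<oplus>\<^bsub>B\<^esub> q) \<ominus>\<^bsub>B\<^esub> r) \<oplus>\<^bsub>B\<^esub> (t' \<oplus>\<^bsub>B\<^esub> (\<ominus>\<^bsub>B\<^esub> p' \<oplus>\<^bsub>B\<^esub> q') \<ominus>\<^bsub>B\<^esub> r')"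
    if "t \<in> carrier B" "t' \<in> carrier B" "p \<in> carrier B" "p' \<in> carrier B" "q \<in> carrier B" "q' \<in> carrier B"
      "r \<in> carrier B" "r' \<in> carrier B" for t t' p p' q q' r r'
    using that by algebra
  show ?thesis
    unfolding x hoch_diff2[OF h cl] hoch_diff2[OF f cl] hoch_diff2[OF g cl]
    using cl F by (subst R[symmetric]) (simp_all add: l_distr r_distr)
qed

end

lemma harr_coboundaries3: "harr_coboundaries K B 3 q = hoch_diff B 2 q ` CHarr K B 2 q"
  by (simp add: harr_coboundaries_def)

text \<open>If \<open>f\<close> is \<open>t\<close> plus the differential of \<open>g\<close>, then
  adding the differential of \<open>h\<close> to \<open>f\<close> amounts to adding that of
  \<open>g + h\<close> to \<open>t\<close>. The other inclusion is later obtained by exchanging the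
  two models.\<close>

lemma harr_class_subset:
  assumes "gca K B" and t: "t \<in> tuples B 3 \<rightarrow> carrier B"
    and f: "g \<in> CHarr K B 2 (- 1)" "f = (\<lambda>xs\<in>tuples B 3. t xs \<oplus>\<^bsub>B\<^esub> hoch_diff B 2 (- 1) g xs)"
  shows "harr_class K B 3 (- 1) f \<subseteq> harr_class K B 3 (- 1) t"
proof
  interpret gca K B by fact
  fix x assume "x \<in> harr_class K B 3 (- 1) f"
  then obtain h where h: "h \<in> CHarr K B 2 (- 1)" "x = (\<lambda>xs\<in>tuples B 3. f xs \<oplus>\<^bsub>B\<^esub> hoch_diff B 2 (- 1) h xs)"
    unfolding harr_class_def harr_coboundaries3 by blast
  let ?k = "\<lambda>xs\<in>tuples B 2. g xs \<oplus>\<^bsub>B\<^esub> h xs"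
  have k: "?k \<in> CHarr K B 2 (- 1)" by (rule CHarr2_add[OF f(1) h(1)])
  have G: "g \<in> tuples B 2 \<rightarrow> carrier B" and H: "h \<in> tuples B 2 \<rightarrow> carrier B"
    using f(1) h(1) by (auto simp: CHarr_def CHoch_def)
  note D = hoch_diff2_closed
  have "x = (\<lambda>xs\<in>tuples B 3. t xs \<oplus>\<^bsub>B\<^esub> hoch_diff B 2 (- 1) ?k xs)"
    unfolding h(2)
  proof (rule restrict_ext)
    fix xs assume xs: "xs \<in> tuples B 3"
    then show "f xs \<oplus>\<^bsub>B\<^esub> hoch_diff B 2 (- 1) h xs = t xs \<oplus>\<^bsub>B\<^esub> hoch_diff B 2 (- 1) ?k xs"
      using t D[OF G xs] D[OF H xs] unfolding hoch_diff2_add[OF G H xs] f(2)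
      by (simp add: M.a_assoc Pi_iff)
  qed
  then show "x \<in> harr_class K B 3 (- 1) t"
    unfolding harr_class_def harr_coboundaries3 using k by blast
qed

lemma transport_CHarr2:
  assumes "gca K B" "gca K C" and phi: "gca_iso K B C \<phi>" and g: "g \<in> CHarr K B 2 q"
  shows "cochain_transport B C \<phi> 2 g \<in> CHarr K C 2 q"
proof -
  interpret B: gca K B by fact
  interpret C: gca K C by fact
  note P = gca_homD[OF gca_isoD(1)[OF phi]]
  let ?s = "inv_into (carrier B) \<phi>"
  note S = gca_homD[OF gca_isoD(1)[OF gca_iso_inverse[OF assms(1,2) phi]]]
  have G: "g \<in> CHoch K B 2 q" using g by (simp add: B.CHarr2_iff)
  note DG = CHoch2D[OF G]
  let ?t = "cochain_transport B C \<phi> 2 g"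
  have t: "?t = (\<lambda>xs\<in>tuples C 2. \<phi> (g [?s (xs ! 0), ?s (xs ! 1)]))"
    unfolding cochain_transport_def by (rule extensional2_eqI[OF restrict_extensional]) simp
  have te: "?t [a, b] = \<phi> (g [?s a, ?s b])" if "a \<in> carrier C" "b \<in> carrier C" for a b
    using that by (simp add: t)
  have "?t \<in> CHoch K C 2 q"
    unfolding t
  proof (rule C.CHoch2I)
    show "linear_map K C C (\<lambda>a. \<phi> (g [?s a, ?s b]))" if "b \<in> carrier C" for b
      using linear_map_compose[OF linear_map_compose[OF S(1) DG(4)[OF assms(1) S(2)[OF that]]] P(1)] .
    show "linear_map K C C (\<lambda>b. \<phi> (g [?s a, ?s b]))" if "a \<in> carrier C" for a
      using linear_map_compose[OF linear_map_compose[OF S(1) DG(5)[OF S(2)[OF that]]] P(1)] .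
    show "\<phi> (g [?s a, ?s b]) \<in> grade C (i + j + q)" if "a \<in> grade C i" "b \<in> grade C j" for a b i j
      by (rule P(5)[OF DG(6)[OF assms(1) S(5)[OF that(1)] S(5)[OF that(2)]]])
  qed
  moreover have "?t [a, b] = [parity_sign (i * j)] \<cdot>\<^bsub>C\<^esub> ?t [b, a]"
    if ab: "a \<in> grade C i" "b \<in> grade C j" for a b i j
  proof -
    have cl: "a \<in> carrier C" "b \<in> carrier C" using ab C.grade_carrier by auto
    have "g [?s a, ?s b] = [parity_sign (i * j)] \<cdot>\<^bsub>B\<^esub> g [?s b, ?s a]"
      using g S(5)[OF ab(1)] S(5)[OF ab(2)] unfolding B.CHarr2_iff by blast
    then have "?t [a, b] = \<phi> ([parity_sign (i * j)] \<cdot>\<^bsub>B\<^esub> g [?s b, ?s a])" using te[OF cl] by simp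
    then show ?thesis
      using te[OF cl(2,1)] DG(3)[OF S(2)[OF cl(2)] S(2)[OF cl(1)]] P(2)
        linear_map_neg[OF P(1) B.abgrp C.abgrp]
      by (simp add: B.M.parity_pow C.M.parity_pow)
  qed
  ultimately show ?thesis unfolding C.CHarr2_iff by blast
qed

text \<open>The Hochschild differential is built from products, sums and the twist, and an
  isomorphism of graded algebras commutes with all of these.\<close>

lemma transport_hoch_diff2:
  assumes "gca K B" "gca K C" and phi: "gca_iso K B C \<phi>" and g: "g \<in> tuples B 2 \<rightarrow> carrier B"
  shows "cochain_transport B C \<phi> 3 (hoch_diff B 2 (- 1) g) = hoch_diff C 2 (- 1) (cochain_transport B C \<phi> 2 g)"
proof -
  interpret B: gca K B by fact
  interpret C: gca K C by fact
  note P = gca_homD[OF gca_isoD(1)[OF phi]]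
  let ?s = "inv_into (carrier B) \<phi>"
  note S = gca_homD[OF gca_isoD(1)[OF gca_iso_inverse[OF assms(1,2) phi]]]
  have ps: "\<phi> (?s y) = y" if "y \<in> carrier C" for y
    using that gca_isoD(2)[OF phi] f_inv_into_f[of y \<phi> "carrier B"] by (auto simp: bij_betw_def)
  have gc: "g [p, q] \<in> carrier B" if "p \<in> carrier B" "q \<in> carrier B" for p q
    using g that by auto
  let ?t = "cochain_transport B C \<phi> 2 g"
  have te: "?t [a, b] = \<phi> (g [?s a, ?s b])" if "a \<in> carrier C" "b \<in> carrier C" for a b
    using that by (simp add: cochain_transport_def)
  have tc: "?t \<in> tuples C 2 \<rightarrow> carrier C"
    using S(2) P(2) gc by (auto simp: tuples2_iff te)
  have tw: "\<phi> (sign_twist B 1 (?s a)) = sign_twist C 1 a" if "a \<in> carrier C" for a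
    using gca_degree_map_twist[OF assms(1,2) P(1), of 0 "?s a"] P S that by (simp add: ps C.M.parity_pow)
  show ?thesis
  proof (rule extensionalityI[of _ "tuples C 3"])
    show "cochain_transport B C \<phi> 3 (hoch_diff B 2 (- 1) g) \<in> extensional (tuples C 3)"
      by (simp add: cochain_transport_def)
    show "hoch_diff C 2 (- 1) ?t \<in> extensional (tuples C 3)"
      by (simp add: hoch_diff_def numeral_3_eq_3 numeral_2_eq_2)
    fix xs assume "xs \<in> tuples C 3"
    then obtain a b c where x: "xs = [a, b, c]" and cl: "a \<in> carrier C" "b \<in> carrier C" "c \<in> carrier C"
      by (auto simp: tuples3_iff)
    have "cochain_transport B C \<phi> 3 (hoch_diff B 2 (- 1) g) xs = \<phi> (hoch_diff B 2 (- 1) g [?s a, ?s b, ?s c])"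
      using cl by (simp add: x cochain_transport_def)
    also have "\<dots> = hoch_diff C 2 (- 1) ?t xs"
      unfolding x C.hoch_diff2[OF tc cl] B.hoch_diff2[OF g S(2)[OF cl(1)] S(2)[OF cl(2)] S(2)[OF cl(3)]]
      using cl gc S(2)
      by (simp add: te P(2,3) S(3) tw ps linear_map_add[OF P(1)] linear_map_neg[OF P(1) B.abgrp C.abgrp]
          linear_map_diff[OF P(1) B.abgrp C.abgrp])
    finally show "cochain_transport B C \<phi> 3 (hoch_diff B 2 (- 1) g) xs = hoch_diff C 2 (- 1) ?t xs" .
  qed
qed

lemma HHarr_map_harr_class:
  assumes "gca K B" "gca K C" and phi: "gca_iso K B C \<phi>" and t: "t \<in> tuples B 3 \<rightarrow> carrier B"
  shows "HHarr_map B C \<phi> 3 (harr_class K B 3 (- 1) t) = harr_class K C 3 (- 1) (cochain_transport B C \<phi> 3 t)"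
proof -
  interpret B: gca K B by fact
  interpret C: gca K C by fact
  note P = gca_homD[OF gca_isoD(1)[OF phi]]
  let ?s = "inv_into (carrier B) \<phi>"
  note si = gca_iso_inverse[OF assms(1,2) phi]
  note S = gca_homD[OF gca_isoD(1)[OF si]]
  have Cf: "g \<in> tuples B 2 \<rightarrow> carrier B" if "g \<in> CHarr K B 2 (- 1)" for g
    using that by (auto simp: CHarr_def CHoch_def)
  note hc = B.hoch_diff2_closed
  have *: "cochain_transport B C \<phi> 3 (\<lambda>xs\<in>tuples B 3. t xs \<oplus>\<^bsub>B\<^esub> hoch_diff B 2 (- 1) g xs)
    = (\<lambda>xs\<in>tuples C 3. cochain_transport B C \<phi> 3 t xs \<oplus>\<^bsub>C\<^esub> hoch_diff C 2 (- 1) (cochain_transport B C \<phi> 2 g) xs)"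
    if g: "g \<in> CHarr K B 2 (- 1)" for g
    unfolding transport_hoch_diff2[OF assms(1-3) Cf[OF g], symmetric]
    unfolding cochain_transport_def
  proof (rule restrict_ext)
    fix ys assume ys: "ys \<in> tuples C 3"
    then have "map ?s ys \<in> tuples B 3" using S(2) by (auto simp: tuples_def)
    then show "\<phi> ((\<lambda>xs\<in>tuples B 3. t xs \<oplus>\<^bsub>B\<^esub> hoch_diff B 2 (- 1) g xs) (map ?s ys)) =
        (\<lambda>ys\<in>tuples C 3. \<phi> (t (map ?s ys))) ys \<oplus>\<^bsub>C\<^esub> (\<lambda>ys\<in>tuples C 3. \<phi> (hoch_diff B 2 (- 1) g (map ?s ys))) ys"
      using ys hc[OF Cf[OF g]] t linear_map_add[OF P(1)] by (auto simp: Pi_iff)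
  qed
  \<comment> \<open>Transport along the inverse isomorphism supplies the preimage, so every
    two-cochain of the target contributes to the image class.\<close>
  have onto: "\<exists>g\<in>CHarr K B 2 (- 1). k = cochain_transport B C \<phi> 2 g" if k: "k \<in> CHarr K C 2 (- 1)" for k
  proof (rule bexI)
    let ?g = "cochain_transport C B ?s 2 k"
    show "?g \<in> CHarr K B 2 (- 1)" by (rule transport_CHarr2[OF assms(2,1) si k])
    have ss: "inv_into (carrier C) ?s x = \<phi> x" if "x \<in> carrier B" for x
    proof -
      have "?s (\<phi> x) = x" "\<phi> x \<in> carrier C" using that gca_isoD(2)[OF phi] P(2) by (auto simp: bij_betw_def)
      then show ?thesis
        using inv_into_f_f[of ?s "carrier C" "\<phi> x"] gca_isoD(2)[OF si] by (simp add: bij_betw_def)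
    qed
    have ps: "\<phi> (?s y) = y" if "y \<in> carrier C" for y
      using that gca_isoD(2)[OF phi] f_inv_into_f[of y \<phi> "carrier B"] by (auto simp: bij_betw_def)
    have k0: "k \<in> CHoch K C 2 (- 1)" using k by (simp add: C.CHarr2_iff)
    show "k = cochain_transport B C \<phi> 2 ?g"
    proof (rule extensionalityI[OF CHoch2D(1)[OF k0]])
      show "cochain_transport B C \<phi> 2 ?g \<in> extensional (tuples C 2)" by (simp add: cochain_transport_def)
      fix xs assume "xs \<in> tuples C 2"
      then obtain a b where x: "xs = [a, b]" and cl: "a \<in> carrier C" "b \<in> carrier C"
        by (auto simp: tuples2_iff)
      show "k xs = cochain_transport B C \<phi> 2 ?g xs"
        using cl S(2) CHoch2D(3)[OF k0] by (simp add: x cochain_transport_def ss ps)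
    qed
  qed
  show ?thesis
    unfolding HHarr_map_def harr_class_def harr_coboundaries3 image_image
    using * onto transport_CHarr2[OF assms(1-3)] by (auto simp: image_iff)
qed

section \<open>Existence and transport of transfer models\<close>

lemma (in dgca) primitive_mapD:
  assumes "is_primitive_map s"
  shows "x \<in> coboundaries A \<Longrightarrow> s x \<in> carrier A" "x \<in> coboundaries A \<Longrightarrow> d (s x) = x"
    "\<lbrakk>x \<in> coboundaries A; y \<in> coboundaries A\<rbrakk> \<Longrightarrow> s (x \<oplus>\<^bsub>A\<^esub> y) = s x \<oplus>\<^bsub>A\<^esub> s y"
    "\<lbrakk>a \<in> carrier K; x \<in> coboundaries A\<rbrakk> \<Longrightarrow> s (a \<odot>\<^bsub>A\<^esub> x) = a \<odot>\<^bsub>A\<^esub> s x"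
    "\<lbrakk>x \<in> coboundaries A; x \<in> grade A k\<rbrakk> \<Longrightarrow> s x \<in> grade A (k - 1)"
    "x \<in> coboundaries A \<Longrightarrow> s (\<ominus>\<^bsub>A\<^esub> x) = \<ominus>\<^bsub>A\<^esub> s x"
proof -
  show c: "x \<in> coboundaries A \<Longrightarrow> s x \<in> carrier A" "x \<in> coboundaries A \<Longrightarrow> d (s x) = x"
    "\<lbrakk>x \<in> coboundaries A; y \<in> coboundaries A\<rbrakk> \<Longrightarrow> s (x \<oplus>\<^bsub>A\<^esub> y) = s x \<oplus>\<^bsub>A\<^esub> s y"
    "\<lbrakk>x \<in> coboundaries A; x \<in> grade A k\<rbrakk> \<Longrightarrow> s x \<in> grade A (k - 1)" for x y k
    using assms unfolding is_primitive_map_def by blast+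
  show sm: "s (a \<odot>\<^bsub>A\<^esub> x) = a \<odot>\<^bsub>A\<^esub> s x" if "a \<in> carrier K" "x \<in> coboundaries A" for a x
    using assms that unfolding is_primitive_map_def by blast
  have CB: "coboundaries A \<subseteq> carrier A" by (auto simp: coboundaries_def)
  \<comment> \<open>Negation is multiplication by the scalar -1, so it is covered by compatibility
    with scalars on coboundaries.\<close>
  have neg: "\<ominus>\<^bsub>A\<^esub> y = (\<ominus>\<^bsub>K\<^esub> \<one>\<^bsub>K\<^esub>) \<odot>\<^bsub>A\<^esub> y" if "y \<in> carrier A" for y
    using that by (simp add: smult_l_minus)
  show "s (\<ominus>\<^bsub>A\<^esub> x) = \<ominus>\<^bsub>A\<^esub> s x" if x: "x \<in> coboundaries A"
    using sm[of "\<ominus>\<^bsub>K\<^esub> \<one>\<^bsub>K\<^esub>", OF _ x] neg[of x] neg[OF c(1)[OF x]] CB x by auto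
qed

lemma (in dgca) coboundary_iff_cls:
  assumes "x \<in> carrier A" "y \<in> carrier A"
  shows "x \<ominus>\<^bsub>A\<^esub> y \<in> coboundaries A \<longleftrightarrow> cls x = cls y"
proof -
  have "x \<ominus>\<^bsub>A\<^esub> y = d u \<longleftrightarrow> x = y \<oplus>\<^bsub>A\<^esub> d u" if "u \<in> carrier A" for u
    using assms d_closed[OF that] 
    by (metis M.add.inv_closed M.add.inv_solve_right M.a_comm a_minus_def)
  then show ?thesis
    unfolding cls_eq_iff[OF assms] coboundaries_def by auto
qed

text \<open>As \<open>\<phi>\<close> is multiplicative, \<open>\<iota> a \<iota> b\<close> and
  \<open>\<iota> (a b)\<close> represent the same class. Their difference is thus a coboundary with
  the symmetry of a graded commutative product, and the linear map \<open>s\<close> turns it into a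
  suitable \<open>m\<close>.\<close>

lemma transfer_model_of_section:
  fixes A :: "('k, 'a, 'y) dg_algebra_scheme" (structure)
  assumes H: "gca K H" and A: "dgca K A" and phi: "gca_iso K H (cohomology A) \<phi>"
    and iota: "linear_map K H A \<iota>" "\<And>x k. x \<in> grade H k \<Longrightarrow> \<iota> x \<in> grade A k"
    and rep: "\<And>a. a \<in> carrier H \<Longrightarrow> \<iota> a \<in> cocycles A" "\<And>a. a \<in> carrier H \<Longrightarrow> cohomology_class A (\<iota> a) = \<phi> a"
    and s: "dgca.is_primitive_map K A s"
  shows "transfer_model K H A \<iota> (\<lambda>a b. s (\<iota> a \<otimes> \<iota> b \<ominus> \<iota> (a \<otimes>\<^bsub>H\<^esub> b)))"
proof -
  interpret H: gca K H by fact
  interpret dgca K A by fact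
  note P = gca_homD[OF gca_isoD(1)[OF phi]]
  note S = primitive_mapD[OF s]
  note [simp] = linear_map_closed[OF iota(1)]
  note iota_add = linear_map_add[OF iota(1)] and iota_smult = linear_map_smult[OF iota(1)]
  note iota_neg = linear_map_neg[OF iota(1) H.abgrp abgrp]
  define F where "F a b = \<iota> a \<otimes> \<iota> b \<ominus> \<iota> (a \<otimes>\<^bsub>H\<^esub> b)" for a b
  have F: "F a b \<in> coboundaries A" if "a \<in> carrier H" "b \<in> carrier H" for a b
    unfolding F_def using that
    by (subst coboundary_iff_cls) (simp_all add: rep P cls_mult[symmetric])
  have Fg: "F a b \<in> grade A (i + j)" if "a \<in> grade H i" "b \<in> grade H j" for a b i j
    unfolding F_def using that by (intro grade_diff mult_grade iota(2) H.mult_grade)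
  note ad = M.diff_add_add
  note lin = F_def iota_add iota_smult l_distr r_distr H.l_distr H.r_distr smult_mult_left smult_mult_right
    H.smult_mult_left H.smult_mult_right ad smult_diff
  have "transfer_model K H A \<iota> (\<lambda>a b. s (F a b))"
  proof (intro transfer_model.intro transfer_model_axioms.intro)
    show "\<exists>!e. e \<in> carrier H \<and> (\<exists>u\<in>carrier A. y = \<iota> e \<oplus> d u)" if y: "y \<in> cocycles A" for y
    proof -
      have iff: "(\<exists>u\<in>carrier A. y = \<iota> e \<oplus> d u) \<longleftrightarrow> cls y = \<phi> e" if "e \<in> carrier H" for e
        using cls_eq_iff[of y "\<iota> e"] y that by (simp add: rep cocycle_closed)
      have "cls y \<in> \<phi> ` carrier H"
        using y gca_isoD(2)[OF phi] by (auto simp: bij_betw_def)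
      then obtain e where e: "e \<in> carrier H" "cls y = \<phi> e" by blast
      have inj: "e' = e" if "e' \<in> carrier H" "\<phi> e' = \<phi> e" for e'
        using that e gca_isoD(2)[OF phi] by (auto simp: bij_betw_def inj_on_def)
      show ?thesis
      proof (rule ex1I[of _ e])
        show "e \<in> carrier H \<and> (\<exists>u\<in>carrier A. y = \<iota> e \<oplus> d u)" using e iff by blast
        fix e' assume e': "e' \<in> carrier H \<and> (\<exists>u\<in>carrier A. y = \<iota> e' \<oplus> d u)"
        then have "cls y = \<phi> e'" using iff[of e'] by blast
        then show "e' = e" using inj e' e(2) by simp
      qed
    qed
    show "linear_map K H A (\<lambda>a. s (F a b))" if b: "b \<in> carrier H" for b
    proof (rule linear_mapI)
      show "s (F x b) \<in> carrier A" if "x \<in> carrier H" for x using S(1) F that b by blast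
      show "s (F (x \<oplus>\<^bsub>H\<^esub> y) b) = s (F x b) \<oplus> s (F y b)" if "x \<in> carrier H" "y \<in> carrier H" for x y
      proof -
        have "F (x \<oplus>\<^bsub>H\<^esub> y) b = F x b \<oplus> F y b" using that b by (simp add: lin)
        then show ?thesis using S(3) F that b by simp
      qed
      show "s (F (a \<odot>\<^bsub>H\<^esub> x) b) = a \<odot> s (F x b)" if "a \<in> carrier K" "x \<in> carrier H" for a x
      proof -
        have "F (a \<odot>\<^bsub>H\<^esub> x) b = a \<odot> F x b" using that b by (simp add: lin)
        then show ?thesis using S(4) F that b by simp
      qed
    qed
    show "linear_map K H A (\<lambda>b. s (F a b))" if b: "a \<in> carrier H" for a
    proof (rule linear_mapI)
      show "s (F a x) \<in> carrier A" if "x \<in> carrier H" for x using S(1) F that b by blast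
      show "s (F a (x \<oplus>\<^bsub>H\<^esub> y)) = s (F a x) \<oplus> s (F a y)" if "x \<in> carrier H" "y \<in> carrier H" for x y
      proof -
        have "F a (x \<oplus>\<^bsub>H\<^esub> y) = F a x \<oplus> F a y" using that b by (simp add: lin)
        then show ?thesis using S(3) F that b by simp
      qed
      show "s (F a (c \<odot>\<^bsub>H\<^esub> x)) = c \<odot> s (F a x)" if "c \<in> carrier K" "x \<in> carrier H" for c x
      proof -
        have "F a (c \<odot>\<^bsub>H\<^esub> x) = c \<odot> F a x" using that b by (simp add: lin)
        then show ?thesis using S(4) F that b by simp
      qed
    qed
  next
    fix a b i j assume ab: "a \<in> grade H i" "b \<in> grade H j"
    then have cl: "a \<in> carrier H" "b \<in> carrier H" using H.grade_carrier by auto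
    show "s (F a b) \<in> grade A (i + j - 1)"
      by (rule S(5)[OF F[OF cl] Fg[OF ab]])
    have "F b a = [parity_sign (i * j)] \<cdot> F a b"
      using cl graded_commutative[OF iota(2)[OF ab(2)] iota(2)[OF ab(1)]] H.graded_commutative[OF ab(2,1)]
      by (simp add: F_def M.parity_pow H.M.parity_pow mult.commute[of j i] iota_neg)
        (simp add: a_minus_def M.minus_add)
    then show "s (F b a) = [parity_sign (i * j)] \<cdot> s (F a b)"
      using F[OF cl] S(1,6) graded_submoduleD(1)[OF graded_submodule_coboundaries]
      by (auto simp: M.parity_pow)
  qed (use H A iota rep S F in \<open>auto simp: cocycle_d F_def[symmetric]\<close>)
  then show ?thesis by (simp only: F_def)
qed

text \<open>Supplies models on the intermediate algebras of a zig-zag, where no Hodge homotopy is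
  given.\<close>

lemma ex_transfer_model:
  assumes K: "field K" and H: "gca K H" and A: "dgca K A" and phi: "gca_iso K H (cohomology A) \<phi>"
  shows "\<exists>\<iota> m. transfer_model K H A \<iota> m \<and> (\<forall>a\<in>carrier H. cohomology_class A (\<iota> a) = \<phi> a)"
proof -
  interpret dgca K A by fact
  note P = gca_homD[OF gca_isoD(1)[OF phi]]
  obtain r where r0: "linear_map K HA A r \<and> (\<forall>k. \<forall>X\<in>grade HA k. r X \<in> grade A k) \<and>
    (\<forall>X\<in>carrier HA. r X \<in> cocycles A \<and> cls (r X) = X)"
    using ex_representatives[OF K] by (rule exE)
  then have r: "linear_map K HA A r" "\<And>X k. X \<in> grade HA k \<Longrightarrow> r X \<in> grade A k"
    "\<And>X. X \<in> carrier HA \<Longrightarrow> r X \<in> cocycles A" "\<And>X. X \<in> carrier HA \<Longrightarrow> cls (r X) = X"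
    by simp_all
  obtain s where s: "is_primitive_map s" using ex_primitive_map[OF K] by blast
  have "transfer_model K H A (\<lambda>a. r (\<phi> a))
      (\<lambda>a b. s (r (\<phi> a) \<otimes>\<^bsub>A\<^esub> r (\<phi> b) \<ominus>\<^bsub>A\<^esub> r (\<phi> (a \<otimes>\<^bsub>H\<^esub> b))))"
    by (rule transfer_model_of_section[OF H A phi linear_map_compose[OF P(1) r(1)] _ _ _ s]) (simp_all add: r P)
  moreover have "\<forall>a\<in>carrier H. cls (r (\<phi> a)) = \<phi> a" using r(4) P(2) by simp
  ultimately show ?thesis by (intro exI conjI)
qed

text \<open>Cohomologous sections are joined by the chain homotopy obtained from a primitive map
  applied to \<open>\<iota>' a - \<iota> a\<close>.\<close>

lemma harr_class_transfer3_eq: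
  fixes A :: "('k, 'a, 'y) dg_algebra_scheme" (structure)
  assumes K: "field K" and M: "transfer_model K H A \<iota> m" "transfer_model K H A \<iota>' m'"
    and eq: "\<And>a. a \<in> carrier H \<Longrightarrow> cohomology_class A (\<iota> a) = cohomology_class A (\<iota>' a)"
  shows "harr_class K H 3 (- 1) (transfer3 H A \<iota> m) = harr_class K H 3 (- 1) (transfer3 H A \<iota>' m')"
proof -
  \<comment> \<open>One inclusion, for arbitrary models, so that it can be applied again with the
    models exchanged.\<close>
  have *: "harr_class K H 3 (- 1) (transfer3 H A \<iota> m) \<subseteq> harr_class K H 3 (- 1) (transfer3 H A \<iota>' m')"
    if M: "transfer_model K H A \<iota> m" "transfer_model K H A \<iota>' m'"
      and eq: "\<And>a. a \<in> carrier H \<Longrightarrow> cohomology_class A (\<iota> a) = cohomology_class A (\<iota>' a)" for \<iota> \<iota>' m m'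
  proof -
    interpret M: transfer_model K H A \<iota> m by fact
    interpret M': transfer_model K H A \<iota>' m' by fact
    obtain s where s: "M.is_primitive_map s" using M.ex_primitive_map[OF K] by blast
    note S = M.primitive_mapD[OF s]
    have B: "\<iota>' a \<ominus> \<iota> a \<in> coboundaries A" if "a \<in> carrier H" for a
      using that eq by (simp add: M.coboundary_iff_cls)
    note ad = M.M.diff_add_add
    have "linear_map K H A (\<lambda>a. s (\<iota>' a \<ominus> \<iota> a))"
      by (rule linear_mapI) (simp_all add: M.iota_add M'.iota_add ad M.iota_smult M'.iota_smult
          M.smult_diff[symmetric] S B)
    moreover have "s (\<iota>' a \<ominus> \<iota> a) \<in> grade A (k - 1)" if "a \<in> grade H k" for a k
      using that M.iota_grade M'.iota_grade M.H.grade_carrier by (intro S B M.grade_diff) auto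
    ultimately obtain g where "g \<in> CHarr K H 2 (- 1)" "transfer3 H A \<iota> m =
        (\<lambda>xs\<in>tuples H 3. transfer3 H A \<iota>' m' xs \<oplus>\<^bsub>H\<^esub> hoch_diff H 2 (- 1) g xs)"
      using transfer3_change_of_model[OF M, of "\<lambda>a. s (\<iota>' a \<ominus> \<iota> a)"] S(2) B by blast
    moreover have "transfer3 H A \<iota>' m' \<in> tuples H 3 \<rightarrow> carrier H"
      using M'.transfer3_CHoch by (auto simp: CHoch_def)
    ultimately show ?thesis
      by (intro harr_class_subset[OF M.H.gca_axioms])
  qed
  show ?thesis
    using *[OF M eq] *[OF M(2,1) eq[symmetric]] by blast
qed

section \<open>Models along quasi-isomorphisms and under reparametrisation of the cohomology\<close>

lemma quasi_iso_cohomology_map: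
  assumes "quasi_iso K A B f" and x: "x \<in> cocycles A"
  shows "f x \<in> cocycles B" "cohomology_map B f (cohomology_class A x) = cohomology_class B (f x)"
proof -
  interpret A: dgca K A using assms by (simp add: quasi_iso_def)
  interpret B: dgca K B using assms by (simp add: quasi_iso_def)
  have h: "gca_hom K A B f" "\<And>x. x \<in> carrier A \<Longrightarrow> f (A.d x) = B.d (f x)"
    using assms by (auto simp: quasi_iso_def dgca_hom_def)
  note F = gca_homD[OF h(1)]
  have xA: "x \<in> carrier A" using x A.cocycle_closed by blast
  show "f x \<in> cocycles B"
    using F(2)[OF xA] h(2)[OF xA] A.cocycle_d[OF x] linear_map_zero[OF F(1) A.abgrp B.abgrp]
    by (simp add: B.cocycleI)
  have "B.cls (f y) = B.cls (f x)" if y: "y \<in> A.cls x" for y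
  proof -
    from y obtain u where u: "u \<in> carrier A" "y = x \<oplus>\<^bsub>A\<^esub> A.d u" using xA by (auto simp: A.cls_mem_iff)
    then have "f y = f x \<oplus>\<^bsub>B\<^esub> B.d (f u)" using xA by (simp add: linear_map_add[OF F(1)] h(2))
    then show ?thesis using F(2) xA u(1) by (intro B.cls_eqI) auto
  qed
  then have "(\<Union>y\<in>A.cls x. B.cls (f y)) = (\<Union>y\<in>A.cls x. B.cls (f x))"
    by (intro SUP_cong refl)
  then show "cohomology_map B f (cohomology_class A x) = cohomology_class B (f x)"
    using A.cls_self[OF xA] unfolding cohomology_map_def by auto
qed

lemma quasi_iso_gca_iso:
  assumes q: "quasi_iso K A B f"
  shows "gca_iso K (cohomology A) (cohomology B) (cohomology_map B f)"
proof -
  interpret A: dgca K A using assms by (simp add: quasi_iso_def)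
  interpret B: dgca K B using assms by (simp add: quasi_iso_def)
  have h: "gca_hom K A B f"
    using assms by (auto simp: quasi_iso_def dgca_hom_def)
  note F = gca_homD[OF h]
  note Q = quasi_iso_cohomology_map[OF q]
  have "gca_hom K (cohomology A) (cohomology B) (cohomology_map B f)"
  proof (rule gca_homI)
    show "linear_map K A.HA B.HA (cohomology_map B f)"
      by (rule linear_mapI; elim A.cohomology_cases)
        (simp_all add: Q A.cls_add B.cls_add A.cocycle_add A.cls_smult B.cls_smult A.cocycle_smult A.cocycle_closed
          linear_map_add[OF F(1)] linear_map_smult[OF F(1)])
    show "cohomology_map B f (X \<otimes>\<^bsub>A.HA\<^esub> Y) = cohomology_map B f X \<otimes>\<^bsub>B.HA\<^esub> cohomology_map B f Y"
      if "X \<in> carrier A.HA" "Y \<in> carrier A.HA" for X Y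
      using that by (elim A.cohomology_cases)
        (simp add: Q A.cls_mult B.cls_mult A.cocycle_mult A.cocycle_closed F(3))
    show "cohomology_map B f \<one>\<^bsub>A.HA\<^esub> = \<one>\<^bsub>B.HA\<^esub>"
      by (simp add: A.cohomology_one B.cohomology_one Q A.cocycle_one F(4))
    show "cohomology_map B f X \<in> grade B.HA k" if "X \<in> grade A.HA k" for X k
      using that by (auto simp: A.grade_cohomology Q intro!: B.cls_grade F(5))
  qed
  then show ?thesis using q by (simp add: gca_iso_def quasi_iso_def)
qed

text \<open>As \<open>f\<close> commutes with products, differentials and twists, the defect of the
  pushed model is the image of the old defect. Bijectivity on cohomology is what
  \<open>rep_ex1\<close> needs, and coordinates in the fixed \<open>H\<close> do not change.\<close>

lemma transfer_model_push:
  fixes A :: "('k, 'a, 'y) dg_algebra_scheme" (structure)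
  assumes q: "quasi_iso K A B f" and M: "transfer_model K H A \<iota> m"
  shows "transfer_model K H B (\<lambda>a. f (\<iota> a)) (\<lambda>a b. f (m a b))" (is ?M)
    and "transfer3 H B (\<lambda>a. f (\<iota> a)) (\<lambda>a b. f (m a b)) = transfer3 H A \<iota> m" (is ?T)
proof -
  interpret transfer_model K H A \<iota> m by fact
  interpret B: dgca K B using q by (simp add: quasi_iso_def)
  have h: "gca_hom K A B f" "\<And>x. x \<in> carrier A \<Longrightarrow> f (d x) = B.d (f x)"
    using q by (auto simp: quasi_iso_def dgca_hom_def)
  have bij: "bij_betw (cohomology_map B f) (carrier HA) (carrier B.HA)"
    using q by (simp add: quasi_iso_def)
  note F = gca_homD[OF h(1)]
  note Fl = linear_map_add[OF F(1)] linear_map_smult[OF F(1)] linear_map_neg[OF F(1) abgrp B.abgrp]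
    linear_map_diff[OF F(1) abgrp B.abgrp] linear_map_zero[OF F(1) abgrp B.abgrp]
  note Q = quasi_iso_cohomology_map[OF q]
  have ex1: "\<exists>!e. e \<in> carrier H \<and> (\<exists>u\<in>carrier B. y = f (\<iota> e) \<oplus>\<^bsub>B\<^esub> B.d u)" if y: "y \<in> cocycles B" for y
  proof (rule ex_ex1I)
    have "B.cls y \<in> cohomology_map B f ` carrier HA"
      using y bij by (simp add: bij_betw_def)
    then obtain X where "X \<in> carrier HA" "B.cls y = cohomology_map B f X" by blast
    then obtain x where x: "x \<in> cocycles A" "B.cls y = B.cls (f x)"
      using Q by (elim cohomology_cases) simp
    obtain u where u: "u \<in> carrier A" "x = \<iota> (\<rho> x) \<oplus> d u" using rho_rep[OF x(1)] by blast
    have r: "\<rho> x \<in> carrier H" using x by auto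
    have "f (\<iota> (\<rho> x) \<oplus> d u) = f (\<iota> (\<rho> x)) \<oplus>\<^bsub>B\<^esub> B.d (f u)"
      using u(1) r by (simp add: Fl h(2))
    then have "f x = f (\<iota> (\<rho> x)) \<oplus>\<^bsub>B\<^esub> B.d (f u)" unfolding u(2)[symmetric] .
    then have "B.cls (f x) = B.cls (f (\<iota> (\<rho> x)))"
      by (rule B.cls_eqI[rotated 2]) (use u(1) r F(2) in simp_all)
    then have "B.cls y = B.cls (f (\<iota> (\<rho> x)))" using x by simp
    then show "\<exists>e. e \<in> carrier H \<and> (\<exists>u\<in>carrier B. y = f (\<iota> e) \<oplus>\<^bsub>B\<^esub> B.d u)"
      using B.cls_eq_iff[of y "f (\<iota> (\<rho> x))"] y r F(2) B.cocycle_closed by auto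
  next
    fix e e' assume e: "e \<in> carrier H \<and> (\<exists>u\<in>carrier B. y = f (\<iota> e) \<oplus>\<^bsub>B\<^esub> B.d u)"
      and e': "e' \<in> carrier H \<and> (\<exists>u\<in>carrier B. y = f (\<iota> e') \<oplus>\<^bsub>B\<^esub> B.d u)"
    have "B.cls y = B.cls (f (\<iota> e))" "B.cls y = B.cls (f (\<iota> e'))"
      using e e' F(2) y by (simp_all add: B.cls_eq_iff B.cocycle_closed)
    then have "cohomology_map B f (cls (\<iota> e)) = cohomology_map B f (cls (\<iota> e'))"
      using e e' by (simp add: Q iota_cocycle)
    then have "cls (\<iota> e) = cls (\<iota> e')"
      using bij e e' by (auto simp: bij_betw_def inj_on_def iota_cocycle)
    then obtain u where "u \<in> carrier A" "\<iota> e = \<iota> e' \<oplus> d u"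
      using cls_eq_iff e e' by auto
    then have "\<rho> (\<iota> e) = e'" using e' rho_eqI by blast
    then show "e = e'" using e rho_iota by simp
  qed
  show ?M
  proof (intro transfer_model.intro transfer_model_axioms.intro)
    show "linear_map K H B (\<lambda>a. f (\<iota> a))" by (rule linear_map_compose[OF iota_linear F(1)])
    show "linear_map K H B (\<lambda>a. f (m a b))" if "b \<in> carrier H" for b
      by (rule linear_map_compose[OF m_linear_left[OF that] F(1)])
    show "linear_map K H B (\<lambda>b. f (m a b))" if "a \<in> carrier H" for a
      by (rule linear_map_compose[OF m_linear_right[OF that] F(1)])
    show "f (m b a) = [parity_sign (i * j)] \<cdot>\<^bsub>B\<^esub> f (m a b)" if "a \<in> grade H i" "b \<in> grade H j" for a b i j
      using m_sym[OF that] that H.grade_carrier F(2) by (simp add: M.parity_pow B.M.parity_pow Fl)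
    show "B.d (f (m a b)) = f (\<iota> a) \<otimes>\<^bsub>B\<^esub> f (\<iota> b) \<ominus>\<^bsub>B\<^esub> f (\<iota> (a \<otimes>\<^bsub>H\<^esub> b))" if "a \<in> carrier H" "b \<in> carrier H" for a b
      using that by (simp add: h(2)[symmetric] d_m Fl F(3))
    show "B.d (f (\<iota> x)) = \<zero>\<^bsub>B\<^esub>" if "x \<in> carrier H" for x
      using that by (simp add: h(2)[symmetric] d_iota Fl)
  qed (auto simp: H.gca_axioms B.dgca_axioms iota_grade m_grade ex1 intro!: F(5))
  then interpret N: transfer_model K H B "\<lambda>a. f (\<iota> a)" "\<lambda>a b. f (m a b)" .
  have rho: "N.\<rho> (f x) = \<rho> x" if x: "x \<in> cocycles A" for x
  proof -
    obtain u where u: "u \<in> carrier A" "x = \<iota> (\<rho> x) \<oplus> d u" using rho_rep[OF x] by blast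
    have r: "\<rho> x \<in> carrier H" using x by auto
    have "f (\<iota> (\<rho> x) \<oplus> d u) = f (\<iota> (\<rho> x)) \<oplus>\<^bsub>B\<^esub> B.d (f u)"
      using u(1) r by (simp add: Fl h(2))
    then have "f x = f (\<iota> (\<rho> x)) \<oplus>\<^bsub>B\<^esub> B.d (f u)" unfolding u(2)[symmetric] .
    then show ?thesis by (rule N.rho_eqI[rotated 2]) (use r F(2)[OF u(1)] in simp_all)
  qed
  have tw: "B.\<tau> (f x) = f (\<tau> x)" if "x \<in> carrier A" for x
    using gca_degree_map_twist[OF gca_axioms B.gca_axioms F(1), of 0 x] F(2,5) that
    by (simp add: B.M.parity_pow)
  show ?T
    unfolding transfer3_def
  proof (rule restrict_ext)
    fix xs assume "xs \<in> tuples H 3"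
    then obtain a b c where x: "xs = [a, b, c]" and cl: "a \<in> carrier H" "b \<in> carrier H" "c \<in> carrier H"
      by (auto simp: tuples3_iff)
    have "N.z a b c = f (z a b c)"
      using cl by (simp add: assoc_defect_def Fl F(3) tw)
    then show "N.\<rho> (N.z (xs ! 0) (xs ! 1) (xs ! 2)) = \<rho> (z (xs ! 0) (xs ! 1) (xs ! 2))"
      using cl by (simp add: x rho z_cocycle)
  qed
qed

text \<open>Turns a model over the cohomology of the target algebra into one over the cohomology of
  the source, where the classes are compared; the cochain is transported accordingly.\<close>

lemma transfer_model_iso:
  fixes A :: "('k, 'a, 'y) dg_algebra_scheme" (structure)
  assumes H': "gca K H'" and phi: "gca_iso K H' H \<phi>" and M: "transfer_model K H A \<iota> m"
  shows "transfer_model K H' A (\<lambda>a. \<iota> (\<phi> a)) (\<lambda>a b. m (\<phi> a) (\<phi> b))" (is ?M)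
    and "cochain_transport H' H \<phi> 3 (transfer3 H' A (\<lambda>a. \<iota> (\<phi> a)) (\<lambda>a b. m (\<phi> a) (\<phi> b))) = transfer3 H A \<iota> m" (is ?T)
proof -
  interpret transfer_model K H A \<iota> m by fact
  interpret H': gca K H' by fact
  note P = gca_homD[OF gca_isoD(1)[OF phi]]
  note bij = gca_isoD(2)[OF phi]
  let ?s = "inv_into (carrier H') \<phi>"
  have s: "?s y \<in> carrier H'" "\<phi> (?s y) = y" if "y \<in> carrier H" for y
    using that bij inv_into_into[of y \<phi> "carrier H'"] f_inv_into_f[of y \<phi> "carrier H'"] by (auto simp: bij_betw_def)
  have inj: "x = y" if "x \<in> carrier H'" "y \<in> carrier H'" "\<phi> x = \<phi> y" for x y
    using that bij by (auto simp: bij_betw_def inj_on_def)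
  show ?M
  proof (intro transfer_model.intro transfer_model_axioms.intro)
    show "linear_map K H' A (\<lambda>a. \<iota> (\<phi> a))" by (rule linear_map_compose[OF P(1) iota_linear])
    show "linear_map K H' A (\<lambda>a. m (\<phi> a) (\<phi> b))" if "b \<in> carrier H'" for b
      by (rule linear_map_compose[OF P(1) m_linear_left[OF P(2)[OF that]]])
    show "linear_map K H' A (\<lambda>b. m (\<phi> a) (\<phi> b))" if "a \<in> carrier H'" for a
      by (rule linear_map_compose[OF P(1) m_linear_right[OF P(2)[OF that]]])
    show "\<exists>!e. e \<in> carrier H' \<and> (\<exists>u\<in>carrier A. y = \<iota> (\<phi> e) \<oplus> d u)" if y: "y \<in> cocycles A" for y
    proof (rule ex_ex1I)
      show "\<exists>e. e \<in> carrier H' \<and> (\<exists>u\<in>carrier A. y = \<iota> (\<phi> e) \<oplus> d u)"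
        using rho_rep[OF y] s by (intro exI[of _ "?s (\<rho> y)"]) simp
      fix e e' assume "e \<in> carrier H' \<and> (\<exists>u\<in>carrier A. y = \<iota> (\<phi> e) \<oplus> d u)"
        and "e' \<in> carrier H' \<and> (\<exists>u\<in>carrier A. y = \<iota> (\<phi> e') \<oplus> d u)"
      then show "e = e'" using rep_ex1[OF y] P(2) inj by blast
    qed
  qed (auto simp: H' dgca_axioms P iota_grade m_grade m_sym d_m d_iota)
  then interpret N: transfer_model K H' A "\<lambda>a. \<iota> (\<phi> a)" "\<lambda>a b. m (\<phi> a) (\<phi> b)" .
  have rho: "\<phi> (N.\<rho> x) = \<rho> x" if x: "x \<in> cocycles A" for x
  proof -
    obtain u where "u \<in> carrier A" "x = \<iota> (\<phi> (N.\<rho> x)) \<oplus> d u" using N.rho_rep[OF x] by blast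
    then have "\<rho> x = \<phi> (N.\<rho> x)" using P(2)[OF N.rho_closed[OF x]] by (intro rho_eqI)
    then show ?thesis by simp
  qed
  show ?T
    unfolding cochain_transport_def transfer3_def[of H A]
  proof (rule restrict_ext)
    fix xs assume "xs \<in> tuples H 3"
    then obtain a b c where x: "xs = [a, b, c]" and cl: "a \<in> carrier H" "b \<in> carrier H" "c \<in> carrier H"
      by (auto simp: tuples3_iff)
    have "N.z (?s a) (?s b) (?s c) = z a b c"
      using cl by (simp add: assoc_defect_def P(3) s)
    then show "\<phi> (transfer3 H' A (\<lambda>a. \<iota> (\<phi> a)) (\<lambda>a b. m (\<phi> a) (\<phi> b)) (map ?s xs))
        = \<rho> (z (xs ! 0) (xs ! 1) (xs ! 2))"
      using cl s by (simp add: x N.transfer3_eq rho z_cocycle)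
  qed
qed

section \<open>Hodge homotopies and zig-zags\<close>

locale hodge_dgca = dgca K A for K and A :: "('k, 'a, 'x) dg_algebra_scheme" (structure) +
  fixes h :: "'a \<Rightarrow> 'a"
  assumes h_linear: "linear_map K A A h"
    and h_grade: "x \<in> grade A k \<Longrightarrow> h x \<in> grade A (k - 1)"
    and h_h: "x \<in> carrier A \<Longrightarrow> h (h x) = \<zero>"
    and h_d_h: "x \<in> carrier A \<Longrightarrow> h (d (h x)) = h x"
    and d_h_d: "x \<in> carrier A \<Longrightarrow> d (h (d x)) = d x"
begin

lemmas h_closed [simp, intro] = linear_map_closed[OF h_linear]
lemmas h_add = linear_map_add[OF h_linear]
lemmas h_smult = linear_map_smult[OF h_linear]
lemmas h_zero = linear_map_zero[OF h_linear abgrp abgrp]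
lemmas h_neg = linear_map_neg[OF h_linear abgrp abgrp]

abbreviation \<pi> :: "'a \<Rightarrow> 'a" where "\<pi> \<equiv> harmonic_proj A h"

lemma proj_closed [simp, intro]: "x \<in> carrier A \<Longrightarrow> \<pi> x \<in> carrier A"
  by (simp add: harmonic_proj_def)

lemma proj_linear: "linear_map K A A \<pi>"
proof (rule linear_mapI)
  fix x y assume xy: "x \<in> carrier A" "y \<in> carrier A"
  show "\<pi> (x \<oplus> y) = \<pi> x \<oplus> \<pi> y"
    using xy by (simp add: harmonic_proj_def h_add d_add M.diff_add_add[symmetric] M.a_ac)
qed (simp_all add: harmonic_proj_def h_smult d_smult smult_diff smult_r_distr)

lemmas proj_add = linear_map_add[OF proj_linear]
lemmas proj_neg = linear_map_neg[OF proj_linear abgrp abgrp]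

lemma proj_cocycle: "x \<in> cocycles A \<Longrightarrow> \<pi> x = x \<ominus> d (h x)"
  by (simp add: harmonic_proj_def cocycle_d cocycle_closed h_zero)

lemma d_proj: "x \<in> carrier A \<Longrightarrow> d (\<pi> x) = \<zero>"
  by (simp add: harmonic_proj_def a_minus_def d_add d_neg d_h_d differential_square M.r_neg)

lemma h_proj: "x \<in> carrier A \<Longrightarrow> h (\<pi> x) = \<zero>"
  by (simp add: harmonic_proj_def a_minus_def h_add h_neg h_d_h h_h M.r_neg)

lemma proj_h: "x \<in> carrier A \<Longrightarrow> \<pi> (h x) = \<zero>"
  by (simp add: harmonic_proj_def h_d_h h_h d_zero a_minus_def M.r_neg)

lemma proj_d: "x \<in> carrier A \<Longrightarrow> \<pi> (d x) = \<zero>"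
  by (simp add: harmonic_proj_def d_h_d differential_square h_zero a_minus_def M.r_neg)

text \<open>What \<open>\<pi>\<close> subtracts passes through \<open>h\<close> or \<open>d\<close>
  first, and both vanish on its image.\<close>

lemma proj_proj: "x \<in> carrier A \<Longrightarrow> \<pi> (\<pi> x) = \<pi> x"
  by (simp add: harmonic_proj_def[of A h "\<pi> x"] h_proj d_proj h_zero d_zero a_minus_def)

lemma cls_proj:
  assumes "x \<in> cocycles A" shows "cls (\<pi> x) = cls x"
proof (rule cls_eqI)
  show "\<pi> x = x \<oplus> d (\<ominus> h x)"
    using assms by (simp add: proj_cocycle cocycle_closed d_neg a_minus_def)
qed (use assms cocycle_closed in auto)

lemma harmonics_closed: "x \<in> harmonics A h \<Longrightarrow> x \<in> carrier A"
  by (auto simp: harmonics_def)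

lemma harmonics_cocycle: "x \<in> harmonics A h \<Longrightarrow> x \<in> cocycles A"
  by (auto simp: harmonics_def cocycles_def d_proj)

lemma harmonics_proj: "x \<in> harmonics A h \<Longrightarrow> \<pi> x = x"
  by (auto simp: harmonics_def proj_proj)

lemma harmonicsI: "x \<in> carrier A \<Longrightarrow> \<pi> x = x \<Longrightarrow> x \<in> harmonics A h"
  unfolding harmonics_def by (metis imageI)

text \<open>The projection fixes harmonic elements and kills coboundaries, so cohomologous harmonic
  elements coincide.\<close>

lemma harmonics_inj:
  assumes "x \<in> harmonics A h" "y \<in> harmonics A h" "cls x = cls y"
  shows "x = y"
proof -
  obtain u where u: "u \<in> carrier A" "x = y \<oplus> d u"
    using assms harmonics_closed cls_eq_iff by blast
  have "\<pi> x = \<pi> y"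
    using u(1) harmonics_closed[OF assms(2)] by (simp add: u(2) proj_add proj_d)
  then show ?thesis using assms harmonics_proj by simp
qed

abbreviation r :: "'a set \<Rightarrow> 'a" where "r \<equiv> harmonic_rep A h"

lemma harmonic_rep_eqI: "x \<in> harmonics A h \<Longrightarrow> cls x = X \<Longrightarrow> r X = x"
  unfolding harmonic_rep_def using harmonics_inj by (auto intro!: inv_into_f_f simp: inj_on_def)

lemma harmonic_rep:
  assumes "X \<in> carrier HA"
  shows "r X \<in> harmonics A h" "cls (r X) = X"
proof -
  obtain x where x: "x \<in> cocycles A" "X = cls x" using assms by (rule cohomology_cases)
  then have "\<pi> x \<in> harmonics A h" "cls (\<pi> x) = X"
    using cls_proj cocycle_closed by (auto simp: harmonics_def)
  then show "r X \<in> harmonics A h" "cls (r X) = X" using harmonic_rep_eqI by auto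
qed

lemma harmonic_rep_closed [simp, intro]: "X \<in> carrier HA \<Longrightarrow> r X \<in> carrier A"
  using harmonic_rep harmonics_closed by blast

lemma harmonic_rep_cocycle: "X \<in> carrier HA \<Longrightarrow> r X \<in> cocycles A"
  using harmonic_rep harmonics_cocycle by blast

lemma h_harmonic_rep: "X \<in> carrier HA \<Longrightarrow> h (r X) = \<zero>"
  using h_proj[of "r X"] harmonics_proj harmonic_rep by auto

lemma harmonic_rep_linear: "linear_map K HA A r"
proof (rule linear_mapI)
  show "r (X \<oplus>\<^bsub>HA\<^esub> Y) = r X \<oplus> r Y" if XY: "X \<in> carrier HA" "Y \<in> carrier HA" for X Y
  proof (rule harmonic_rep_eqI)
    show "r X \<oplus> r Y \<in> harmonics A h"
      using XY by (intro harmonicsI) (simp_all add: proj_add harmonics_proj harmonic_rep)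
    show "cls (r X \<oplus> r Y) = X \<oplus>\<^bsub>HA\<^esub> Y"
      using XY by (simp add: cls_add[symmetric] harmonic_rep_cocycle harmonic_rep)
  qed
  show "r (a \<odot>\<^bsub>HA\<^esub> X) = a \<odot> r X" if aX: "a \<in> carrier K" "X \<in> carrier HA" for a X
  proof (rule harmonic_rep_eqI)
    show "a \<odot> r X \<in> harmonics A h"
      using aX by (intro harmonicsI) (simp_all add: linear_map_smult[OF proj_linear] harmonics_proj harmonic_rep)
    show "cls (a \<odot> r X) = a \<odot>\<^bsub>HA\<^esub> X"
      using aX by (simp add: cls_smult[symmetric] harmonic_rep_cocycle harmonic_rep)
  qed
qed auto

lemma harmonic_rep_grade:
  assumes "X \<in> grade HA k" shows "r X \<in> grade A k"
proof -
  obtain x where x: "x \<in> cocycles A" "x \<in> grade A k" "X = cls x"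
    using assms by (auto simp: grade_cohomology)
  have "r X = \<pi> x"
    using x cls_proj cocycle_closed by (intro harmonic_rep_eqI) (auto simp: harmonics_def)
  moreover have "d (h x) \<in> grade A k"
    using differential_grade[OF h_grade[OF x(2)]] by simp
  ultimately show ?thesis using x by (simp add: proj_cocycle grade_diff)
qed

text \<open>The relation \<open>d h d = d\<close> says that \<open>h\<close> inverts the
  differential on coboundaries.\<close>

lemma primitive_map_h: "is_primitive_map h"
  unfolding is_primitive_map_def coboundaries_def
  by (auto simp: d_h_d h_add h_smult h_grade)

lemma hodge_transfer_model:
  "transfer_model K HA A r (\<lambda>a b. h (r a \<otimes> r b \<ominus> r (a \<otimes>\<^bsub>HA\<^esub> b)))"
  by (rule transfer_model_of_section[OF gca_cohomology dgca_axioms gca_iso_id harmonic_rep_linear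
        harmonic_rep_grade harmonic_rep_cocycle harmonic_rep(2) primitive_map_h])

lemma mu3_eq_transfer3:
  "mu3 A h = transfer3 HA A r (\<lambda>a b. h (r a \<otimes> r b \<ominus> r (a \<otimes>\<^bsub>HA\<^esub> b)))"
  unfolding mu3_def transfer3_def Let_def
proof (rule restrict_ext)
  interpret T: transfer_model K HA A r "\<lambda>a b. h (r a \<otimes> r b \<ominus> r (a \<otimes>\<^bsub>HA\<^esub> b))"
    by (rule hodge_transfer_model)
  fix xs assume "xs \<in> tuples HA 3"
  then obtain a b c where x: "xs = [a, b, c]" and cl: "a \<in> carrier HA" "b \<in> carrier HA" "c \<in> carrier HA"
    by (auto simp: tuples3_iff)
  \<comment> \<open>Harmonic representatives are annihilated by \<open>h\<close>, so the correction
    \<open>r (a b)\<close> contributes nothing to \<open>m\<close>.\<close>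
  have m: "h (r a \<otimes> r b \<ominus> r (a \<otimes>\<^bsub>HA\<^esub> b)) = h (r a \<otimes> r b)"
    if "a \<in> carrier HA" "b \<in> carrier HA" for a b
    using that by (simp add: a_minus_def h_add h_neg h_harmonic_rep)
  let ?w = "h (r a \<otimes> r b) \<otimes> r c \<ominus> r (T.H.\<tau> a) \<otimes> h (r b \<otimes> r c)"
  have z: "T.z a b c = ?w \<oplus> h (r (a \<otimes>\<^bsub>HA\<^esub> b) \<otimes> r c) \<ominus> h (r a \<otimes> r (b \<otimes>\<^bsub>HA\<^esub> c))"
    using cl by (simp add: assoc_defect_def m T.iota_twist)
  have "\<pi> (T.z a b c) = \<pi> ?w"
    unfolding z using cl by (simp add: proj_add proj_neg proj_h a_minus_def)
  moreover have "cls (\<pi> (T.z a b c)) = cls (T.z a b c)"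
    using cl by (intro cls_proj T.z_cocycle)
  \<comment> \<open>Here \<open>H\<close> is the cohomology itself and \<open>r\<close> represents
    each class by one of its members, so the coordinate of a cocycle is its class.\<close>
  moreover have "T.\<rho> (T.z a b c) = cls (T.z a b c)"
  proof -
    have zc: "T.z a b c \<in> cocycles A" using cl by (rule T.z_cocycle)
    obtain u where u: "u \<in> carrier A" "T.z a b c = r (T.\<rho> (T.z a b c)) \<oplus> d u"
      using T.rho_rep[OF zc] by blast
    have e: "T.\<rho> (T.z a b c) \<in> carrier HA" using zc by (rule T.rho_closed)
    have "cls (T.z a b c) = cls (r (T.\<rho> (T.z a b c)))"
      by (rule cls_eqI[OF _ u]) (use e in simp)
    then show ?thesis using harmonic_rep(2)[OF e] by simp
  qed
  ultimately show "cls (\<pi> (h (r (xs ! 0) \<otimes> r (xs ! 1)) \<otimes> r (xs ! 2)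
      \<ominus> r (T.H.\<tau> (xs ! 0)) \<otimes> h (r (xs ! 1) \<otimes> r (xs ! 2))))
    = T.\<rho> (T.z (xs ! 0) (xs ! 1) (xs ! 2))"
    by (simp add: x)
qed

end

lemma hodge_homotopy_hodge_dgca:
  "dgca K A \<Longrightarrow> hodge_homotopy K A n fund h \<Longrightarrow> hodge_dgca K A h"
  by (intro hodge_dgca.intro hodge_dgca_axioms.intro) (auto simp: hodge_homotopy_def image_subset_iff)

lemma hodge_homotopy_mu3:
  assumes "dgca K A" "hodge_homotopy K A n fund h"
  obtains \<iota> m where "transfer_model K (cohomology A) A \<iota> m"
    "\<forall>a\<in>carrier (cohomology A). cohomology_class A (\<iota> a) = a"
    "mu3 A h = transfer3 (cohomology A) A \<iota> m"
proof -
  interpret hodge_dgca K A h using assms by (rule hodge_homotopy_hodge_dgca)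
  show thesis
    by (rule that[OF hodge_transfer_model _ mu3_eq_transfer3]) (simp add: harmonic_rep)
qed

text \<open>Comparing all models over \<open>\<phi>\<close>, rather than one, makes the relation composable along a zig-zag.\<close>

definition transports_class ::
  "('k, 'm) ring_scheme \<Rightarrow> ('k, 'a, 'x) dg_algebra_scheme \<Rightarrow> ('k, 'b, 'y) dg_algebra_scheme
    \<Rightarrow> ('a set \<Rightarrow> 'b set) \<Rightarrow> bool"
  where "transports_class K A U \<phi> \<longleftrightarrow> dgca K U \<and> gca_iso K (cohomology A) (cohomology U) \<phi> \<and>
    (\<forall>\<iota> m \<iota>' m'. transfer_model K (cohomology A) A \<iota> m \<longrightarrow>
      (\<forall>a\<in>carrier (cohomology A). cohomology_class A (\<iota> a) = a) \<longrightarrow>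
      transfer_model K (cohomology A) U \<iota>' m' \<longrightarrow>
      (\<forall>a\<in>carrier (cohomology A). cohomology_class U (\<iota>' a) = \<phi> a) \<longrightarrow>
      harr_class K (cohomology A) 3 (- 1) (transfer3 (cohomology A) A \<iota> m)
        = harr_class K (cohomology A) 3 (- 1) (transfer3 (cohomology A) U \<iota>' m'))"

lemma transports_classD:
  assumes "transports_class K A U \<phi>"
    and "transfer_model K (cohomology A) A \<iota> m" "\<And>a. a \<in> carrier (cohomology A) \<Longrightarrow> cohomology_class A (\<iota> a) = a"
    and "transfer_model K (cohomology A) U \<iota>' m'" "\<And>a. a \<in> carrier (cohomology A) \<Longrightarrow> cohomology_class U (\<iota>' a) = \<phi> a"
  shows "harr_class K (cohomology A) 3 (- 1) (transfer3 (cohomology A) A \<iota> m)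
    = harr_class K (cohomology A) 3 (- 1) (transfer3 (cohomology A) U \<iota>' m')"
  using assms unfolding transports_class_def by simp

lemma transports_class_refl:
  assumes "field K" "dgca K A" shows "transports_class K A A (\<lambda>a. a)"
  unfolding transports_class_def
  by (intro conjI allI impI assms gca_iso_id harr_class_transfer3_eq[OF assms(1)]) auto

text \<open>An auxiliary model on \<open>U\<close> is compared with the model on \<open>A\<close> by
  hypothesis. Its push-forward is compared with the model on \<open>V\<close>, as both lie over the
  same identification.\<close>

lemma transports_class_forward:
  assumes K: "field K" and A: "dgca K A" and U: "transports_class K A U \<phi>" and q: "quasi_iso K U V f"
  shows "transports_class K A V (\<lambda>a. cohomology_map V f (\<phi> a))"
  unfolding transports_class_def
proof (intro conjI allI impI)
  interpret A: dgca K A by fact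
  have dU: "dgca K U" and phi: "gca_iso K (cohomology A) (cohomology U) \<phi>"
    using U by (auto simp: transports_class_def)
  show "dgca K V" using q by (simp add: quasi_iso_def)
  show "gca_iso K (cohomology A) (cohomology V) (\<lambda>a. cohomology_map V f (\<phi> a))"
    by (rule gca_iso_compose[OF phi quasi_iso_gca_iso[OF q]])
  fix \<iota> m \<iota>' m'
  assume M: "transfer_model K (cohomology A) A \<iota> m" "\<forall>a\<in>carrier (cohomology A). cohomology_class A (\<iota> a) = a"
    and M': "transfer_model K (cohomology A) V \<iota>' m'"
      "\<forall>a\<in>carrier (cohomology A). cohomology_class V (\<iota>' a) = cohomology_map V f (\<phi> a)"
  obtain \<kappa> l where L: "transfer_model K (cohomology A) U \<kappa> l"
    "\<forall>a\<in>carrier (cohomology A). cohomology_class U (\<kappa> a) = \<phi> a"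
    using ex_transfer_model[OF K A.gca_cohomology dU phi] by blast
  interpret L: transfer_model K "cohomology A" U \<kappa> l by (rule L(1))
  have "harr_class K (cohomology A) 3 (- 1) (transfer3 (cohomology A) A \<iota> m)
      = harr_class K (cohomology A) 3 (- 1) (transfer3 (cohomology A) U \<kappa> l)"
    by (rule transports_classD[OF U M(1) M(2)[rule_format] L(1) L(2)[rule_format]])
  also have "\<dots> = harr_class K (cohomology A) 3 (- 1) (transfer3 (cohomology A) V (\<lambda>a. f (\<kappa> a)) (\<lambda>a b. f (l a b)))"
    by (simp only: transfer_model_push(2)[OF q L(1)])
  also have "\<dots> = harr_class K (cohomology A) 3 (- 1) (transfer3 (cohomology A) V \<iota>' m')"
    by (rule harr_class_transfer3_eq[OF K transfer_model_push(1)[OF q L(1)] M'(1)])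
      (simp add: M'(2) L(2)[rule_format, symmetric] quasi_iso_cohomology_map[OF q L.iota_cocycle])
  finally show "harr_class K (cohomology A) 3 (- 1) (transfer3 (cohomology A) A \<iota> m)
      = harr_class K (cohomology A) 3 (- 1) (transfer3 (cohomology A) V \<iota>' m')" .
qed

text \<open>The arrow points to the algebra already reached. No auxiliary model is needed: the given
  model on \<open>V\<close> is pushed forward to \<open>U\<close>, without changing its
  cochain.\<close>

lemma transports_class_backward:
  assumes K: "field K" and A: "dgca K A" and U: "transports_class K A U \<phi>" and q: "quasi_iso K V U f"
  shows "transports_class K A V (\<lambda>a. inv_into (carrier (cohomology V)) (cohomology_map U f) (\<phi> a))"
  unfolding transports_class_def
proof (intro conjI allI impI)
  interpret A: dgca K A by fact
  have dU: "dgca K U" and phi: "gca_iso K (cohomology A) (cohomology U) \<phi>"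
    using U by (auto simp: transports_class_def)
  show dV: "dgca K V" using q by (simp add: quasi_iso_def)
  note qi = quasi_iso_gca_iso[OF q]
  let ?s = "inv_into (carrier (cohomology V)) (cohomology_map U f)"
  show "gca_iso K (cohomology A) (cohomology V) (\<lambda>a. ?s (\<phi> a))"
    by (rule gca_iso_compose[OF phi gca_iso_inverse[OF dgca.gca_cohomology[OF dV] dgca.gca_cohomology[OF dU] qi]])
  have qs: "cohomology_map U f (?s y) = y" if "y \<in> carrier (cohomology U)" for y
    using that gca_isoD(2)[OF qi] by (simp add: bij_betw_def f_inv_into_f)
  fix \<iota> m \<iota>' m'
  assume M: "transfer_model K (cohomology A) A \<iota> m" "\<forall>a\<in>carrier (cohomology A). cohomology_class A (\<iota> a) = a"
    and M': "transfer_model K (cohomology A) V \<iota>' m'"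
      "\<forall>a\<in>carrier (cohomology A). cohomology_class V (\<iota>' a) = ?s (\<phi> a)"
  interpret M': transfer_model K "cohomology A" V \<iota>' m' by (rule M'(1))
  \<comment> \<open>The inverse in the new identification is undone by \<open>f\<close>, so the
    pushed model lies over \<open>\<phi>\<close> and the hypothesis on \<open>U\<close> applies to
    it.\<close>
  have "\<forall>a\<in>carrier (cohomology A). cohomology_class U (f (\<iota>' a)) = \<phi> a"
    using M'(2) gca_homD(2)[OF gca_isoD(1)[OF phi]] qs
    by (simp add: quasi_iso_cohomology_map(2)[OF q M'.iota_cocycle, symmetric])
  from transports_classD[OF U M(1) M(2)[rule_format] transfer_model_push(1)[OF q M'(1)] this[rule_format]]
  have "harr_class K (cohomology A) 3 (- 1) (transfer3 (cohomology A) A \<iota> m)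
      = harr_class K (cohomology A) 3 (- 1) (transfer3 (cohomology A) U (\<lambda>a. f (\<iota>' a)) (\<lambda>a b. f (m' a b)))" .
  then show "harr_class K (cohomology A) 3 (- 1) (transfer3 (cohomology A) A \<iota> m)
      = harr_class K (cohomology A) 3 (- 1) (transfer3 (cohomology A) V \<iota>' m')"
    by (simp only: transfer_model_push(2)[OF q M'(1)])
qed

lemma transports_class_linked:
  assumes "field K" "dgca K A" "\<exists>\<phi>. transports_class K A U \<phi>" "quasi_iso_linked K U V"
  shows "\<exists>\<phi>. transports_class K A V \<phi>"
  using assms transports_class_forward transports_class_backward unfolding quasi_iso_linked_def by metis

lemma transports_class_zigzag:
  fixes A :: "('k, 'a) dg_algebra" and A' :: "('k, 'b) dg_algebra"
  assumes K: "field K" and A: "dgca K A" and sh: "same_homotopy_class TYPE('u) K A A'"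
  shows "\<exists>\<phi>. transports_class K A A' \<phi>"
proof -
  obtain U V :: "('k, 'u) dg_algebra" where
    UV: "quasi_iso_linked K A U" "(quasi_iso_linked K)\<^sup>*\<^sup>* U V" "quasi_iso_linked K V A'"
    using sh unfolding same_homotopy_class_def by blast
  have "\<exists>\<phi>. transports_class K A A \<phi>" using transports_class_refl[OF K A] by blast
  then have "\<exists>\<phi>. transports_class K A U \<phi>" using transports_class_linked[OF K A] UV(1) by blast
  with UV(2) have "\<exists>\<phi>. transports_class K A V \<phi>"
    by (induction rule: rtranclp_induct) (use transports_class_linked[OF K A] in blast)+
  then show ?thesis using transports_class_linked[OF K A] UV(3) by blast
qed

lemma mu3_class_HHarr:
  assumes "dgca K A" "hodge_homotopy K A n fund h"
  shows "mu3_class K A h \<in> HHarr K (cohomology A) 3 (- 1)"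
proof -
  obtain \<iota> m where M: "transfer_model K (cohomology A) A \<iota> m" "mu3 A h = transfer3 (cohomology A) A \<iota> m"
    by (rule hodge_homotopy_mu3[OF assms])
  show ?thesis
    unfolding mu3_class_def HHarr_def M(2) by (rule imageI transfer_model.transfer3_harr_cocycle[OF M(1)])+
qed

text \<open>The model from \<open>h'\<close> is indexed by the cohomology of \<open>A'\<close>.
  Reindexed along \<open>\<phi>\<close>, it becomes a model of \<open>A'\<close> over the cohomology
  of \<open>A\<close> and can be compared with the one from \<open>h\<close>.\<close>

lemma mu3_class_transport:
  assumes K: "field K" and A: "dgca K A" and A': "dgca K A'" and phi: "transports_class K A A' \<phi>"
    and h: "hodge_homotopy K A n fund h" and h': "hodge_homotopy K A' n' fund' h'"
  shows "HHarr_map (cohomology A) (cohomology A') \<phi> 3 (mu3_class K A h) = mu3_class K A' h'"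
proof -
  interpret A: dgca K A by fact
  interpret A': dgca K A' by fact
  have iso: "gca_iso K A.HA A'.HA \<phi>" using phi by (simp add: transports_class_def)
  obtain \<iota> m where M: "transfer_model K A.HA A \<iota> m" "\<forall>a\<in>carrier A.HA. A.cls (\<iota> a) = a"
    "mu3 A h = transfer3 A.HA A \<iota> m"
    by (rule hodge_homotopy_mu3[OF A h])
  obtain \<iota>' m' where M': "transfer_model K A'.HA A' \<iota>' m'" "\<forall>a\<in>carrier A'.HA. A'.cls (\<iota>' a) = a"
    "mu3 A' h' = transfer3 A'.HA A' \<iota>' m'"
    by (rule hodge_homotopy_mu3[OF A' h'])
  note N = transfer_model_iso[OF A.gca_cohomology iso M'(1)]
  let ?t = "transfer3 A.HA A' (\<lambda>a. \<iota>' (\<phi> a)) (\<lambda>a b. m' (\<phi> a) (\<phi> b))"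
  have t: "\<forall>a\<in>carrier A.HA. A'.cls (\<iota>' (\<phi> a)) = \<phi> a"
    using M'(2) gca_homD(2)[OF gca_isoD(1)[OF iso]] by blast
  have "mu3_class K A h = harr_class K A.HA 3 (- 1) ?t"
    unfolding mu3_class_def M(3)
    by (rule transports_classD[OF phi M(1) M(2)[rule_format] N(1) t[rule_format]])
  moreover have "?t \<in> tuples A.HA 3 \<rightarrow> carrier A.HA"
    using transfer_model.transfer3_CHoch[OF N(1)] by (auto simp: CHoch_def)
  ultimately show ?thesis
    by (simp only: HHarr_map_harr_class[OF A.gca_cohomology A'.gca_cohomology iso] N(2) mu3_class_def M'(3))
qed

theorem lemma3p3:
  fixes K :: "('k, 'm) ring_scheme"
    and A :: "('k, 'a) dg_algebra" and A' :: "('k, 'b) dg_algebra"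
    and n n' :: nat
    and fund :: "'a set \<Rightarrow> 'k" and fund' :: "'b set \<Rightarrow> 'k"
  assumes "field K" and "char_zero K"
    and "poincare_dgca K A n fund" and "simply_connected K A"
    and "\<exists>h. hodge_homotopy K A n fund h"
    and "poincare_dgca K A' n' fund'" and "simply_connected K A'"
    and "\<exists>h'. hodge_homotopy K A' n' fund' h'"
    and "same_homotopy_class TYPE('u) K A A'"
  shows "(\<forall>h. hodge_homotopy K A n fund h \<longrightarrow>
            mu3_class K A h \<in> HHarr K (cohomology A) 3 (- 1)) \<and>
         (\<forall>h'. hodge_homotopy K A' n' fund' h' \<longrightarrow>
            mu3_class K A' h' \<in> HHarr K (cohomology A') 3 (- 1)) \<and>
         (\<exists>\<phi>. gca_iso K (cohomology A) (cohomology A') \<phi> \<and>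
            (\<forall>h h'. hodge_homotopy K A n fund h \<longrightarrow> hodge_homotopy K A' n' fund' h' \<longrightarrow>
               HHarr_map (cohomology A) (cohomology A') \<phi> 3 (mu3_class K A h) = mu3_class K A' h'))"
proof -
  have dg: "dgca K A" "dgca K A'"
    using assms(3,6) by (simp_all add: poincare_dgca_def)
  \<comment> \<open>The isomorphism depends on the zig-zag alone, so a single one serves all pairs
    of Hodge homotopies.\<close>
  obtain \<phi> where phi: "transports_class K A A' \<phi>"
    using transports_class_zigzag[OF assms(1) dg(1) assms(9)] by blast
  then have "gca_iso K (cohomology A) (cohomology A') \<phi>"
    by (simp add: transports_class_def)
  then show ?thesis
    by (intro conjI allI impI exI[of _ \<phi>] mu3_class_HHarr[OF dg(1)] mu3_class_HHarr[OF dg(2)]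
        mu3_class_transport[OF assms(1) dg phi])
qed

end
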